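(* Let $N\ge1$, $u_0,\ldots,u_N\in\mathbb{C}$ with all arguments below avoiding the relevant lattices, $u=u_0+\cdots+u_N$, and $\widetilde M_N=M_N+\frac i2R_N$. Then (i) $-\big[\delta_{jk}\zeta_N^{k}\big]_{j,k=0}^{N-1}\widetilde M_N(u_0+1,u_1,\ldots,u_N;\tau)=\widetilde M_N(u_0,\ldots,u_N;\tau)$; (ii) $-e^{-2\pi iu/N}q^{-1/(2N)}P\,\widetilde M_N(u_0+\tau,u_1,\ldots,u_N;\tau)=\widetilde M_N(u_0,\ldots,u_N;\tau)$, with $P$ the $N\times N$ matrix satisfying $(PV)_0=V_{N-1}$, $(PV)_j=V_{j-1}$ ($1\le j\le N-1$); (iii) $e^{\pi iN/4}\big[\delta_{jk}(-1)^k\zeta_{2N}^{k^2}\big]_{j,k=0}^{N-1}\widetilde M_N(u_0,\ldots,u_N;\tau+1)=\widetilde M_N(u_0,\ldots,u_N;\tau)$; (iv) $\dfrac{(-i)^{N+1}e^{\pi iu^2/(N\tau)}}{\sqrt N\sqrt{-i\tau}}\big[\zeta_N^{-jk}\big]_{j,k=0}^{N-1}\widetilde M_N\!\left(\tfrac{u_0}{\tau},\ldots,\tfrac{u_N}{\tau};-\tfrac1\tau\right)=\widetilde M_N(u_0,\ldots,u_N;\tau)$ (principal branch of the square root).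
   Context: Fix $\tau$ with $\operatorname{Im}\tau>0$, $q=e^{2\pi i\tau}$, $q^c:=e^{2\pi ic\tau}$, $\zeta_M=e^{2\pi i/M}$, $\vartheta(u;\tau)=\sum_{\nu\in\mathbb{Z}+1/2}e^{2\pi i\nu(u+1/2)}q^{\nu^2/2}$. $\mu_N(u_0,\ldots,u_N;\tau)=\sum_{n\in\mathbb{Z}^N}\frac{e^{\pi iu_0}}{1-e^{2\pi iu_0}q^{|n|}}\prod_{j=1}^N\frac{(-1)^{n_j}e^{-2\pi in_ju_j}q^{n_j(n_j+1)/2}}{\vartheta(u_j;\tau)}$ with $|n|=\sum n_j$, and $M_N=\big[(-1)^ke^{-2\pi iku/N-\pi ik^2\tau/N}\mu_N(u_0+k\tau,u_1,\ldots,u_N;\tau)\big]_{k=0}^{N-1}$. Let $E(x)=2\int_0^xe^{-\pi z^2}dz$ and for $w\in\mathbb{C}$, $\sigma$ in the upper half plane, with $t=\operatorname{Im}\sigma$, $a=\operatorname{Im}w/\operatorname{Im}\sigma$: $R(w;\sigma)=\sum_{\nu\in\mathbb{Z}+1/2}\{\operatorname{sgn}(\nu)-E((\nu+a)\sqrt{2t})\}(-1)^{\nu-1/2}e^{-2\pi i\nu w}e^{-\pi i\nu^2\sigma}$. Then $R_N(u;\tau)=\big[(-1)^ke^{-2\pi iku/N}q^{-k^2/(2N)}R\big(u+k\tau+\tfrac{N+1}{2};N\tau\big)\big]_{k=0}^{N-1}$. *)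

theory Defs
  imports "HOL-Analysis.Analysis"
begin

text \<open>Conventions: \<open>q^c := exp(2 pi i c tau)\<close>; half-integers \<open>nu\<close> are written
  \<open>nu = m + 1/2\<close> with \<open>m\<close> an integer; points of \<open>Z^N\<close> are functions \<open>nat \<Rightarrow> int\<close>
  supported on \<open>{1..N}\<close>; vectors of length N are functions \<open>nat \<Rightarrow> complex\<close> on \<open>{0..<N}\<close>;
  the tuple \<open>(u_0,...,u_N)\<close> is a function \<open>uu :: nat \<Rightarrow> complex\<close> on \<open>{0..N}\<close>.\<close>

definition qpow :: "complex \<Rightarrow> complex \<Rightarrow> complex" where
  "qpow \<tau> c = exp (2 * of_real pi * \<i> * c * \<tau>)"

definition zeta :: "nat \<Rightarrow> complex" where
  "zeta M = exp (2 * of_real pi * \<i> / of_nat M)"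

definition theta :: "complex \<Rightarrow> complex \<Rightarrow> complex" where
  "theta u \<tau> = (\<Sum>\<^sub>\<infinity> m::int. let \<nu> = (of_int m + 1/2 :: complex) in
      exp (2 * of_real pi * \<i> * \<nu> * (u + 1/2)) * qpow \<tau> (\<nu>\<^sup>2 / 2))"

definition ZN :: "nat \<Rightarrow> (nat \<Rightarrow> int) set" where
  "ZN N = {n. \<forall>j. j \<notin> {1..N} \<longrightarrow> n j = 0}"

definition muN :: "nat \<Rightarrow> complex \<Rightarrow> (nat \<Rightarrow> complex) \<Rightarrow> complex \<Rightarrow> complex" where
  "muN N u0 uu \<tau> = (\<Sum>\<^sub>\<infinity> n \<in> ZN N.
      exp (of_real pi * \<i> * u0)
        / (1 - exp (2 * of_real pi * \<i> * u0) * qpow \<tau> (of_int (\<Sum>j\<in>{1..N}. n j)))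
      * (\<Prod>j\<in>{1..N}. (-1) powi (n j) * exp (- 2 * of_real pi * \<i> * of_int (n j) * uu j)
           * qpow \<tau> (of_int (n j * (n j + 1)) / 2) / theta (uu j) \<tau>))"

definition MN :: "nat \<Rightarrow> (nat \<Rightarrow> complex) \<Rightarrow> complex \<Rightarrow> nat \<Rightarrow> complex" where
  "MN N uu \<tau> k = (let u = (\<Sum>j\<le>N. uu j) in
     (-1) ^ k * exp (- 2 * of_real pi * \<i> * of_nat k * u / of_nat N
                      - of_real pi * \<i> * of_nat (k\<^sup>2) * \<tau> / of_nat N)
     * muN N (uu 0 + of_nat k * \<tau>) uu \<tau>)"

definition Efun :: "real \<Rightarrow> real" where
  "Efun x = (if 0 \<le> x then 2 * integral {0..x} (\<lambda>z. exp (- pi * z\<^sup>2))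
             else - 2 * integral {x..0} (\<lambda>z. exp (- pi * z\<^sup>2)))"

definition Rfun :: "complex \<Rightarrow> complex \<Rightarrow> complex" where
  "Rfun w \<sigma> = (let t = Im \<sigma>; a = Im w / Im \<sigma> in
     (\<Sum>\<^sub>\<infinity> m::int. let \<nu> = (real_of_int m + 1/2) in
        complex_of_real (sgn \<nu> - Efun ((\<nu> + a) * sqrt (2 * t))) * (-1) powi m
        * exp (- 2 * of_real pi * \<i> * of_real \<nu> * w)
        * exp (- of_real pi * \<i> * of_real (\<nu>\<^sup>2) * \<sigma>)))"

definition RN :: "nat \<Rightarrow> complex \<Rightarrow> complex \<Rightarrow> nat \<Rightarrow> complex" where
  "RN N u \<tau> k = (-1) ^ k * exp (- 2 * of_real pi * \<i> * of_nat k * u / of_nat N)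
     * qpow \<tau> (- of_nat (k\<^sup>2) / (2 * of_nat N))
     * Rfun (u + of_nat k * \<tau> + (of_nat N + 1) / 2) (of_nat N * \<tau>)"

definition MtN :: "nat \<Rightarrow> (nat \<Rightarrow> complex) \<Rightarrow> complex \<Rightarrow> nat \<Rightarrow> complex" where
  "MtN N uu \<tau> k = MN N uu \<tau> k + \<i> / 2 * RN N (\<Sum>j\<le>N. uu j) \<tau> k"

definition matvec :: "nat \<Rightarrow> (nat \<Rightarrow> nat \<Rightarrow> complex) \<Rightarrow> (nat \<Rightarrow> complex) \<Rightarrow> nat \<Rightarrow> complex" where
  "matvec N A V j = (\<Sum>k<N. A j k * V k)"

definition Pmat :: "nat \<Rightarrow> nat \<Rightarrow> nat \<Rightarrow> complex" where
  "Pmat N j k = (if k = (if j = 0 then N - 1 else j - 1) then 1 else 0)"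

definition lattice :: "complex \<Rightarrow> complex set" where
  "lattice \<tau> = {of_int a + of_int b * \<tau> | a b. True}"

end

theory Submission
  imports Defs "HOL-Complex_Analysis.Complex_Analysis" "HOL-Probability.Distributions" "HOL-Real_Asymp.Real_Asymp"
begin

text \<open>
  Parts (i) and (iii), and (ii) apart from the component \<open>j = 0\<close>, are termwise computations. The
  remaining component of (ii) holds because the failures of \<open>M\<^sub>N\<close> and \<open>R\<^sub>N\<close> to be quasiperiodic
  under \<open>u\<^sub>0 \<mapsto> u\<^sub>0 + N\<tau>\<close> cancel.

  For (iv), (ii) reduces the claim to the component \<open>j = 0\<close>. The difference \<open>F(u\<^sub>0)\<close> of the
  two sides changes sign under \<open>u\<^sub>0 \<mapsto> u\<^sub>0 + 1\<close> and is multiplied by \<open>(-1)\<^sup>N e\<^bsup>2\<pi>iu\<^esup> q\<^bsup>N/2\<^esup>\<close> under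
  \<open>u\<^sub>0 \<mapsto> u\<^sub>0 + N\<tau>\<close>, by (i) and (ii) at \<open>\<tau>\<close> and at \<open>-1/\<tau>\<close>. An entire function with such a
  negative-degree law vanishes, as its Fourier coefficients would grow. So it suffices that \<open>F\<close> is
  entire. Its nonholomorphic part is a line integral from \<open>0\<close> to the conjugate of \<open>u\<close> whose kernel
  is a unary theta function, and it cancels by the Jacobi transformation. Its poles are simple and
  lie on the lattice; their residues cancel because \<open>\<mu>\<^sub>N\<close> is an Appell sum over the
  Fourier coefficients of \<open>x \<mapsto> \<Prod>\<^sub>j \<theta>(u\<^sub>j + x)\<close>, and comparing this product at \<open>\<tau>\<close> and \<open>-1/\<tau>\<close>,
  averaged over \<open>x \<mapsto> x + r/N\<close>, gives the required relation between the coefficients.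
\<close>

text \<open>In (iv) the difference of the two completing series is never computed: it is enough that
  it is entire in \<open>u\<close>, since the vanishing argument then disposes of everything at
  once. What makes a vector of length N tractable is that row 0 of the matrix in (iv) consists of
  ones. The N components of R at -1/\<tau> are then summed with equal weight and interleave, through
  the index l = N m + k, into one series of modulus -1/(N \<tau>), the image under inversion of the
  modulus N \<tau> of component 0. So a comparison of two scalar series suffices. All modularity
  comes from one Jacobi transformation in one variable. It enters three times: for the theta
  denominators, for the kernel of the nonholomorphic part (at minus the conjugate modulus), and for
  the coefficients that govern the residues (at modulus N \<tau>). The factor i/2 in front of R is
  dictated by (ii): the sign function jumps by 2, while the Appell sum misses quasiperiodicity by a
  single exponential, because the theta product it produces cancels against the
  denominators.\<close>

abbreviation (input) pi_i :: complex where "pi_i \<equiv> of_real pi * \<i>"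

abbreviation (input) neg_pi_i :: complex where "neg_pi_i \<equiv> - of_real pi * \<i>"

abbreviation (input) two_pi_i :: complex where "two_pi_i \<equiv> 2 * of_real pi * \<i>"

abbreviation (input) neg_two_pi_i :: complex where "neg_two_pi_i \<equiv> - 2 * of_real pi * \<i>"

section \<open>Entire periodic functions\<close>

text \<open>Weierstrass' theorem for unordered sums. The majorant is local because in the
  applications bounds deteriorate near poles or near the real axis of the modulus.\<close>

lemma holomorphic_on_infsum:
  fixes f :: "'a \<Rightarrow> complex \<Rightarrow> complex"
  assumes hol: "\<And>x. x \<in> X \<Longrightarrow> f x holomorphic_on S"
    and bd: "\<And>z. z \<in> S \<Longrightarrow> \<exists>r>0. \<exists>M. cball z r \<subseteq> S \<and> M summable_on X \<and>
               (\<forall>x\<in>X. \<forall>y\<in>cball z r. norm (f x y) \<le> M x)"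
  shows "(\<lambda>z. \<Sum>\<^sub>\<infinity>x\<in>X. f x z) holomorphic_on S"
proof (rule analytic_imp_holomorphic, subst analytic_on_def, intro ballI)
  fix z assume "z \<in> S"
  with bd obtain r M where r: "r > 0" "cball z r \<subseteq> S" "M summable_on X"
    "\<And>x y. x \<in> X \<Longrightarrow> y \<in> cball z r \<Longrightarrow> norm (f x y) \<le> M x" by meson
  have ul: "uniform_limit (cball z r) (\<lambda>Y y. \<Sum>x\<in>Y. f x y) (\<lambda>y. \<Sum>\<^sub>\<infinity>x\<in>X. f x y) (finite_subsets_at_top X)"
    by (rule Weierstrass_m_test_general) (use r in auto)
  have ev: "eventually (\<lambda>Y. continuous_on (cball z r) (\<lambda>y. \<Sum>x\<in>Y. f x y) \<and>
      (\<lambda>y. \<Sum>x\<in>Y. f x y) holomorphic_on ball z r) (finite_subsets_at_top X)"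
  proof (rule eventually_finite_subsets_at_top_weakI)
    fix Y assume "finite Y" "Y \<subseteq> X"
    then have "(\<lambda>y. \<Sum>x\<in>Y. f x y) holomorphic_on S"
      by (intro holomorphic_intros hol) auto
    then show "continuous_on (cball z r) (\<lambda>y. \<Sum>x\<in>Y. f x y) \<and>
      (\<lambda>y. \<Sum>x\<in>Y. f x y) holomorphic_on ball z r"
      using r(2) ball_subset_cball holomorphic_on_imp_continuous_on holomorphic_on_subset
      by (metis order_trans)
  qed
  have "(\<lambda>z. \<Sum>\<^sub>\<infinity>x\<in>X. f x z) holomorphic_on ball z r"
    by (rule holomorphic_uniform_limit[OF ev ul]) auto
  then show "\<exists>e>0. (\<lambda>z. \<Sum>\<^sub>\<infinity>x\<in>X. f x z) holomorphic_on ball z e" using r(1) by blast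
qed

text \<open>Riemann's removable singularity theorem at all points of a closed discrete set at once.
  The limit condition says that an at most simple pole has residue zero, so poles can be removed by
  matching limits.\<close>

lemma entire_extension:
  fixes f :: "complex \<Rightarrow> complex"
  assumes hol: "f holomorphic_on - S" and clS: "closed S"
    and isol: "\<And>p. p \<in> S \<Longrightarrow> \<exists>r>0. ball p r \<inter> S \<subseteq> {p}"
    and lim: "\<And>p. p \<in> S \<Longrightarrow> ((\<lambda>z. (z - p) * f z) \<longlongrightarrow> 0) (at p)"
  obtains g where "g holomorphic_on UNIV" "\<And>z. z \<notin> S \<Longrightarrow> g z = f z"
proof -
  have op: "open (- S)" using clS by auto
  have an: "f analytic_on - S" using hol op analytic_on_open by blast
  have an1: "f analytic_on {z}" if "z \<notin> S" for z
    using an analytic_on_subset[of f "-S" "{z}"] that by auto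
  have "remove_sings f analytic_on {z}" for z
  proof (cases "z \<in> S")
    case False
    then show ?thesis using an1 remove_sings_analytic_on by blast
  next
    case True
    with isol obtain r where r: "r > 0" "ball z r \<inter> S \<subseteq> {z}" by blast
    have hb: "f holomorphic_on ball z r - {z}"
      using hol r by (rule_tac holomorphic_on_subset) auto
    then obtain h where h: "h holomorphic_on ball z r" "\<forall>w\<in>ball z r - {z}. h w = f w"
      using holomorphic_on_extend_lim[of f "ball z r" z] lim[OF True] r(1) by auto
    have "isCont h z" using h(1) r(1)
      by (metis centre_in_ball continuous_on_eq_continuous_at holomorphic_on_imp_continuous_on open_ball)
    then have "(h \<longlongrightarrow> h z) (at z)" by (simp add: isCont_def)
    moreover have "eventually (\<lambda>w. h w = f w) (at z)"
      using h(2) r(1) eventually_at_in_open[of "ball z r" z]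
      by (auto elim!: eventually_mono)
    ultimately have lm: "(f \<longlongrightarrow> h z) (at z)"
      using tendsto_cong by blast
    have "isolated_singularity_at f z"
      using hb r(1) by (metis analytic_on_open isolated_singularity_at_def open_ball open_delete)
    then show ?thesis using lm remove_sings_analytic_at by blast
  qed
  then have "remove_sings f analytic_on UNIV" by (metis analytic_on_analytic_at)
  then have "remove_sings f holomorphic_on UNIV" using analytic_imp_holomorphic by blast
  moreover have "remove_sings f z = f z" if "z \<notin> S" for z using an1[OF that] by simp
  ultimately show thesis using that by blast
qed

text \<open>A countable set has empty interior, so its complement is dense. This carries functional
  equations proved off the singular set over to entire extensions.\<close>

lemma continuous_eq_off_countable:
  fixes f g :: "complex \<Rightarrow> complex"
  assumes S: "countable S" and f: "continuous_on UNIV f" and g: "continuous_on UNIV g"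
    and eq: "\<And>z. z \<notin> S \<Longrightarrow> f z = g z"
  shows "f z = g z"
proof -
  have "interior S = {}"
  proof (rule ccontr)
    assume "interior S \<noteq> {}"
    then obtain x r where "r > 0" "ball x r \<subseteq> S" using mem_interior by blast
    then show False using S countable_subset uncountable_ball by blast
  qed
  then have cl: "closure (- S) = UNIV" by (simp add: closure_complement)
  have "(\<lambda>z. f z - g z) z = 0"
    by (rule continuous_constant_on_closure[of "- S" "\<lambda>z. f z - g z"])
      (use cl eq in \<open>auto intro!: continuous_intros f g\<close>)
  then show ?thesis by simp
qed

lemma holomorphic_on_compose_entire:
  assumes "f holomorphic_on UNIV" "g holomorphic_on A"
  shows "(\<lambda>z. f (g z)) holomorphic_on A"
  using holomorphic_on_compose_gen[OF assms(2,1)] by (simp add: o_def)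

text \<open>The derivative in \<open>s\<close> is the integral of the derivative of \<open>D\<close>
  over a full period, hence zero. As \<open>s\<close> is complex, the line of integration moves
  vertically as well as horizontally.\<close>

lemma integral_periodic_shift:
  fixes D :: "complex \<Rightarrow> complex"
  assumes hol: "D holomorphic_on UNIV" and per: "\<And>z. D (z + 1) = D z"
  shows "integral {0..1} (\<lambda>x. D (of_real x + s)) = integral {0..1} (\<lambda>x. D (of_real x))"
proof -
  have cD: "continuous_on UNIV (deriv D)" "continuous_on UNIV D"
    using hol holomorphic_deriv holomorphic_on_imp_continuous_on open_UNIV by blast+
  have dD: "(D has_field_derivative deriv D z) (at z)" for z
    using hol holomorphic_derivI open_UNIV by blast
  have J: "((\<lambda>s. integral (cbox 0 1) (\<lambda>x::real. D (of_real x + s))) has_field_derivative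
      integral (cbox 0 1) (\<lambda>x::real. deriv D (of_real x + s))) (at s within UNIV)" for s
  proof (rule leibniz_rule_field_derivative)
    show "((\<lambda>s. D (of_real t + s)) has_field_derivative deriv D (of_real t + x)) (at x within UNIV)"
      for x and t :: real
      by (rule DERIV_chain2[where g = "\<lambda>s. of_real t + s" and Db = 1, simplified, OF dD])
        (auto intro!: derivative_eq_intros)
    show "(\<lambda>xa::real. D (of_real xa + x)) integrable_on cbox 0 1" for x
      by (intro integrable_continuous continuous_on_compose2[OF cD(2)] continuous_intros) auto
    show "continuous_on (UNIV \<times> cbox 0 (1::real)) (\<lambda>(x, t). deriv D (of_real t + x))"
      unfolding split_beta
      by (intro continuous_on_compose2[OF cD(1)] continuous_intros) auto
  qed auto
  have "integral (cbox 0 1) (\<lambda>x::real. deriv D (of_real x + s)) = 0" for s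
  proof -
    have "((\<lambda>x::real. deriv D (of_real x + s)) has_integral D (of_real 1 + s) - D (of_real 0 + s)) {0..1}"
    proof (rule fundamental_theorem_of_calculus)
      fix x :: real
      have "((\<lambda>x. D (x + s)) has_field_derivative deriv D (of_real x + s)) (at (of_real x))"
        by (rule DERIV_chain2[where g = "\<lambda>x. x + s" and Db = 1, simplified, OF dD])
        (auto intro!: derivative_eq_intros)
      then show "((\<lambda>x. D (of_real x + s)) has_vector_derivative deriv D (of_real x + s)) (at x within {0..1})"
        using has_vector_derivative_real_field[of "\<lambda>x. D (x + s)"] by blast
    qed auto
    moreover have "D (of_real 1 + s) = D (of_real 0 + s)" using per[of s] by (simp add: add.commute)
    ultimately show ?thesis by (simp add: integral_unique)
  qed
  with J have "((\<lambda>s. integral (cbox 0 1) (\<lambda>x::real. D (of_real x + s))) has_field_derivative 0) (at s)" for s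
    by (metis)
  then obtain c where "\<And>s. integral (cbox 0 1) (\<lambda>x::real. D (of_real x + s)) = c"
    using has_field_derivative_zero_constant[of UNIV "\<lambda>s. integral (cbox 0 1) (\<lambda>x::real. D (of_real x + s))"]
    by auto
  from this[of s] this[of 0] show ?thesis by simp
qed

definition fourier_coeff :: "(complex \<Rightarrow> complex) \<Rightarrow> int \<Rightarrow> complex" where
  "fourier_coeff D n = integral {0..1} (\<lambda>x. D (of_real x) * exp (neg_two_pi_i * of_int n * of_real x))"

lemma exp_2pi_int [simp]: "exp (two_pi_i * of_int n) = 1"
  using exp_integer_2pi[of "of_int n"] by (simp add: mult_ac)

lemma fourier_coeff_shift:
  fixes D :: "complex \<Rightarrow> complex"
  assumes hol: "D holomorphic_on UNIV" and per: "\<And>z. D (z + 1) = D z"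
  shows "fourier_coeff D n =
    integral {0..1} (\<lambda>x. D (of_real x + s) * exp (neg_two_pi_i * of_int n * (of_real x + s)))"
proof -
  let ?G = "\<lambda>z. D z * exp (neg_two_pi_i * of_int n * z)"
  have "?G (z + 1) = ?G z" for z
  proof -
    have "exp (neg_two_pi_i * of_int n * (z + 1)) =
       exp (neg_two_pi_i * of_int n * z) * exp (two_pi_i * of_int (- n))"
      unfolding exp_add[symmetric] by (simp add: algebra_simps)
    then show ?thesis unfolding exp_2pi_int using per by simp
  qed
  moreover have "?G holomorphic_on UNIV" by (intro holomorphic_intros hol)
  ultimately have "integral {0..1} (\<lambda>x. ?G (of_real x + s)) = integral {0..1} (\<lambda>x. ?G (of_real x))"
    by (rule integral_periodic_shift[rotated])
  then show ?thesis unfolding fourier_coeff_def by simp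
qed


lemma continuous_on_of_real_line:
  assumes "D holomorphic_on UNIV"
  shows "continuous_on A (\<lambda>x::real. D (of_real x + s))"
  by (rule continuous_on_compose2[OF holomorphic_on_imp_continuous_on[OF assms]])
    (auto intro!: continuous_intros)

lemma bounded_on_segment:
  assumes "D holomorphic_on UNIV"
  obtains K where "\<And>x::real. x \<in> {0..1} \<Longrightarrow> norm (D (of_real x + s)) \<le> K"
proof -
  have "compact ((\<lambda>x::real. D (of_real x + s)) ` {0..1})"
    by (intro compact_continuous_image continuous_on_of_real_line assms) auto
  then obtain K where "\<forall>y \<in> (\<lambda>x::real. D (of_real x + s)) ` {0..1}. norm y \<le> K"
    using compact_imp_bounded bounded_iff by metis
  then show thesis using that[of K] by blast
qed

text \<open>The coefficient is evaluated on the horizontal line of height \<open>s\<close>. The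
  height is free, so it can be chosen to suit the sign of \<open>n\<close>.\<close>

lemma norm_fourier_coeff_le:
  assumes hol: "D holomorphic_on UNIV" and per: "\<And>z. D (z + 1) = D z"
    and K: "\<And>x::real. x \<in> {0..1} \<Longrightarrow> norm (D (of_real x + \<i> * of_real s)) \<le> K"
  shows "norm (fourier_coeff D n) \<le> K * exp (2 * pi * of_int n * s)"
proof -
  have "norm (integral {0..1} (\<lambda>x. D (of_real x + \<i> * of_real s) *
      exp (neg_two_pi_i * of_int n * (of_real x + \<i> * of_real s)))) \<le>
      (K * exp (2 * pi * of_int n * s)) * (1 - 0)"
  proof (rule integral_bound)
    show "continuous_on {0..1} (\<lambda>x. D (of_real x + \<i> * of_real s) *
      exp (neg_two_pi_i * of_int n * (of_real x + \<i> * of_real s)))"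
      by (intro continuous_intros continuous_on_of_real_line hol)
  next
    fix x :: real assume "x \<in> {0..1}"
    moreover have "norm (exp (neg_two_pi_i * of_int n * (of_real x + \<i> * of_real s))) =
        exp (2 * pi * of_int n * s)"
      by (simp add: algebra_simps)
    ultimately show "norm (D (of_real x + \<i> * of_real s) *
      exp (neg_two_pi_i * of_int n * (of_real x + \<i> * of_real s))) \<le> K * exp (2 * pi * of_int n * s)"
      using K[of x] by (simp add: norm_mult)
  qed auto
  then show ?thesis using fourier_coeff_shift[OF hol per, of n "\<i> * of_real s"] by simp
qed

lemma fourier_coeff_decay:
  assumes hol: "D holomorphic_on UNIV" and per: "\<And>z. D (z + 1) = D z"
  shows "(\<lambda>n::nat. fourier_coeff D (int n)) \<longlonglongrightarrow> 0" "(\<lambda>n::nat. fourier_coeff D (- int n)) \<longlonglongrightarrow> 0"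
proof -
  \<comment> \<open>Height -1 gives the factor exp (- 2 pi n), which decays for positive indices;
    height 1 serves the negative ones below.\<close>
  obtain K where K: "\<And>x::real. x \<in> {0..1} \<Longrightarrow> norm (D (of_real x + \<i> * of_real (-1))) \<le> K"
    using bounded_on_segment[OF hol] by metis
  have "(\<lambda>n::nat. K * exp (2 * pi * of_int (int n) * (-1))) \<longlonglongrightarrow> 0" by real_asymp
  then show "(\<lambda>n::nat. fourier_coeff D (int n)) \<longlonglongrightarrow> 0"
    by (rule Lim_null_comparison[rotated])
      (rule always_eventually, rule allI, rule norm_fourier_coeff_le[OF hol per K])
  obtain K where K: "\<And>x::real. x \<in> {0..1} \<Longrightarrow> norm (D (of_real x + \<i> * of_real 1)) \<le> K"
    using bounded_on_segment[OF hol] by metis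
  have "(\<lambda>n::nat. K * exp (2 * pi * of_int (- int n) * 1)) \<longlonglongrightarrow> 0" by real_asymp
  then show "(\<lambda>n::nat. fourier_coeff D (- int n)) \<longlonglongrightarrow> 0"
    by (rule Lim_null_comparison[rotated])
      (rule always_eventually, rule allI, rule norm_fourier_coeff_le[OF hol per K])
qed

lemma fourier_coeff_const: "fourier_coeff (\<lambda>_. c) n = (if n = 0 then c else 0)"
proof (cases "n = 0")
  case False
  let ?k = "neg_two_pi_i * of_int n :: complex"
  have k: "?k \<noteq> 0" using False by simp
  have "((\<lambda>x::real. c * exp (?k * of_real x)) has_integral (c * exp (?k * of_real 1) / ?k - c * exp (?k * of_real 0) / ?k)) {0..1}"
  proof (rule fundamental_theorem_of_calculus)
    fix x :: real
    have "((\<lambda>x. c * exp (?k * x) / ?k) has_field_derivative c * exp (?k * of_real x)) (at (of_real x))"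
      using k by (auto intro!: derivative_eq_intros simp del: mult_minus_left)
    then show "((\<lambda>x::real. c * exp (?k * of_real x) / ?k) has_vector_derivative c * exp (?k * of_real x)) (at x within {0..1})"
      using has_vector_derivative_real_field by blast
  qed auto
  moreover have "exp (?k * of_real 1) = 1" using exp_2pi_int[of "-n"] by simp
  ultimately have "((\<lambda>x::real. c * exp (?k * of_real x)) has_integral 0) {0..1}" by simp
  then show ?thesis using False unfolding fourier_coeff_def by (metis integral_unique)
qed (simp add: fourier_coeff_def)

lemma fourier_coeff_diff:
  assumes "D holomorphic_on UNIV" "E holomorphic_on UNIV"
  shows "fourier_coeff (\<lambda>z. D z - E z) n = fourier_coeff D n - fourier_coeff E n"
proof -
  have "fourier_coeff D n - fourier_coeff E n = integral {0..1} (\<lambda>x.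
      D (of_real x) * exp (neg_two_pi_i * of_int n * of_real x) -
      E (of_real x) * exp (neg_two_pi_i * of_int n * of_real x))"
    unfolding fourier_coeff_def
    using continuous_on_of_real_line[OF assms(1), of _ 0] continuous_on_of_real_line[OF assms(2), of _ 0]
    by (intro integral_diff[symmetric] integrable_continuous_real continuous_intros) auto
  then show ?thesis unfolding fourier_coeff_def by (simp add: algebra_simps)
qed

lemma exp_2pi_eq_1_iff: "exp (two_pi_i * z) = 1 \<longleftrightarrow> z \<in> \<int>"
proof -
  have "exp (two_pi_i * z) = 1 \<longleftrightarrow> (\<exists>n::int. Re z = of_int n \<and> Im z = 0)"
    unfolding exp_eq_1 by (simp add: mult.commute) (metis mult.commute mult_cancel_left pi_neq_zero)
  also have "\<dots> \<longleftrightarrow> z \<in> \<int>"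
    by (auto simp: complex_is_Int_iff Ints_def complex_eq_iff)
  finally show ?thesis .
qed

text \<open>Chernoff's argument: D - D(0) vanishes at all integers, which are exactly the simple
  zeros of \<open>exp (2 pi i z) - 1\<close>, so the quotient is again entire and periodic and has
  decaying coefficients.\<close>

lemma fourier_unique_at_0:
  assumes hol: "D holomorphic_on UNIV" and per: "\<And>z. D (z + 1) = D z"
    and c0: "\<And>n. fourier_coeff D n = 0"
  shows "D 0 = 0"
proof -
  let ?e = "\<lambda>z. exp (two_pi_i * z)"
  have e1: "?e z = 1 \<longleftrightarrow> z \<in> \<int>" for z by (rule exp_2pi_eq_1_iff)
  have perI: "D (of_int m) = D 0" for m
  proof -
    have "D (of_nat k) = D 0 \<and> D (- of_nat k) = D 0" for k
    proof (induction k)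
      case (Suc k)
      then show ?case using per[of "of_nat k"] per[of "- of_nat (Suc k)"] by (simp add: add.commute)
    qed simp
    then show ?thesis by (cases m rule: int_cases2) auto
  qed
  obtain g where g: "g holomorphic_on UNIV" "\<And>z. z \<notin> \<int> \<Longrightarrow> g z = (D z - D 0) / (?e z - 1)"
  proof (rule entire_extension[of "\<lambda>z. (D z - D 0) / (?e z - 1)" "\<int>"])
    show "(\<lambda>z. (D z - D 0) / (?e z - 1)) holomorphic_on - \<int>"
      using e1 by (intro holomorphic_intros holomorphic_on_subset[OF hol]) auto
    show "closed (\<int> :: complex set)" by (rule closed_Ints)
    fix p :: complex assume p: "p \<in> \<int>"
    show "\<exists>r>0. ball p r \<inter> \<int> \<subseteq> {p}"
    proof (intro exI conjI subsetI)
      fix z assume "z \<in> ball p 1 \<inter> \<int>"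
      then obtain a b where ab: "p = of_int a" "z = of_int b" "dist p z < 1"
        using p by (auto elim!: Ints_cases)
      have "dist p z = norm (of_int (a - b) :: complex)" using ab by (simp add: dist_norm)
      then have "\<bar>real_of_int (a - b)\<bar> < 1" using ab(3) unfolding norm_of_int by simp
      then have "a = b" by linarith
      then show "z \<in> {p}" using ab by simp
    qed auto
    obtain m where m: "p = of_int m" using p Ints_cases by blast
    have "(?e has_field_derivative two_pi_i * ?e p) (at p)"
      by (auto intro!: derivative_eq_intros)
    then have "((\<lambda>z. (?e z - ?e p) / (z - p)) \<longlongrightarrow> two_pi_i * ?e p) (at p)"
      by (simp only: has_field_derivative_iff)
    then have d: "((\<lambda>z. (?e z - 1) / (z - p)) \<longlongrightarrow> two_pi_i) (at p)"
      using m by simp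
    have "isCont D p" using hol
      by (metis UNIV_I continuous_on_eq_continuous_at holomorphic_on_imp_continuous_on open_UNIV)
    then have "(D \<longlongrightarrow> D 0) (at p)" using perI[of m] m by (simp add: isCont_def)
    then have "((\<lambda>z. (D z - D 0) / ((?e z - 1) / (z - p))) \<longlongrightarrow> (D 0 - D 0) / (two_pi_i)) (at p)"
      by (intro tendsto_divide tendsto_diff tendsto_const d) auto
    then show "((\<lambda>z. (z - p) * ((D z - D 0) / (?e z - 1))) \<longlongrightarrow> 0) (at p)"
      by (simp add: mult.commute)
  qed blast
  have ge: "D z - D 0 = g z * (?e z - 1)" for z
  proof (cases "z \<in> \<int>")
    case True then show ?thesis using e1[of z] perI by (auto elim: Ints_cases)
  next
    case False then show ?thesis using g(2)[OF False] e1[of z] by simp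
  qed
  have cd: "continuous_on UNIV g" using g(1) holomorphic_on_imp_continuous_on by blast
  have gper: "g (z + 1) = g z" for z
  proof (rule continuous_eq_off_countable[of "\<int>" "\<lambda>z. g (z + 1)"])
    show "countable (\<int> :: complex set)" using countable_int by (simp add: Ints_def)
    show "continuous_on UNIV (\<lambda>z. g (z + 1))"
      by (intro continuous_on_compose2[OF cd] continuous_intros) auto
    show "g (z + 1) = g z" if "z \<notin> \<int>" for z
    proof -
      have "z + 1 \<notin> \<int>" using that by (metis Ints_1 Ints_diff add_diff_cancel_right')
      moreover have "?e (z + 1) = ?e z" by (simp add: ring_distribs exp_add)
      ultimately show ?thesis using g(2) that per by simp
    qed
  qed (rule cd)
  \<comment> \<open>The coefficients of \<open>g\<close> jump only at \<open>n = 0\<close>, by \<open>D 0\<close>, and tend to \<open>0\<close> at both ends.\<close>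
  have rel: "fourier_coeff g (n - 1) - fourier_coeff g n = (if n = 0 then - D 0 else 0)" for n
  proof -
    have "fourier_coeff g (n - 1) = fourier_coeff (\<lambda>z. g z * ?e z) n"
      unfolding fourier_coeff_def by (intro integral_cong) (simp add: exp_add[symmetric] algebra_simps)
    then have "fourier_coeff g (n - 1) - fourier_coeff g n = fourier_coeff (\<lambda>z. g z * ?e z - g z) n"
      using g(1) by (subst fourier_coeff_diff) (auto intro!: holomorphic_intros)
    also have "(\<lambda>z. g z * ?e z - g z) = (\<lambda>z. D z - D 0)" using ge by (auto simp: algebra_simps)
    finally show ?thesis using c0 hol by (simp add: fourier_coeff_diff fourier_coeff_const)
  qed
  have "fourier_coeff g (int n) = fourier_coeff g 0" for n
  proof (induction n)
    case (Suc n) then show ?case using rel[of "int (Suc n)"] by simp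
  qed simp
  with fourier_coeff_decay(1)[OF g(1) gper] have a: "fourier_coeff g 0 = 0"
    by (simp add: LIMSEQ_const_iff)
  have "fourier_coeff g (- int (Suc n)) = fourier_coeff g (-1)" for n
  proof (induction n)
    case (Suc n) then show ?case using rel[of "- int (Suc n)"] by (simp add: algebra_simps)
  qed simp
  with LIMSEQ_Suc[OF fourier_coeff_decay(2)[OF g(1) gper]] have b: "fourier_coeff g (-1) = 0"
    by (simp add: LIMSEQ_const_iff)
  show ?thesis using rel[of 0] a b by simp
qed

lemma fourier_unique:
  assumes hol: "D holomorphic_on UNIV" and per: "\<And>z. D (z + 1) = D z"
    and c0: "\<And>n. fourier_coeff D n = 0"
  shows "D z = 0"
proof -
  have "(\<lambda>w. D (w + z)) 0 = 0"
  proof (rule fourier_unique_at_0)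
    show "(\<lambda>w. D (w + z)) holomorphic_on UNIV"
      by (intro holomorphic_on_compose_entire[OF hol] holomorphic_intros)
    show "D (w + 1 + z) = D (w + z)" for w using per[of "w + z"] by (simp add: algebra_simps)
    fix n
    have "0 = integral {0..1} (\<lambda>x. D (of_real x + z) * exp (neg_two_pi_i * of_int n * (of_real x + z)))"
      using fourier_coeff_shift[OF hol per, of n z] c0 by simp
    also have "\<dots> = integral {0..1} (\<lambda>x. D (of_real x + z) * exp (neg_two_pi_i * of_int n * of_real x) * exp (neg_two_pi_i * of_int n * z))"
      by (intro integral_cong) (simp add: exp_add[symmetric] ring_distribs)
    also have "\<dots> = fourier_coeff (\<lambda>w. D (w + z)) n * exp (neg_two_pi_i * of_int n * z)"
      unfolding fourier_coeff_def by (rule integral_mult_left)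
    finally show "fourier_coeff (\<lambda>w. D (w + z)) n = 0" by simp
  qed
  then show ?thesis by simp
qed

section \<open>Gaussian series\<close>

lemma summable_on_int_exp_abs: "(\<lambda>n::int. exp (- \<bar>of_int n\<bar>) :: real) summable_on UNIV"
proof -
  have g: "(\<lambda>n::nat. exp (- real n)) summable_on UNIV"
  proof (rule norm_summable_imp_summable_on)
    have "summable (\<lambda>n. exp (-1::real) ^ n)" by (rule summable_geometric) simp
    then show "summable (\<lambda>n. norm (exp (- real n)))" by (simp add: exp_of_nat_mult[symmetric])
  qed
  have "(\<lambda>n::int. exp (- \<bar>of_int n\<bar>) :: real) summable_on (range int)"
    by (subst summable_on_reindex) (auto simp: o_def g inj_on_def)
  moreover have "(\<lambda>n::int. exp (- \<bar>of_int n\<bar>) :: real) summable_on (range (\<lambda>n. - int n))"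
    by (subst summable_on_reindex) (auto simp: o_def g inj_on_def)
  ultimately have "(\<lambda>n::int. exp (- \<bar>of_int n\<bar>) :: real) summable_on (range int \<union> range (\<lambda>n. - int n))"
    by (rule summable_on_union)
  also have "range int \<union> range (\<lambda>n. - int n) = UNIV"
    by (auto, metis int_cases2 rangeI)
  finally show ?thesis .
qed

lemma summable_on_int_gauss:
  assumes "y > 0"
  shows "(\<lambda>n::int. K * exp (- y * of_int n ^ 2 + B * \<bar>of_int n\<bar> + C) :: real) summable_on UNIV"
proof -
  have "(\<lambda>n::int. exp (- y * of_int n ^ 2 + B * \<bar>of_int n\<bar> + C) :: real) summable_on UNIV"
  proof (rule summable_on_comparison_test)
    show "(\<lambda>n::int. exp (C + (B + 1)\<^sup>2 / (4 * y)) * exp (- \<bar>of_int n\<bar>) :: real) summable_on UNIV"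
      by (intro summable_on_cmult_right summable_on_int_exp_abs)
    fix n :: int
    define a where "a = \<bar>of_int n :: real\<bar>"
    \<comment> \<open>Completing the square absorbs the linear term together with one extra copy of
      |n|; that copy supplies the summable factor \<open>exp (- |n|)\<close>.\<close>
    have "0 \<le> (2 * y * a - (B + 1))\<^sup>2 / (4 * y)" using assms by simp
    also have "\<dots> = y * a\<^sup>2 - (B + 1) * a + (B + 1)\<^sup>2 / (4 * y)"
      using assms by (simp add: field_simps power2_eq_square)
    finally have "- y * a\<^sup>2 + B * a + C \<le> C + (B + 1)\<^sup>2 / (4 * y) + (- a)"
      by (simp add: algebra_simps)
    moreover have "a\<^sup>2 = of_int n ^ 2" by (simp add: a_def)
    ultimately show "exp (- y * of_int n ^ 2 + B * \<bar>of_int n\<bar> + C) \<le> exp (C + (B + 1)\<^sup>2 / (4 * y)) * exp (- \<bar>of_int n\<bar>)"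
      unfolding exp_add[symmetric] a_def by (metis exp_le_cancel_iff)
  qed auto
  then show ?thesis by (rule summable_on_cmult_right)
qed

text \<open>Every series below is rewritten into this shape, so that convergence and holomorphy are checked once.\<close>

definition gterm :: "complex \<Rightarrow> complex \<Rightarrow> complex \<Rightarrow> int \<Rightarrow> complex" where
  "gterm a b c n = exp (a * of_int n ^ 2 + b * of_int n + c)"

lemma norm_gterm_le:
  assumes "Re a \<le> - y" "norm b \<le> B" "Re c \<le> C"
  shows "norm (gterm a b c n) \<le> exp (- y * of_int n ^ 2 + B * \<bar>of_int n\<bar> + C)"
proof -
  have "Re a * of_int n ^ 2 \<le> - y * of_int n ^ 2"
    using assms(1) by (intro mult_right_mono) auto
  moreover have "Re b * of_int n \<le> B * \<bar>of_int n\<bar>"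
  proof -
    have "Re b * of_int n \<le> \<bar>Re b\<bar> * \<bar>of_int n\<bar>" by (metis abs_ge_self abs_mult)
    also have "\<dots> \<le> B * \<bar>of_int n\<bar>"
      using assms(2) abs_Re_le_cmod[of b] by (intro mult_right_mono) auto
    finally show ?thesis .
  qed
  moreover have "a * of_int n ^ 2 = a * of_real (of_int n ^ 2)" by simp
  moreover have "Re (a * of_real (of_int n ^ 2)) = Re a * of_int n ^ 2" by simp
  ultimately show ?thesis using assms(3) unfolding gterm_def by (simp del: of_real_power of_real_of_int_eq)
qed

lemma gterm_abs_summable:
  assumes "Re a < 0" and K: "\<And>n. norm (k n) \<le> K"
  shows "(\<lambda>n. norm (k n * gterm a b c n)) summable_on UNIV"
proof (rule summable_on_comparison_test)
  show "(\<lambda>n::int. K * exp (- (- Re a) * of_int n ^ 2 + norm b * \<bar>of_int n\<bar> + Re c)) summable_on UNIV"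
    by (rule summable_on_int_gauss) (use assms in auto)
  show "norm (k n * gterm a b c n) \<le> K * exp (- (- Re a) * of_int n ^ 2 + norm b * \<bar>of_int n\<bar> + Re c)" for n
    unfolding norm_mult using K[of n] norm_gterm_le[of a "- Re a" b "norm b" c "Re c" n]
    by (intro mult_mono) (auto intro: order_trans[OF norm_ge_zero])
qed auto

lemma gterm_summable:
  assumes "Re a < 0"
  shows "(\<lambda>n. norm (gterm a b c n)) summable_on UNIV" "(\<lambda>n. gterm a b c n) summable_on UNIV"
  using gterm_abs_summable[OF assms, of "\<lambda>_. 1" 1] abs_summable_summable by auto

text \<open>The bounded weights \<open>k\<close> will carry sign characters and error-function
  quotients. On a closed ball the real part of \<open>a\<close> attains a maximum, which is still
  negative, so a single Gaussian majorant works there.\<close>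

lemma holomorphic_on_gterm_series:
  assumes "open S" and a: "a holomorphic_on S" "\<And>z. z \<in> S \<Longrightarrow> Re (a z) < 0"
    and b: "b holomorphic_on S" and c: "c holomorphic_on S" and K: "\<And>n. norm (k n) \<le> K"
  shows "(\<lambda>z. \<Sum>\<^sub>\<infinity>n. k n * gterm (a z) (b z) (c z) n) holomorphic_on S"
proof (rule holomorphic_on_infsum)
  show "(\<lambda>z. k n * gterm (a z) (b z) (c z) n) holomorphic_on S" for n
    unfolding gterm_def by (intro holomorphic_intros a b c)
  fix z assume "z \<in> S"
  then obtain r where r: "r > 0" "cball z r \<subseteq> S" using \<open>open S\<close> open_contains_cball by blast
  have bdd: "\<exists>B. \<forall>w\<in>cball z r. f w \<le> B" if "continuous_on S f" for f :: "complex \<Rightarrow> real"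
  proof -
    have "compact (f ` cball z r)"
      by (rule compact_continuous_image[OF continuous_on_subset[OF that r(2)]]) simp
    then have "bdd_above (f ` cball z r)" by (intro bounded_imp_bdd_above compact_imp_bounded)
    then show ?thesis by (auto simp: bdd_above_def)
  qed
  have cont: "continuous_on S a" "continuous_on S b" "continuous_on S c"
    using a b c holomorphic_on_imp_continuous_on by auto
  have "\<exists>w0\<in>cball z r. \<forall>w\<in>cball z r. Re (a w) \<le> Re (a w0)"
    using r by (intro continuous_attains_sup continuous_on_Re continuous_on_subset[OF cont(1)]) auto
  then obtain w0 where w0: "w0 \<in> cball z r" "\<And>w. w \<in> cball z r \<Longrightarrow> Re (a w) \<le> Re (a w0)" by blast
  obtain B where B: "\<And>w. w \<in> cball z r \<Longrightarrow> norm (b w) \<le> B"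
    using bdd[of "\<lambda>w. norm (b w)"] continuous_on_norm[OF cont(2)] by blast
  obtain C where C: "\<And>w. w \<in> cball z r \<Longrightarrow> Re (c w) \<le> C"
    using bdd[of "\<lambda>w. Re (c w)"] continuous_on_Re[OF cont(3)] by blast
  have "Re (a w0) < 0" using a(2) w0(1) r(2) by blast
  then have "(\<lambda>n::int. K * exp (- (- Re (a w0)) * of_int n ^ 2 + B * \<bar>of_int n\<bar> + C)) summable_on UNIV"
    by (intro summable_on_int_gauss) auto
  moreover have "norm (k n * gterm (a w) (b w) (c w) n) \<le> K * exp (- (- Re (a w0)) * of_int n ^ 2 + B * \<bar>of_int n\<bar> + C)"
    if "w \<in> cball z r" for w n
    unfolding norm_mult using K[of n] norm_gterm_le[of "a w" "- Re (a w0)" "b w" B "c w" C n] w0(2) B C that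
    by (intro mult_mono) (auto intro: order_trans[OF norm_ge_zero])
  ultimately show "\<exists>r>0. \<exists>M. cball z r \<subseteq> S \<and> M summable_on UNIV \<and>
      (\<forall>n\<in>UNIV. \<forall>w\<in>cball z r. norm (k n * gterm (a w) (b w) (c w) n) \<le> M n)"
    using r by blast
qed

text \<open>Integrating along the line shifted by \<open>s\<close> and inserting the quasiperiod law
  moves the index by \<open>m\<close>. The case m = 1 is that of theta functions of degree one, m =
  -1 that of negative degree.\<close>

lemma fourier_coeff_quasiperiodic:
  assumes hol: "D holomorphic_on UNIV" and per: "\<And>z. D (z + 1) = D z"
    and quasi: "\<And>z. D (z + s) = exp (\<kappa> - two_pi_i * of_int m * z) * D z"
  shows "fourier_coeff D n = exp (\<kappa> - two_pi_i * of_int n * s) * fourier_coeff D (n + m)"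
proof -
  have "fourier_coeff D n = integral {0..1} (\<lambda>x. exp (\<kappa> - two_pi_i * of_int n * s) *
     (D (of_real x) * exp (neg_two_pi_i * of_int (n + m) * of_real x)))"
    unfolding fourier_coeff_shift[OF hol per, of n s] quasi
    by (intro integral_cong) (simp add: exp_add[symmetric] exp_diff[symmetric] algebra_simps flip: exp_add exp_diff)
  also have "\<dots> = exp (\<kappa> - two_pi_i * of_int n * s) * fourier_coeff D (n + m)"
    unfolding fourier_coeff_def by (rule integral_mult_right)
  finally show ?thesis .
qed

text \<open>In degree one neighbouring coefficients differ by a nonzero factor, so the zeroth one
  decides about all. This is the uniqueness behind both the Jacobi transformation and the product
  formula for theta.\<close>

lemma entire_quasiperiodic_eq_0:
  assumes hol: "D holomorphic_on UNIV" and per: "\<And>z. D (z + 1) = D z"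
    and quasi: "\<And>z. D (z + s) = exp (\<kappa> - two_pi_i * z) * D z"
    and 0: "fourier_coeff D 0 = 0"
  shows "D z = 0"
proof (rule fourier_unique[OF hol per])
  have rec: "fourier_coeff D n = 0 \<longleftrightarrow> fourier_coeff D (n + 1) = 0" for n
    using fourier_coeff_quasiperiodic[OF hol per, of s \<kappa> 1 n] quasi by simp
  fix n show "fourier_coeff D n = 0"
  proof (induction n rule: int_induct[where k = 0])
    case (step2 i) then show ?case using rec[of "i - 1"] by simp
  qed (use 0 rec in auto)
qed

text \<open>Uniform convergence on the interval. The form \<open>has_sum\<close> allows the sum to
  be evaluated later along a chosen exhausting sequence of finite sets.\<close>

lemma integral_infsum:
  fixes f :: "'a \<Rightarrow> real \<Rightarrow> complex"
  assumes cont: "\<And>k. continuous_on {a..b} (f k)" and M: "M summable_on UNIV"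
    and bd: "\<And>k x. x \<in> {a..b} \<Longrightarrow> norm (f k x) \<le> M k"
  shows "((\<lambda>k. integral {a..b} (f k)) has_sum integral {a..b} (\<lambda>x. \<Sum>\<^sub>\<infinity>k. f k x)) UNIV"
proof -
  have ul: "uniform_limit {a..b} (\<lambda>Y x. \<Sum>k\<in>Y. f k x) (\<lambda>x. \<Sum>\<^sub>\<infinity>k. f k x) (finite_subsets_at_top UNIV)"
    by (rule Weierstrass_m_test_general[OF _ M]) (rule bd)
  have ct: "continuous_on {a..b} (\<lambda>x. \<Sum>k\<in>Y. f k x)" for Y
    by (intro continuous_intros cont)
  obtain I J where IJ: "\<And>Y. ((\<lambda>x. \<Sum>k\<in>Y. f k x) has_integral I Y) {a..b}"
    "((\<lambda>x. \<Sum>\<^sub>\<infinity>k. f k x) has_integral J) {a..b}"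
    "(I \<longlongrightarrow> J) (finite_subsets_at_top UNIV)"
    using uniform_limit_integral[OF ul ct] by auto
  have "I Y = (\<Sum>k\<in>Y. integral {a..b} (f k))" if "finite Y" for Y
    using has_integral_unique[OF IJ(1)[of Y] has_integral_sum[OF that integrable_integral[OF integrable_continuous_real[OF cont]]]] .
  then have "((\<lambda>Y. \<Sum>k\<in>Y. integral {a..b} (f k)) \<longlongrightarrow> J) (finite_subsets_at_top UNIV)"
    using IJ(3) by (rule_tac tendsto_cong[THEN iffD1, rotated]) (auto intro: eventually_finite_subsets_at_top_weakI)
  then show ?thesis
    using IJ(2) by (simp add: has_sum_def integral_unique)
qed

lemma fourier_coeff_infsum:
  fixes f :: "'a \<Rightarrow> complex \<Rightarrow> complex"
  assumes hol: "\<And>k. f k holomorphic_on UNIV" and M: "M summable_on UNIV"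
    and bd: "\<And>k x. x \<in> {0..1} \<Longrightarrow> norm (f k (of_real x)) \<le> M k"
  shows "((\<lambda>k. fourier_coeff (f k) n) has_sum fourier_coeff (\<lambda>z. \<Sum>\<^sub>\<infinity>k. f k z) n) UNIV"
proof -
  let ?e = "\<lambda>x::real. exp (neg_two_pi_i * of_int n * of_real x)"
  have cf: "continuous_on {0..1} (\<lambda>x::real. f k (of_real x))" for k
    using continuous_on_of_real_line[OF hol, of "{0..1}" k 0] by simp
  have "((\<lambda>k. integral {0..1} (\<lambda>x. f k (of_real x) * ?e x)) has_sum
      integral {0..1} (\<lambda>x. \<Sum>\<^sub>\<infinity>k. f k (of_real x) * ?e x)) UNIV"
    by (rule integral_infsum[OF _ M]) (auto intro!: continuous_intros cf simp: norm_mult bd)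
  then show ?thesis unfolding fourier_coeff_def infsum_cmult_left' .
qed

section \<open>The Gaussian integral over the real line\<close>

lemma gaussian_has_integral:
  assumes "t > 0"
  shows "((\<lambda>x::real. exp (- pi * x\<^sup>2 / t)) has_integral sqrt t) UNIV"
proof -
  \<comment> \<open>With variance t / (2 pi) the normal density is
    \<open>exp (- pi * x^2 / t) / sqrt t\<close>.\<close>
  let ?s = "sqrt (t / (2 * pi))"
  have eq: "normal_density 0 ?s x = exp (- pi * x\<^sup>2 / t) / sqrt t" for x
    using assms by (simp add: normal_density_def field_simps)
  have s: "0 < ?s" using assms by simp
  have "(normal_density 0 ?s has_integral 1) UNIV"
    using has_integral_integral_lborel[OF integrable_normal_density[OF s, of 0]]
    unfolding integral_normal_density[OF s] .
  from has_integral_mult_right[OF this, of "sqrt t"] show ?thesis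
    unfolding eq using assms by simp
qed

lemma gaussian_integral_tendsto:
  assumes "t > 0"
  shows "(\<lambda>m::nat. integral {- real m..real m} (\<lambda>x. exp (- pi * x\<^sup>2 / t))) \<longlonglongrightarrow> sqrt t"
proof (rule LIMSEQ_I)
  fix e :: real assume "e > 0"
  from conjunct2[OF gaussian_has_integral[OF assms, unfolded has_integral_alt'], rule_format, OF this]
  obtain B where B: "B > 0"
    "\<And>a b. ball 0 B \<subseteq> cbox a b \<Longrightarrow> norm (integral (cbox a b) (\<lambda>x. if x \<in> UNIV then exp (- pi * x\<^sup>2 / t) else 0) - sqrt t) < e"
    by blast
  have "norm (integral {- real m..real m} (\<lambda>x. exp (- pi * x\<^sup>2 / t)) - sqrt t) < e" if "m \<ge> nat \<lceil>B\<rceil>" for m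
  proof -
    have "real m \<ge> B" using that by linarith
    then have "ball 0 B \<subseteq> cbox (- real m) (real m)" by (auto simp: dist_norm)
    from B(2)[OF this] show ?thesis by simp
  qed
  then show "\<exists>n0. \<forall>m\<ge>n0. norm (integral {- real m..real m} (\<lambda>x. exp (- pi * x\<^sup>2 / t)) - sqrt t) < e" by blast
qed

section \<open>The Jacobi transformation\<close>

lemma infsum_shift_int:
  fixes f :: "int \<Rightarrow> 'a::{comm_monoid_add,t2_space}"
  shows "(\<Sum>\<^sub>\<infinity>n. f (n + m)) = (\<Sum>\<^sub>\<infinity>n. f n)"
proof -
  have "bij_betw (\<lambda>n::int. n + m) UNIV UNIV"
    by (rule bij_betwI[where g = "\<lambda>n. n - m"]) auto
  from infsum_reindex_bij_betw[OF this, of f] show ?thesis .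
qed

text \<open>The common form of the functional equations of Gaussian series: shifting the index
  completes the square and leaves a constant factor.\<close>

lemma gterm_series_exp_shift:
  assumes "\<And>n. gterm a b c (n + m) = exp d * gterm a' b' c' n"
  shows "(\<Sum>\<^sub>\<infinity>n. gterm a b c n) = exp d * (\<Sum>\<^sub>\<infinity>n. gterm a' b' c' n)"
proof -
  have "(\<Sum>\<^sub>\<infinity>n. gterm a b c n) = (\<Sum>\<^sub>\<infinity>n. exp d * gterm a' b' c' n)"
    using infsum_shift_int[of "gterm a b c" m] assms by simp
  then show ?thesis by (simp add: infsum_cmult_right')
qed

text \<open>Jacobi's third theta function. Its zeros are the lattice translates of 1/2 + \<sigma>/2,
  which accounts for the half-period shifts below.\<close>

definition jtheta :: "complex \<Rightarrow> complex \<Rightarrow> complex" where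
  "jtheta z \<sigma> = (\<Sum>\<^sub>\<infinity>n::int. gterm (pi_i * \<sigma>) (two_pi_i * z) 0 n)"

text \<open>The periodisation of the Gaussian exp (- pi i z^2 / \<sigma>), that is, the sum of its
  translates by integers, expanded into the shape of \<open>gterm\<close>. It is the Poisson dual of
  \<open>jtheta\<close>.\<close>

definition jgauss :: "complex \<Rightarrow> complex \<Rightarrow> complex" where
  "jgauss z \<sigma> = (\<Sum>\<^sub>\<infinity>n::int. gterm (neg_pi_i / \<sigma>) (neg_two_pi_i * z / \<sigma>) (neg_pi_i * z\<^sup>2 / \<sigma>) n)"

lemma Re_over_upper:
  assumes "Im \<sigma> > 0"
  shows "Re (neg_pi_i / \<sigma>) < 0"
proof -
  have "\<sigma> \<noteq> 0" using assms by auto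
  then show ?thesis using assms by (simp add: Re_divide field_simps sum_power2_gt_zero_iff complex_eq_iff)
qed

lemma holomorphic_on_gterm_sum:
  assumes "open S" "\<And>z. z \<in> S \<Longrightarrow> Re (a z) < 0" "a holomorphic_on S" "b holomorphic_on S" "c holomorphic_on S"
  shows "(\<lambda>z. \<Sum>\<^sub>\<infinity>n. gterm (a z) (b z) (c z) n) holomorphic_on S"
  using holomorphic_on_gterm_series[of S a b c "\<lambda>_. 1" 1] assms by simp

lemma holomorphic_jtheta:
  assumes "Im \<sigma> > 0" shows "(\<lambda>z. jtheta z \<sigma>) holomorphic_on UNIV"
  unfolding jtheta_def using assms by (intro holomorphic_on_gterm_sum holomorphic_intros) auto

lemma holomorphic_jgauss:
  assumes "Im \<sigma> > 0" shows "(\<lambda>z. jgauss z \<sigma>) holomorphic_on UNIV"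
  unfolding jgauss_def using assms by (intro holomorphic_on_gterm_sum holomorphic_intros Re_over_upper) auto

lemma holomorphic_jtheta_param: "(\<lambda>\<sigma>. jtheta z \<sigma>) holomorphic_on {\<sigma>. Im \<sigma> > 0}"
  unfolding jtheta_def
  by (intro holomorphic_on_gterm_sum holomorphic_intros) (auto simp: open_halfspace_Im_gt)

lemma holomorphic_jgauss_param: "(\<lambda>\<sigma>. jgauss z \<sigma>) holomorphic_on {\<sigma>. Im \<sigma> > 0}"
  unfolding jgauss_def
  by (intro holomorphic_on_gterm_sum holomorphic_intros Re_over_upper) (auto simp: open_halfspace_Im_gt)

lemma jtheta_plus_1: "jtheta (z + 1) \<sigma> = jtheta z \<sigma>"
  unfolding jtheta_def gterm_def
proof (intro infsum_cong)
  fix n :: int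
  have "exp (pi_i * \<sigma> * (of_int n)\<^sup>2 + two_pi_i * (z + 1) * of_int n + 0) =
    exp (pi_i * \<sigma> * (of_int n)\<^sup>2 + two_pi_i * z * of_int n + 0) * exp (two_pi_i * of_int n)"
    unfolding exp_add[symmetric] by (rule arg_cong[of _ _ exp]) (simp add: algebra_simps)
  then show "exp (pi_i * \<sigma> * (of_int n)\<^sup>2 + two_pi_i * (z + 1) * of_int n + 0) =
    exp (pi_i * \<sigma> * (of_int n)\<^sup>2 + two_pi_i * z * of_int n + 0)"
    by (simp only: exp_2pi_int mult_1_right)
qed

lemma jtheta_plus_period: "jtheta (z + \<sigma>) \<sigma> = exp (neg_pi_i * \<sigma> - two_pi_i * z) * jtheta z \<sigma>"
  unfolding jtheta_def
  by (rule gterm_series_exp_shift[where m = "-1"], unfold gterm_def exp_add[symmetric], rule arg_cong[of _ _ exp])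
    (simp add: algebra_simps power2_eq_square)

lemma jgauss_plus_1: "jgauss (z + 1) \<sigma> = jgauss z \<sigma>"
proof -
  have "jgauss (z + 1) \<sigma> = exp 0 * jgauss z \<sigma>"
    unfolding jgauss_def
    by (rule gterm_series_exp_shift[where m = "-1"], unfold gterm_def exp_add[symmetric], rule arg_cong[of _ _ exp])
      (cases "\<sigma> = 0", auto simp: field_simps power2_eq_square)
  then show ?thesis by simp
qed

lemma jgauss_plus_period:
  assumes "\<sigma> \<noteq> 0"
  shows "jgauss (z + \<sigma>) \<sigma> = exp (neg_pi_i * \<sigma> - two_pi_i * z) * jgauss z \<sigma>"
proof -
  have "gterm (neg_pi_i / \<sigma>) (neg_two_pi_i * (z + \<sigma>) / \<sigma>) (neg_pi_i * (z + \<sigma>)\<^sup>2 / \<sigma>) n =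
     exp (neg_pi_i * \<sigma> - two_pi_i * z) *
     gterm (neg_pi_i / \<sigma>) (neg_two_pi_i * z / \<sigma>) (neg_pi_i * z\<^sup>2 / \<sigma>) n" for n
  proof -
    have "gterm (neg_pi_i / \<sigma>) (neg_two_pi_i * (z + \<sigma>) / \<sigma>) (neg_pi_i * (z + \<sigma>)\<^sup>2 / \<sigma>) n =
      exp (neg_pi_i * \<sigma> - two_pi_i * z) *
      gterm (neg_pi_i / \<sigma>) (neg_two_pi_i * z / \<sigma>) (neg_pi_i * z\<^sup>2 / \<sigma>) n *
      exp (two_pi_i * of_int (- n))"
      unfolding gterm_def exp_add[symmetric]
      by (rule arg_cong[of _ _ exp]) (use assms in \<open>simp add: field_simps power2_eq_square\<close>)
    then show ?thesis unfolding exp_2pi_int by simp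
  qed
  then show ?thesis unfolding jgauss_def by (intro gterm_series_exp_shift[where m = 0]) simp
qed

lemma fourier_coeff_exp_int:
  "fourier_coeff (\<lambda>z. exp (two_pi_i * of_int k * z)) n = (if n = k then 1 else 0)"
proof -
  have "fourier_coeff (\<lambda>z. exp (two_pi_i * of_int k * z)) n = fourier_coeff (\<lambda>_. 1) (n - k)"
    unfolding fourier_coeff_def
    by (intro integral_cong) (simp add: exp_add[symmetric] algebra_simps)
  then show ?thesis by (simp add: fourier_coeff_const)
qed

lemma fourier_coeff_cmult: "fourier_coeff (\<lambda>z. c * f z) n = c * fourier_coeff f n"
  unfolding fourier_coeff_def mult.assoc by (rule integral_mult_right)

lemma fourier_coeff_jtheta_0:
  assumes "Im \<sigma> > 0"
  shows "fourier_coeff (\<lambda>z. jtheta z \<sigma>) 0 = 1"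
proof -
  let ?f = "\<lambda>k z. gterm (pi_i * \<sigma>) (two_pi_i * z) 0 k"
  have *: "?f k = (\<lambda>z. gterm (pi_i * \<sigma>) 0 0 k * exp (two_pi_i * of_int k * z))" for k
    unfolding gterm_def by (simp add: exp_add mult_ac)
  have "((\<lambda>k. fourier_coeff (?f k) 0) has_sum fourier_coeff (\<lambda>z. \<Sum>\<^sub>\<infinity>k. ?f k z) 0) UNIV"
  proof (rule fourier_coeff_infsum)
    show "?f k holomorphic_on UNIV" for k unfolding * by (intro holomorphic_intros)
    show "(\<lambda>k. norm (gterm (pi_i * \<sigma>) 0 0 k)) summable_on UNIV"
      by (rule gterm_summable) (use assms in simp)
    show "norm (?f k (of_real x)) \<le> norm (gterm (pi_i * \<sigma>) 0 0 k)" for k x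
    proof -
      have "norm (exp (two_pi_i * of_int k * of_real x)) = 1" by simp
      then show ?thesis using fun_cong[OF *[of k], of "of_real x"] by (simp only: norm_mult mult_1_right)
    qed
  qed
  moreover have "((\<lambda>k. fourier_coeff (?f k) 0) has_sum 1) UNIV"
  proof -
    have "fourier_coeff (?f k) 0 = (if k = 0 then 1 else 0)" for k
      unfolding * fourier_coeff_cmult fourier_coeff_exp_int by (simp add: gterm_def)
    moreover have "((\<lambda>k::int. if k = 0 then 1 else 0 :: complex) has_sum 1) UNIV"
      by (rule has_sum_cong_neutral[THEN iffD1, OF _ _ _ has_sum_finite[of "{0::int}" "\<lambda>_. 1"], simplified]) auto
    ultimately show ?thesis by simp
  qed
  ultimately show ?thesis unfolding jtheta_def using has_sum_unique by blast
qed

lemma fourier_coeff_jgauss_0: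
  assumes "t > 0"
  shows "fourier_coeff (\<lambda>z. jgauss z (\<i> * of_real t)) 0 = of_real (sqrt t)"
proof -
  let ?g = "\<lambda>x::real. exp (- pi * x\<^sup>2 / t)"
  let ?\<sigma> = "\<i> * of_real t :: complex"
  let ?f = "\<lambda>k z. gterm (neg_pi_i / ?\<sigma>) (neg_two_pi_i * z / ?\<sigma>) (neg_pi_i * z\<^sup>2 / ?\<sigma>) k"
  have *: "?f k (of_real x) = of_real (?g (x + of_int k))" for k x
    unfolding gterm_def exp_of_real[symmetric]
    by (rule arg_cong[of _ _ exp]) (use assms in \<open>simp add: field_simps power2_eq_square\<close>)
  have sum: "((\<lambda>k. fourier_coeff (?f k) 0) has_sum fourier_coeff (\<lambda>z. \<Sum>\<^sub>\<infinity>k. ?f k z) 0) UNIV"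
  proof (rule fourier_coeff_infsum)
    show "?f k holomorphic_on UNIV" for k unfolding gterm_def using assms by (intro holomorphic_intros) auto
    show "(\<lambda>n::int. 1 * exp (- (pi / t) * of_int n ^ 2 + (2 * pi / t) * \<bar>of_int n\<bar> + 0)) summable_on UNIV"
      by (rule summable_on_int_gauss) (use assms in simp)
    fix k :: int and x :: real assume x: "x \<in> {0..1}"
    have "- pi * (x + of_int k)\<^sup>2 / t \<le> - (pi / t) * of_int k ^ 2 + (2 * pi / t) * \<bar>of_int k\<bar>"
    proof -
      \<comment> \<open>For x in the unit interval the cross term of (x + k)^2 costs at most 2 |k|,
        so one majorant serves all x.\<close>
      have "- (x * of_int k) \<le> \<bar>of_int k\<bar>"
      proof -
        have "- (x * of_int k) \<le> \<bar>x\<bar> * \<bar>of_int k\<bar>" by (metis abs_ge_self abs_minus_cancel abs_mult)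
        also have "\<dots> \<le> 1 * \<bar>of_int k\<bar>" using x by (intro mult_right_mono) auto
        finally show ?thesis by simp
      qed
      then have "- (x + of_int k)\<^sup>2 \<le> - (of_int k ^ 2) + 2 * \<bar>of_int k\<bar>"
        unfolding power2_sum using zero_le_power2[of x] by linarith
      then have "(pi / t) * - (x + of_int k)\<^sup>2 \<le> (pi / t) * (- (of_int k ^ 2) + 2 * \<bar>of_int k\<bar>)"
        using assms by (intro mult_left_mono) auto
      then show ?thesis by (simp add: algebra_simps)
    qed
    then show "norm (?f k (of_real x)) \<le> 1 * exp (- (pi / t) * of_int k ^ 2 + (2 * pi / t) * \<bar>of_int k\<bar> + 0)"
      unfolding * by simp
  qed
  have cont: "continuous_on A ?g" for A using assms by (intro continuous_intros) auto
  have coeff: "fourier_coeff (?f k) 0 = of_real (integral {of_int k..of_int k + 1} ?g)" for k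
  proof -
    have "(?g has_integral integral {of_int k..of_int k + 1} ?g) {of_int k..of_int k + 1}"
      by (intro integrable_integral integrable_continuous_real cont)
    then have "((\<lambda>x. ?g (1 * x + of_int k)) has_integral (1 / \<bar>1\<bar> ^ 1 * integral {of_int k..of_int k + 1} ?g))
        ((\<lambda>x. (1 / 1) * x - (1 / 1) * of_int k) ` {of_int k..of_int k + 1})"
      using has_integral_affinity[of ?g _ "of_int k" "of_int k + 1" 1 "of_int k"] by simp
    moreover have "(\<lambda>x. (1 / 1) * x - (1 / 1) * of_int k) ` {of_int k..of_int k + 1} = {0..1::real}"
    proof (intro set_eqI iffI)
      fix x :: real assume "x \<in> {0..1}"
      then show "x \<in> (\<lambda>x. (1 / 1) * x - (1 / 1) * of_int k) ` {of_int k..of_int k + 1}"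
        by (intro image_eqI[of _ _ "x + of_int k"]) auto
    qed auto
    ultimately have "((\<lambda>x. ?g (x + of_int k)) has_integral integral {of_int k..of_int k + 1} ?g) {0..1}"
      by simp
    then have "((\<lambda>x. complex_of_real (?g (x + of_int k))) has_integral of_real (integral {of_int k..of_int k + 1} ?g)) {0..1}"
      by (rule has_integral_of_real)
    then show ?thesis unfolding fourier_coeff_def * by (simp add: integral_unique)
  qed
  have part: "(\<Sum>k\<in>{- int m..<int m}. integral {of_int k..of_int k + 1} ?g) = integral {- real m..real m} ?g" for m
  proof (induction m)
    case (Suc m)
    have ii: "?g integrable_on {a..b}" for a b by (intro integrable_continuous_real cont)
    have "{- int (Suc m)..<int (Suc m)} = insert (- int (Suc m)) (insert (int m) {- int m..<int m})" by auto
    then have "(\<Sum>k\<in>{- int (Suc m)..<int (Suc m)}. integral {of_int k..of_int k + 1} ?g) =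
       integral {- real (Suc m)..- real m} ?g + (integral {real m..real (Suc m)} ?g + integral {- real m..real m} ?g)"
      using Suc by (simp add: add.commute)
    also have "\<dots> = integral {- real (Suc m)..- real m} ?g + integral {- real m..real (Suc m)} ?g"
      using Henstock_Kurzweil_Integration.integral_combine[of "- real m" "real m" "real (Suc m)" ?g] ii by simp
    also have "\<dots> = integral {- real (Suc m)..real (Suc m)} ?g"
      by (rule Henstock_Kurzweil_Integration.integral_combine) (use ii in auto)
    finally show ?case .
  qed simp
  \<comment> \<open>The unordered sum is evaluated along these ranges because their partial sums are
    Gaussian integrals over [-m, m].\<close>
  have fl: "filterlim (\<lambda>m. {- int m..<int m}) (finite_subsets_at_top UNIV) sequentially"
  proof (rule filterlim_finite_subsets_at_top[THEN iffD2], intro allI impI)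
    fix X :: "int set" assume "finite X \<and> X \<subseteq> UNIV"
    then have "finite (abs ` X)" by simp
    then obtain b where b: "\<And>x. x \<in> X \<Longrightarrow> \<bar>x\<bar> \<le> b" by (meson bdd_above_def bdd_above_finite imageI)
    have "eventually (\<lambda>m. m \<ge> nat b + 1) sequentially" by (rule eventually_ge_at_top)
    then show "\<forall>\<^sub>F m in sequentially. finite {- int m..<int m} \<and> X \<subseteq> {- int m..<int m} \<and> {- int m..<int m} \<subseteq> UNIV"
    proof (rule eventually_mono)
      fix m assume m: "m \<ge> nat b + 1"
      have "x \<in> {- int m..<int m}" if "x \<in> X" for x using b[OF that] m by auto
      then show "finite {- int m..<int m} \<and> X \<subseteq> {- int m..<int m} \<and> {- int m..<int m} \<subseteq> UNIV" by auto
    qed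
  qed
  have "(\<lambda>m. \<Sum>k\<in>{- int m..<int m}. fourier_coeff (?f k) 0) \<longlonglongrightarrow> fourier_coeff (\<lambda>z. \<Sum>\<^sub>\<infinity>k. ?f k z) 0"
    using filterlim_compose[OF sum[unfolded has_sum_def] fl] .
  moreover have "(\<Sum>k\<in>{- int m..<int m}. fourier_coeff (?f k) 0) = of_real (integral {- real m..real m} ?g)" for m
    unfolding coeff part[symmetric] by simp
  moreover have "(\<lambda>m. of_real (integral {- real m..real m} ?g) :: complex) \<longlonglongrightarrow> of_real (sqrt t)"
    by (intro tendsto_of_real gaussian_integral_tendsto assms)
  ultimately show ?thesis unfolding jgauss_def using LIMSEQ_unique by auto
qed

text \<open>For imaginary \<open>\<sigma>\<close> both sides satisfy the same functional equations, and the zeroth Fourier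
  coefficient of the left-hand side unfolds to a Gaussian integral over the real line. The general case
  follows by analytic continuation in \<open>\<sigma>\<close>.\<close>

lemma jacobi_transformation:
  assumes "Im \<sigma> > 0"
  shows "jgauss z \<sigma> = csqrt (- \<i> * \<sigma>) * jtheta z \<sigma>"
proof -
  have imag: "jgauss z (\<i> * of_real t) = of_real (sqrt t) * jtheta z (\<i> * of_real t)" if t: "t > 0" for t
  proof -
    let ?s = "\<i> * of_real t :: complex"
    have s: "Im ?s > 0" "?s \<noteq> 0" using t by auto
    note hol = holomorphic_jgauss[OF s(1)] holomorphic_jtheta[OF s(1)]
    have "jgauss z ?s - of_real (sqrt t) * jtheta z ?s = 0"
    proof (rule entire_quasiperiodic_eq_0[where D = "\<lambda>z. jgauss z ?s - of_real (sqrt t) * jtheta z ?s"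
          and s = ?s and \<kappa> = "neg_pi_i * ?s"])
      show "(\<lambda>z. jgauss z ?s - of_real (sqrt t) * jtheta z ?s) holomorphic_on UNIV"
        by (intro holomorphic_intros hol)
      show "jgauss (z + ?s) ?s - of_real (sqrt t) * jtheta (z + ?s) ?s =
        exp (neg_pi_i * ?s - two_pi_i * z) * (jgauss z ?s - of_real (sqrt t) * jtheta z ?s)" for z
        unfolding jgauss_plus_period[OF s(2)] jtheta_plus_period by (simp add: algebra_simps)
      have "fourier_coeff (\<lambda>z. jgauss z ?s - of_real (sqrt t) * jtheta z ?s) 0 =
          fourier_coeff (\<lambda>z. jgauss z ?s) 0 - fourier_coeff (\<lambda>z. of_real (sqrt t) * jtheta z ?s) 0"
        by (intro fourier_coeff_diff holomorphic_intros hol)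
      then show "fourier_coeff (\<lambda>z. jgauss z ?s - of_real (sqrt t) * jtheta z ?s) 0 = 0"
        by (simp add: fourier_coeff_cmult fourier_coeff_jtheta_0[OF s(1)] fourier_coeff_jgauss_0[OF t])
    qed (simp add: jgauss_plus_1 jtheta_plus_1)
    then show ?thesis by simp
  qed
  have "(\<lambda>\<sigma>. jgauss z \<sigma> - csqrt (- \<i> * \<sigma>) * jtheta z \<sigma>) \<sigma> = 0"
  proof (rule analytic_continuation[where f = "\<lambda>\<sigma>. jgauss z \<sigma> - csqrt (- \<i> * \<sigma>) * jtheta z \<sigma>" and S = "{\<sigma>. Im \<sigma> > 0}" and U = "(\<lambda>t. \<i> * of_real t) ` {0<..}" and \<xi> = \<i>])
    show "(\<lambda>\<sigma>. jgauss z \<sigma> - csqrt (- \<i> * \<sigma>) * jtheta z \<sigma>) holomorphic_on {\<sigma>. Im \<sigma> > 0}"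
      by (intro holomorphic_intros holomorphic_jgauss_param holomorphic_jtheta_param)
        (auto simp: complex_nonpos_Reals_iff)
    show "connected {\<sigma>. Im \<sigma> > 0}"
      by (intro convex_connected convex_halfspace_Im_gt)
    show "\<i> islimpt (\<lambda>t. \<i> * of_real t) ` {0<..}"
      unfolding islimpt_sequential
    proof (intro exI conjI allI)
      show "\<i> * of_real (1 + inverse (real (Suc n))) \<in> (\<lambda>t. \<i> * of_real t) ` {0<..} - {\<i>}" for n
        by (auto simp: complex_eq_iff intro!: imageI add_pos_pos)
      have "(\<lambda>n. \<i> * of_real (1 + inverse (real (Suc n))) :: complex) \<longlonglongrightarrow> \<i> * of_real (1 + 0)"
        by (intro tendsto_intros LIMSEQ_inverse_real_of_nat)
      then show "(\<lambda>n. \<i> * of_real (1 + inverse (real (Suc n))) :: complex) \<longlonglongrightarrow> \<i>" by simp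
    qed
    fix s assume "s \<in> (\<lambda>t. \<i> * complex_of_real t) ` {0<..}"
    then obtain t where t: "s = \<i> * of_real t" "t > 0" by auto
    then have "csqrt (- \<i> * s) = of_real (sqrt t)" by (simp add: csqrt_of_real_nonneg)
    then show "jgauss z s - csqrt (- \<i> * s) * jtheta z s = 0" using imag[OF t(2)] t(1) by simp
  qed (use assms in \<open>auto simp: open_halfspace_Im_gt\<close>)
  then show ?thesis by simp
qed

section \<open>Zeros and inversion of theta\<close>

text \<open>The infinite q-Pochhammer symbol (x; q) with infinitely many factors.\<close>

definition qpoch :: "complex \<Rightarrow> complex \<Rightarrow> complex" where
  "qpoch q x = (\<Prod>n. 1 - x * q ^ n)"

lemma convergent_prod_qpoch:
  fixes q x :: complex
  assumes "norm q < 1" shows "convergent_prod (\<lambda>n. 1 - x * q ^ n)"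
proof -
  have "summable (\<lambda>n. norm (x * q ^ n))"
    unfolding norm_mult norm_power using assms by (intro summable_mult summable_geometric) auto
  then have "summable (\<lambda>n. norm ((1 - x * q ^ n) - 1))" by simp
  then show ?thesis by (intro abs_convergent_prod_imp_convergent_prod summable_imp_abs_convergent_prod)
qed

lemma qpoch_rec:
  assumes "norm q < 1" shows "qpoch q x = (1 - x) * qpoch q (x * q)"
proof -
  have "(\<lambda>n. 1 - x * q ^ n) has_prod ((\<Prod>k<1. 1 - x * q ^ k) * (\<Prod>k. 1 - x * q ^ (k + 1)))"
    by (rule has_prod_ignore_initial_segment'[OF convergent_prod_qpoch[OF assms]])
  then show ?thesis unfolding qpoch_def
    by (simp add: has_prod_unique[symmetric] mult.assoc)
qed

text \<open>Absolute convergence gives a product in the strict sense, which vanishes only with one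
  of its factors.\<close>

lemma qpoch_eq_0D:
  assumes "norm q < 1" "qpoch q x = 0"
  obtains n where "x * q ^ n = 1"
  using prodinf_nonzero[OF convergent_prod_qpoch[OF assms(1), of x]] assms(2)
  unfolding qpoch_def by auto

lemma holomorphic_qpoch:
  assumes "norm q < 1" shows "qpoch q holomorphic_on UNIV"
proof (rule holomorphic_uniform_sequence[where f = "\<lambda>N x. \<Prod>n<N. 1 - x * q ^ n"])
  fix x :: complex
  let ?C = "cball x 1"
  have nb: "norm (- (y * q ^ n)) \<le> (norm x + 1) * norm q ^ n" if "y \<in> ?C" for y n
  proof -
    have "norm y \<le> norm x + 1"
      using that norm_triangle_ineq2[of y x] by (simp add: dist_norm norm_minus_commute)
    then show ?thesis by (simp add: norm_mult norm_power mult_right_mono)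
  qed
  have "uniformly_convergent_on ?C (\<lambda>N y. \<Sum>n<N. norm (- (y * q ^ n)))"
    by (rule Weierstrass_m_test'[where M = "\<lambda>n. (norm x + 1) * norm q ^ n"])
      (use nb assms in \<open>auto intro!: summable_mult summable_geometric\<close>)
  then have "uniformly_convergent_on ?C (\<lambda>N y. \<Prod>n<N. 1 + - (y * q ^ n))"
    by (intro uniformly_convergent_on_prod) (auto intro!: continuous_intros)
  then have ul: "uniform_limit ?C (\<lambda>N y. \<Prod>n<N. 1 - y * q ^ n) (\<lambda>y. lim (\<lambda>N. \<Prod>n<N. 1 - y * q ^ n)) sequentially"
    by (simp add: uniformly_convergent_uniform_limit_iff)
  have "lim (\<lambda>N. \<Prod>n<N. 1 - y * q ^ n) = qpoch q y" for y
    using convergent_prod_LIMSEQ[OF convergent_prod_qpoch[OF assms, of y]]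
    unfolding qpoch_def by (simp add: limI LIMSEQ_lessThan_iff_atMost)
  with ul show "\<exists>d>0. cball x d \<subseteq> UNIV \<and>
      uniform_limit (cball x d) (\<lambda>N y. \<Prod>n<N. 1 - y * q ^ n) (qpoch q) sequentially"
    by (intro exI[of _ 1]) simp
qed (auto intro!: holomorphic_intros)

lemma norm_nome_less_1:
  assumes "Im \<tau> > 0" shows "norm (exp (two_pi_i * \<tau>)) < 1"
  using assms by simp

lemma lattice_add_period: "z + \<tau> \<in> lattice \<tau> \<longleftrightarrow> z \<in> lattice \<tau>"
proof -
  have "w + of_int c * \<tau> \<in> lattice \<tau>" if "w \<in> lattice \<tau>" for w c
  proof -
    obtain a b :: int where "w = of_int a + of_int b * \<tau>" using \<open>w \<in> lattice \<tau>\<close> by (auto simp: lattice_def)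
    then have "w + of_int c * \<tau> = of_int a + of_int (b + c) * \<tau>" by (simp add: algebra_simps)
    then show ?thesis unfolding lattice_def by blast
  qed
  from this[of z 1] this[of "z + \<tau>" "-1"] show ?thesis by auto
qed

text \<open>The infinite product with zeros exactly on the lattice satisfies the same functional equations, and
  their solution space is one-dimensional.\<close>

lemma jtheta_nonzero:
  assumes \<tau>: "Im \<tau> > 0" and z: "z \<notin> lattice \<tau>"
  shows "jtheta (z + 1/2 - \<tau>/2) \<tau> \<noteq> 0"
proof
  assume zero: "jtheta (z + 1/2 - \<tau>/2) \<tau> = 0"
  define q where "q = exp (two_pi_i * \<tau>)"
  define e where "e = (\<lambda>z. exp (two_pi_i * z))"
  \<comment> \<open>\<open>P\<close> is the product side of the Jacobi triple product without its
    constant factor. In \<open>J\<close> below, the shift by 1/2 - \<tau>/2 moves a zero of the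
    series side to the origin.\<close>
  define P where "P = (\<lambda>z. qpoch q (e z) * qpoch q (e (- z) * q))"
  define J where "J = (\<lambda>z. jtheta (z + 1/2 - \<tau>/2) \<tau>)"
  have q: "norm q < 1" using norm_nome_less_1[OF \<tau>] by (simp add: q_def)
  have e_add: "e (a + b) = e a * e b" for a b by (simp add: e_def exp_add algebra_simps)
  have e1: "e 1 = 1" "e (- 1) = 1" and e\<tau>: "e \<tau> = q"
    using exp_2pi_int[of 1] exp_2pi_int[of "-1"] by (simp_all add: e_def q_def)
  have e_minus: "e (- a) * e a = 1" for a by (simp add: e_def exp_minus)
  have holP: "P holomorphic_on UNIV" unfolding P_def e_def
    by (intro holomorphic_intros holomorphic_on_compose_entire[OF holomorphic_qpoch[OF q]])
  have holJ: "J holomorphic_on UNIV" unfolding J_def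
    by (intro holomorphic_on_compose_entire[OF holomorphic_jtheta[OF \<tau>]] holomorphic_intros) auto
  have perP: "P (z + 1) = P z" for z
    using e_add[of z 1] e_add[of "-z" "-1"] e1 by (simp add: P_def)
  have perJ: "J (z + 1) = J z" for z
    using jtheta_plus_1[of "z + 1/2 - \<tau>/2" \<tau>] by (simp add: J_def algebra_simps)
  have quP: "P (z + \<tau>) = exp (pi_i - two_pi_i * z) * P z" for z
  proof -
    have "e (- (z + \<tau>)) * q = e (- z) * (e (- \<tau>) * e \<tau>)" using e_add[of "-z" "-\<tau>"] e\<tau> by simp
    then have 1: "e (- (z + \<tau>)) * q = e (- z)" by (simp add: e_minus)
    have "P (z + \<tau>) = qpoch q (e z * q) * qpoch q (e (- z))"
      unfolding P_def 1 by (simp add: e_add e\<tau>)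
    also have "\<dots> = qpoch q (e z * q) * ((1 - e (- z)) * qpoch q (e (- z) * q))"
      by (subst (2) qpoch_rec[OF q]) simp
    also have "1 - e (- z) = - e (- z) * (1 - e z)" using e_minus[of z] by (simp add: algebra_simps)
    also have "qpoch q (e z * q) * (- e (- z) * (1 - e z) * qpoch q (e (- z) * q)) = - e (- z) * P z"
      unfolding P_def by (subst (2) qpoch_rec[OF q]) simp
    also have "- e (- z) = exp (pi_i - two_pi_i * z)"
      unfolding e_def by (simp add: exp_diff exp_minus field_simps)
    finally show ?thesis .
  qed
  have quJ: "J (z + \<tau>) = exp (pi_i - two_pi_i * z) * J z" for z
  proof -
    have "J (z + \<tau>) = jtheta ((z + 1/2 - \<tau>/2) + \<tau>) \<tau>" by (simp add: J_def algebra_simps)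
    also have "\<dots> = exp (neg_pi_i * \<tau> - two_pi_i * (z + 1/2 - \<tau>/2)) * J z"
      unfolding jtheta_plus_period J_def ..
    also have "exp (neg_pi_i * \<tau> - two_pi_i * (z + 1/2 - \<tau>/2)) =
       exp (pi_i - two_pi_i * z) * exp (two_pi_i * of_int (- 1))"
      unfolding exp_add[symmetric] by (rule arg_cong[of _ _ exp]) (simp add: algebra_simps)
    finally show ?thesis unfolding exp_2pi_int by simp
  qed
  have cJ: "fourier_coeff J 0 = 1"
  proof -
    have "1 = integral {0..1} (\<lambda>x. jtheta (of_real x + (1/2 - \<tau>/2)) \<tau>)"
      using fourier_coeff_shift[OF holomorphic_jtheta[OF \<tau>] jtheta_plus_1, of 0 "1/2 - \<tau>/2"]
      by (simp add: fourier_coeff_jtheta_0[OF \<tau>])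
    then show ?thesis unfolding fourier_coeff_def J_def by (simp add: algebra_simps)
  qed
  \<comment> \<open>The zeroth coefficient of \<open>J\<close> is 1, so \<open>P\<close> is
    \<open>J\<close> times the zeroth coefficient of \<open>P\<close>. Whatever that constant is, a
    zero of \<open>J\<close> is a zero of \<open>P\<close>, and the zeros of \<open>P\<close> can be
    read off its factors.\<close>
  have "P z * 1 - fourier_coeff P 0 * J z = 0" for z
  proof (rule entire_quasiperiodic_eq_0[where D = "\<lambda>z. P z * 1 - fourier_coeff P 0 * J z" and s = \<tau> and \<kappa> = "pi_i"])
    show "fourier_coeff (\<lambda>z. P z * 1 - fourier_coeff P 0 * J z) 0 = 0"
      by (subst fourier_coeff_diff) (auto simp: fourier_coeff_cmult cJ intro!: holomorphic_intros holP holJ)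
  qed (auto simp: perP perJ quP quJ algebra_simps intro!: holomorphic_intros holP holJ)
  from this[of z] have "P z = 0" using zero by (simp add: J_def)
  then consider "qpoch q (e z) = 0" | "qpoch q (e (- z) * q) = 0" by (auto simp: P_def)
  then obtain m :: int where "e (z + of_int m * \<tau>) = 1"
  proof cases
    case 1
    then obtain n where "e z * q ^ n = 1" by (rule qpoch_eq_0D[OF q])
    then have "e (z + of_int (int n) * \<tau>) = 1"
      by (simp add: e_add) (simp add: e_def q_def exp_of_nat_mult[symmetric] mult_ac)
    then show thesis using that by blast
  next
    case 2
    then obtain n where "e (- z) * q * q ^ n = 1" by (rule qpoch_eq_0D[OF q])
    then have "e (- z) * q ^ Suc n = 1" by (simp add: mult_ac)
    then have "e (- z + of_nat (Suc n) * \<tau>) = 1"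
      unfolding e_add by (simp add: e_def q_def exp_of_nat_mult[symmetric] mult_ac del: power_Suc of_nat_Suc)
    then have "e (z + of_int (- int (Suc n)) * \<tau>) = 1"
      using e_minus[of "- z + of_nat (Suc n) * \<tau>"] by (simp add: algebra_simps)
    then show thesis using that by blast
  qed
  then obtain k :: int where "Re (two_pi_i * (z + of_int m * \<tau>)) = 0"
    "Im (two_pi_i * (z + of_int m * \<tau>)) = of_int (2 * k) * pi"
    unfolding e_def exp_eq_1 by auto
  then have "z + of_int m * \<tau> = of_int k" by (auto simp: complex_eq_iff)
  then have "z = of_int k + of_int (- m) * \<tau>" by (simp add: algebra_simps)
  then show False using z unfolding lattice_def by blast
qed

section \<open>Reduction of \<open>theta\<close> to \<open>jtheta\<close> and its modular
  laws\<close>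

lemma theta_eq_jtheta:
  "theta u \<tau> = exp (pi_i * \<tau> / 4 + pi_i * (u + 1/2)) * jtheta (u + 1/2 + \<tau>/2) \<tau>"
proof -
  have "theta u \<tau> = (\<Sum>\<^sub>\<infinity>m. gterm (pi_i * \<tau>) (pi_i * \<tau> + two_pi_i * (u + 1/2))
      (pi_i * \<tau> / 4 + pi_i * (u + 1/2)) m)"
    unfolding theta_def Let_def qpow_def gterm_def exp_add[symmetric]
    by (intro infsum_cong arg_cong[of _ _ exp]) (simp add: field_simps power2_eq_square)
  also have "\<dots> = exp (pi_i * \<tau> / 4 + pi_i * (u + 1/2)) * jtheta (u + 1/2 + \<tau>/2) \<tau>"
    unfolding jtheta_def
    by (rule gterm_series_exp_shift[where m = 0], unfold gterm_def exp_add[symmetric], rule arg_cong[of _ _ exp])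
      (simp add: algebra_simps power2_eq_square)
  finally show ?thesis .
qed

text \<open>\<open>theta\<close> involves the shift +\<tau>/2 and \<open>jtheta_nonzero\<close> the
  shift -\<tau>/2, hence the passage through \<open>u + \<tau>\<close>.\<close>

lemma theta_nonzero:
  assumes "Im \<tau> > 0" "u \<notin> lattice \<tau>" shows "theta u \<tau> \<noteq> 0"
  using jtheta_nonzero[OF assms(1), of "u + \<tau>"] assms(2) lattice_add_period[of u \<tau>]
  unfolding theta_eq_jtheta by (simp add: algebra_simps)

lemma jtheta_minus: "jtheta (- z) \<sigma> = jtheta z \<sigma>"
proof -
  have "bij_betw (\<lambda>n::int. - n) UNIV UNIV" by (rule bij_betwI[where g = uminus]) auto
  from infsum_reindex_bij_betw[OF this, of "gterm (pi_i * \<sigma>) (two_pi_i * z) 0"]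
  show ?thesis unfolding jtheta_def gterm_def by simp
qed

lemma jtheta_inversion:
  assumes "Im \<sigma> > 0"
  shows "jtheta (z / \<sigma>) (- 1 / \<sigma>) = csqrt (- \<i> * \<sigma>) * exp (pi_i * z\<^sup>2 / \<sigma>) * jtheta z \<sigma>"
proof -
  have s: "\<sigma> \<noteq> 0" using assms by auto
  have "jtheta (z / \<sigma>) (- 1 / \<sigma>) = jtheta (- z / \<sigma>) (- 1 / \<sigma>)"
    using jtheta_minus[of "z / \<sigma>"] by simp
  also have "\<dots> = exp (pi_i * z\<^sup>2 / \<sigma>) * jgauss z \<sigma>"
    unfolding jtheta_def jgauss_def
    by (rule gterm_series_exp_shift[where m = 0], unfold gterm_def exp_add[symmetric], rule arg_cong[of _ _ exp])
      (use s in \<open>simp add: field_simps\<close>)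
  finally show ?thesis using jacobi_transformation[OF assms, of z] by simp
qed

lemma theta_inversion:
  assumes "Im \<tau> > 0"
  shows "theta (u / \<tau>) (- 1 / \<tau>) = - \<i> * csqrt (- \<i> * \<tau>) * exp (pi_i * u\<^sup>2 / \<tau>) * theta u \<tau>"
proof -
  have t: "\<tau> \<noteq> 0" using assms by auto
  \<comment> \<open>Subtracting the period 1 from the argument at \<tau> makes the argument on the
    dual side exactly \<open>?z / \<tau>\<close>.\<close>
  let ?z = "u + \<tau>/2 - 1/2"
  have J: "jtheta (u + 1/2 + \<tau>/2) \<tau> = jtheta ?z \<tau>"
    using jtheta_plus_1[of ?z \<tau>] by (simp add: algebra_simps)
  have z: "u / \<tau> + 1/2 + (- 1 / \<tau>)/2 = ?z / \<tau>" using t by (simp add: field_simps)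
  have mi: "exp (- (pi_i / 2)) = - \<i>"
    using exp_pi_i' cis_minus_pi_half by (simp add: cis_conv_exp mult_ac)
  have "exp (pi_i * (- 1 / \<tau>) / 4 + pi_i * (u / \<tau> + 1/2)) * exp (pi_i * ?z\<^sup>2 / \<tau>) =
     exp (- (pi_i / 2)) * exp (pi_i * u\<^sup>2 / \<tau>) * exp (pi_i * \<tau> / 4 + pi_i * (u + 1/2))"
    unfolding exp_add[symmetric]
    by (rule arg_cong[of _ _ exp]) (use t in \<open>simp add: field_simps power2_eq_square\<close>)
  then show ?thesis
    unfolding theta_eq_jtheta z jtheta_inversion[OF assms] J mi by (simp add: mult_ac)
qed

text \<open>For integral m, (m + 1/2)^2 / 2 = m (m + 1) / 2 + 1/8 and the first summand is an
  integer, so all terms acquire the same factor.\<close>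

lemma theta_plus_1:
  "theta u (\<tau> + 1) = exp (pi_i / 4) * theta u \<tau>"
proof -
  have "exp (two_pi_i * (of_int m + 1/2) * (u + 1/2)) * qpow (\<tau> + 1) ((of_int m + 1/2)\<^sup>2 / 2) =
     exp (pi_i / 4) * (exp (two_pi_i * (of_int m + 1/2) * (u + 1/2)) * qpow \<tau> ((of_int m + 1/2)\<^sup>2 / 2))" for m :: int
  proof -
    have "even (m * (m + 1))" by simp
    then obtain k where k: "m * (m + 1) = 2 * k" by blast
    have "(of_int m + 1/2)\<^sup>2 / 2 = (of_int (m * (m + 1)) / 2 + 1 / 8 :: complex)"
      by (simp add: power2_eq_square field_simps)
    then have h: "(of_int m + 1/2)\<^sup>2 / 2 = (of_int k + 1 / 8 :: complex)" unfolding k by simp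
    have "qpow (\<tau> + 1) ((of_int m + 1/2)\<^sup>2 / 2) =
       exp (pi_i / 4) * exp (two_pi_i * of_int k) * qpow \<tau> ((of_int m + 1/2)\<^sup>2 / 2)"
      unfolding qpow_def h exp_add[symmetric] by (intro arg_cong[of _ _ exp]) (simp add: algebra_simps)
    then show ?thesis unfolding exp_2pi_int by simp
  qed
  then show ?thesis unfolding theta_def Let_def infsum_cmult_right'[symmetric] by (intro infsum_cong)
qed

text \<open>These terms are the one-variable factors in the summand of \<open>muN\<close>, with
  (-1)^n written as exp (pi i n). Reflection and the two quasiperiods of \<open>jtheta\<close> turn
  their sum into \<open>theta\<close>.\<close>

lemma sum_eq_theta:
  "(\<Sum>\<^sub>\<infinity>n. gterm (pi_i * \<tau>) (pi_i * \<tau> + pi_i - two_pi_i * u) 0 n) =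
    \<i> * exp (pi_i * u) * qpow \<tau> (- 1 / 8) * theta u \<tau>"
proof -
  let ?z = "u - \<tau>/2 + 1/2"
  have "(\<Sum>\<^sub>\<infinity>n. gterm (pi_i * \<tau>) (pi_i * \<tau> + pi_i - two_pi_i * u) 0 n) =
     jtheta (- (u - \<tau>/2 - 1/2)) \<tau>"
    unfolding jtheta_def by (simp add: algebra_simps)
  also have "\<dots> = jtheta ?z \<tau>"
    unfolding jtheta_minus using jtheta_plus_1[of "u - \<tau>/2 - 1/2" \<tau>] by (simp add: algebra_simps)
  finally have A: "(\<Sum>\<^sub>\<infinity>n. gterm (pi_i * \<tau>) (pi_i * \<tau> + pi_i - two_pi_i * u) 0 n) = jtheta ?z \<tau>" .
  have B: "jtheta (u + 1/2 + \<tau>/2) \<tau> = exp (neg_pi_i * \<tau> - two_pi_i * ?z) * jtheta ?z \<tau>"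
    using jtheta_plus_period[of ?z \<tau>] by (simp add: algebra_simps)
  have I: "exp (pi_i / 2) = \<i>" using cis_pi_half by (simp add: cis_conv_exp mult_ac)
  have "exp (pi_i / 2) * exp (pi_i * u) * qpow \<tau> (- 1 / 8) *
     exp (pi_i * \<tau> / 4 + pi_i * (u + 1/2)) * exp (neg_pi_i * \<tau> - two_pi_i * ?z) = exp 0"
    unfolding qpow_def exp_add[symmetric] by (rule arg_cong[of _ _ exp]) (simp add: field_simps)
  then show ?thesis unfolding A theta_eq_jtheta B I by (simp add: mult.assoc[symmetric])
qed

section \<open>Fourier coefficients of products of theta functions\<close>

lemma abs_summable_prod_PiE:
  fixes f :: "'a \<Rightarrow> 'b \<Rightarrow> complex"
  assumes A: "finite A" and sm: "\<And>x. x \<in> A \<Longrightarrow> (\<lambda>y. norm (f x y)) summable_on B x"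
  shows "(\<lambda>g. norm (\<Prod>x\<in>A. f x (g x))) summable_on PiE A B"
proof (rule nonneg_bdd_above_summable_on)
  show "bdd_above (sum (\<lambda>g. norm (\<Prod>x\<in>A. f x (g x))) ` {F. F \<subseteq> PiE A B \<and> finite F})"
  proof (rule bdd_aboveI2)
    fix Y assume Y: "Y \<in> {F. F \<subseteq> PiE A B \<and> finite F}"
    \<comment> \<open>The coordinate projections of \<open>Y\<close>: the finite set
      \<open>Y\<close> lies in a finite box, over which the sum of products factorises.\<close>
    define F where "F = (\<lambda>x. (\<lambda>g. g x) ` Y)"
    have F: "finite (F x)" "x \<in> A \<Longrightarrow> F x \<subseteq> B x" for x using Y by (auto simp: F_def PiE_iff)
    have "Y \<subseteq> PiE A F" using Y by (auto simp: F_def PiE_iff)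
    then have "(\<Sum>g\<in>Y. norm (\<Prod>x\<in>A. f x (g x))) \<le> (\<Sum>g\<in>PiE A F. norm (\<Prod>x\<in>A. f x (g x)))"
      by (intro sum_mono2 finite_PiE A F) auto
    also have "\<dots> = (\<Prod>x\<in>A. \<Sum>y\<in>F x. norm (f x y))"
      unfolding prod_norm[symmetric] by (rule prod_sum_PiE[symmetric]) (use A F in auto)
    also have "\<dots> \<le> (\<Prod>x\<in>A. \<Sum>\<^sub>\<infinity>y\<in>B x. norm (f x y))"
      by (intro prod_mono conjI sum_nonneg finite_sum_le_infsum sm F) auto
    finally show "(\<Sum>g\<in>Y. norm (\<Prod>x\<in>A. f x (g x))) \<le> (\<Prod>x\<in>A. \<Sum>\<^sub>\<infinity>y\<in>B x. norm (f x y))" .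
  qed
qed auto

text \<open>Points of \<open>ZN\<close> are 0 outside the index range, those of \<open>PiE\<close>
  are \<open>undefined\<close> there. Restriction mediates, so that product theorems for
  \<open>PiE\<close> apply to \<open>ZN\<close>.\<close>

lemma bij_betw_restrict_ZN: "bij_betw (\<lambda>n. restrict n {1..N}) (ZN N) (PiE {1..N} (\<lambda>_. UNIV))"
  by (rule bij_betwI[where g = "\<lambda>g j. if j \<in> {1..N} then g j else 0"])
    (auto simp: ZN_def fun_eq_iff PiE_def extensional_def restrict_def)

text \<open>Fubini over the graph of \<open>g\<close>. The weight is constant on fibres, so it
  leaves the inner sum, and its boundedness preserves absolute convergence.\<close>

lemma infsum_fibres:
  fixes f :: "'a \<Rightarrow> complex" and g :: "'a \<Rightarrow> 'b" and \<psi> :: "'b \<Rightarrow> complex"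
  assumes sm: "(\<lambda>x. norm (f x)) summable_on X" and K: "\<And>x. x \<in> X \<Longrightarrow> norm (\<psi> (g x)) \<le> K"
  shows "(\<Sum>\<^sub>\<infinity>x\<in>X. \<psi> (g x) * f x) = (\<Sum>\<^sub>\<infinity>l. \<psi> l * (\<Sum>\<^sub>\<infinity>x\<in>{x\<in>X. g x = l}. f x))"
    and "(\<lambda>l. norm (\<Sum>\<^sub>\<infinity>x\<in>{x\<in>X. g x = l}. f x)) summable_on UNIV"
proof -
  let ?F = "\<lambda>l. {x\<in>X. g x = l}"
  have bij: "bij_betw (\<lambda>x. (g x, x)) X (Sigma UNIV ?F)"
    by (rule bij_betwI[where g = snd]) auto
  have sS: "(\<lambda>p. norm (f (snd p))) summable_on Sigma UNIV ?F"
    using summable_on_reindex_bij_betw[OF bij, of "\<lambda>p. norm (f (snd p))"] sm by simp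
  have K0: "norm (\<psi> l * f x) \<le> max K 0 * norm (f x)" if "x \<in> ?F l" for l x
    unfolding norm_mult using K[of x] that by (intro mult_right_mono) auto
  have "(\<lambda>p. norm (\<psi> (fst p) * f (snd p))) summable_on Sigma UNIV ?F"
    by (rule summable_on_comparison_test[OF summable_on_cmult_right[OF sS, of "max K 0"]]) (use K0 in auto)
  then have s2: "(\<lambda>p. \<psi> (fst p) * f (snd p)) summable_on Sigma UNIV ?F" by (rule abs_summable_summable)
  have "(\<Sum>\<^sub>\<infinity>x\<in>X. \<psi> (g x) * f x) = (\<Sum>\<^sub>\<infinity>p\<in>Sigma UNIV ?F. \<psi> (fst p) * f (snd p))"
    using infsum_reindex_bij_betw[OF bij, of "\<lambda>p. \<psi> (fst p) * f (snd p)"] by simp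
  also have "\<dots> = (\<Sum>\<^sub>\<infinity>l. \<Sum>\<^sub>\<infinity>x\<in>?F l. \<psi> l * f x)"
    using infsum_Sigma_banach[OF s2] by simp
  finally show "(\<Sum>\<^sub>\<infinity>x\<in>X. \<psi> (g x) * f x) = (\<Sum>\<^sub>\<infinity>l. \<psi> l * (\<Sum>\<^sub>\<infinity>x\<in>?F l. f x))"
    by (simp add: infsum_cmult_right')
  have sX: "(\<lambda>x. norm (f x)) summable_on ?F l" for l by (rule summable_on_subset_banach[OF sm]) auto
  have "(\<lambda>l. \<Sum>\<^sub>\<infinity>x\<in>?F l. norm (f x)) summable_on UNIV"
    by (rule summable_on_Sigma_banach) (use sS in \<open>simp add: case_prod_unfold\<close>)
  then show "(\<lambda>l. norm (\<Sum>\<^sub>\<infinity>x\<in>?F l. f x)) summable_on UNIV"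
    by (rule summable_on_comparison_test) (auto intro: norm_infsum_bound sX)
qed

text \<open>The summand of \<open>muN\<close> stripped of the kernel in \<open>u0\<close> and of the
  theta denominators, with the signs absorbed as exp (pi i n_j).\<close>

definition lcoef :: "nat \<Rightarrow> (nat \<Rightarrow> complex) \<Rightarrow> complex \<Rightarrow> (nat \<Rightarrow> int) \<Rightarrow> complex" where
  "lcoef N uu \<tau> n = (\<Prod>j\<in>{1..N}. gterm (pi_i * \<tau>)
     (pi_i * \<tau> + pi_i - two_pi_i * uu j) 0 (n j))"

text \<open>Grouping \<open>\<int>\<^sup>N\<close> by \<open>|n|\<close> turns \<open>\<mu>\<^sub>N\<close> into a one-dimensional Appell sum over these coefficients.\<close>

definition acoef :: "nat \<Rightarrow> (nat \<Rightarrow> complex) \<Rightarrow> complex \<Rightarrow> int \<Rightarrow> complex" where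
  "acoef N uu \<tau> l = (\<Sum>\<^sub>\<infinity>n\<in>{n\<in>ZN N. (\<Sum>j\<in>{1..N}. n j) = l}. lcoef N uu \<tau> n)"

lemma exp_pi_int: "exp (pi_i * of_int n) = (-1) powi n"
proof -
  have "exp (pi_i * of_int n) = exp (pi_i) powi n"
    by (metis exp_power_int mult.commute)
  then show ?thesis by simp
qed

lemma lcoef_summable:
  assumes "Im \<tau> > 0" shows "(\<lambda>n. norm (lcoef N uu \<tau> n)) summable_on ZN N"
proof -
  have "(\<lambda>g. norm (lcoef N uu \<tau> g)) summable_on (PiE {1..N} (\<lambda>_. UNIV))"
    unfolding lcoef_def by (intro abs_summable_prod_PiE gterm_summable) (use assms in auto)
  then have "(\<lambda>n. norm (lcoef N uu \<tau> (restrict n {1..N}))) summable_on ZN N"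
    by (subst summable_on_reindex_bij_betw[OF bij_betw_restrict_ZN])
  then show ?thesis by (simp add: lcoef_def)
qed

lemma infsum_lcoef:
  assumes "Im \<tau> > 0"
  shows "(\<Sum>\<^sub>\<infinity>n\<in>ZN N. lcoef N uu \<tau> n) =
    (\<Prod>j\<in>{1..N}. \<i> * exp (pi_i * uu j) * qpow \<tau> (- 1 / 8) * theta (uu j) \<tau>)"
proof -
  have "(\<Sum>\<^sub>\<infinity>n\<in>ZN N. lcoef N uu \<tau> (restrict n {1..N})) = (\<Sum>\<^sub>\<infinity>g\<in>PiE {1..N} (\<lambda>_. UNIV). lcoef N uu \<tau> g)"
    by (rule infsum_reindex_bij_betw[OF bij_betw_restrict_ZN])
  also have "\<dots> = (\<Prod>j\<in>{1..N}. \<Sum>\<^sub>\<infinity>n. gterm (pi_i * \<tau>)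
     (pi_i * \<tau> + pi_i - two_pi_i * uu j) 0 n)"
    unfolding lcoef_def
  proof (rule infsum_prod_PiE[OF _ _ abs_summable_summable[OF abs_summable_prod_PiE]])
    show "gterm (pi_i * \<tau>) (pi_i * \<tau> + pi_i - two_pi_i * uu j) 0 summable_on UNIV" for j
      using gterm_summable(2)[of "pi_i * \<tau>"] assms by simp
    show "(\<lambda>y. norm (gterm (pi_i * \<tau>) (pi_i * \<tau> + pi_i - two_pi_i * uu j) 0 y)) summable_on UNIV" for j
      by (rule gterm_summable(1)) (use assms in simp)
  qed auto
  also have "\<dots> = (\<Prod>j\<in>{1..N}. \<i> * exp (pi_i * uu j) * qpow \<tau> (- 1 / 8) * theta (uu j) \<tau>)"
    by (simp only: sum_eq_theta)
  finally show ?thesis by (simp add: lcoef_def)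
qed

lemma acoef_summable:
  assumes "Im \<tau> > 0" shows "(\<lambda>l. norm (acoef N uu \<tau> l)) summable_on UNIV"
  unfolding acoef_def
  by (rule infsum_fibres(2)[OF lcoef_summable[OF assms], where \<psi> = "\<lambda>_. 0" and K = 0]) auto

lemma infsum_acoef_weighted:
  assumes "Im \<tau> > 0" "\<And>l. norm (\<psi> l) \<le> K"
  shows "(\<Sum>\<^sub>\<infinity>n\<in>ZN N. \<psi> (\<Sum>j\<in>{1..N}. n j) * lcoef N uu \<tau> n) = (\<Sum>\<^sub>\<infinity>l. \<psi> l * acoef N uu \<tau> l)"
  unfolding acoef_def
  by (rule infsum_fibres(1)[OF lcoef_summable[OF assms(1)], where \<psi> = \<psi> and K = K]) (use assms(2) in auto)

text \<open>A common translation enters only through the sum of the \<open>n j\<close>, which is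
  fixed on the fibre. This is what makes the \<open>acoef\<close> Fourier coefficients of a product
  of theta functions.\<close>

lemma acoef_translate:
  "acoef N (\<lambda>j. uu j + x) \<tau> l = exp (neg_two_pi_i * of_int l * x) * acoef N uu \<tau> l"
proof -
  have "lcoef N (\<lambda>j. uu j + x) \<tau> n = exp (neg_two_pi_i * of_int l * x) * lcoef N uu \<tau> n"
    if "(\<Sum>j\<in>{1..N}. n j) = l" for n
  proof -
    have l: "of_int l = (\<Sum>j\<in>{1..N}. of_int (n j) :: complex)" using that by (metis of_int_sum)
    have "lcoef N (\<lambda>j. uu j + x) \<tau> n = (\<Prod>j\<in>{1..N}. exp (neg_two_pi_i * of_int (n j) * x) *
      gterm (pi_i * \<tau>) (pi_i * \<tau> + pi_i - two_pi_i * uu j) 0 (n j))"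
      unfolding lcoef_def gterm_def exp_add[symmetric] by (intro prod.cong refl arg_cong[of _ _ exp]) (simp add: algebra_simps)
    also have "\<dots> = exp (\<Sum>j\<in>{1..N}. - two_pi_i * of_int (n j) * x) * lcoef N uu \<tau> n"
      unfolding lcoef_def prod.distrib by (simp add: exp_sum)
    also have "(\<Sum>j\<in>{1..N}. - two_pi_i * of_int (n j) * x) = neg_two_pi_i * of_int l * x"
      unfolding l by (simp add: sum_distrib_left sum_distrib_right)
    finally show ?thesis .
  qed
  then show ?thesis unfolding acoef_def infsum_cmult_right'[symmetric]
    by (intro infsum_cong) auto
qed

lemma infsum_acoef_exp:
  assumes "Im \<tau> > 0"
  shows "(\<Sum>\<^sub>\<infinity>l. acoef N uu \<tau> l * exp (neg_two_pi_i * of_int l * x)) =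
    (\<Prod>j\<in>{1..N}. \<i> * exp (pi_i * (uu j + x)) * qpow \<tau> (- 1 / 8) * theta (uu j + x) \<tau>)"
proof -
  have "(\<Sum>\<^sub>\<infinity>l. acoef N uu \<tau> l * exp (neg_two_pi_i * of_int l * x)) = (\<Sum>\<^sub>\<infinity>l. 1 * acoef N (\<lambda>j. uu j + x) \<tau> l)"
    by (simp add: acoef_translate mult.commute)
  also have "\<dots> = (\<Sum>\<^sub>\<infinity>n\<in>ZN N. 1 * lcoef N (\<lambda>j. uu j + x) \<tau> n)"
    by (rule infsum_acoef_weighted[OF assms, of "\<lambda>_. 1" 1, symmetric]) simp
  finally show ?thesis by (simp add: infsum_lcoef[OF assms])
qed

lemma acoef_exp_summable:
  assumes "Im \<tau> > 0"
  shows "(\<lambda>l. norm (acoef N uu \<tau> l * exp (neg_two_pi_i * of_int l * x))) summable_on UNIV"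
  using acoef_summable[OF assms, of N "\<lambda>j. uu j + x"] unfolding acoef_translate by (simp only: mult.commute)

text \<open>Adding 1 to every \<open>n j\<close> raises the sum by N and changes each Gaussian
  factor by an explicit exponential. In terms of coefficients this is the quasiperiodicity of a
  theta product of degree N.\<close>

lemma acoef_rec:
  "acoef N uu \<tau> (l + int N) = (-1) ^ N * exp (neg_two_pi_i * (\<Sum>j\<in>{1..N}. uu j)) *
     qpow \<tau> (of_int l + of_nat N) * acoef N uu \<tau> l"
proof -
  let ?S = "\<lambda>n. \<Sum>j\<in>{1..N}. n j :: int"
  let ?g = "\<lambda>(n :: nat \<Rightarrow> int) j. if j \<in> {1..N} then n j + 1 else 0"
  let ?c = "(-1) ^ N * exp (neg_two_pi_i * (\<Sum>j\<in>{1..N}. uu j)) * qpow \<tau> (of_int l + of_nat N)"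
  have Sg: "?S (?g n) = ?S n + int N" for n by (simp add: sum.distrib)
  have bij: "bij_betw ?g {n\<in>ZN N. ?S n = l} {n\<in>ZN N. ?S n = l + int N}"
  proof (rule bij_betwI[where g = "\<lambda>n j. if j \<in> {1..N} then n j - 1 else 0"])
    show "?g \<in> {n \<in> ZN N. ?S n = l} \<rightarrow> {n \<in> ZN N. ?S n = l + int N}"
      using Sg by (auto simp: ZN_def)
    show "(\<lambda>n j. if j \<in> {1..N} then n j - 1 else 0) \<in> {n \<in> ZN N. ?S n = l + int N} \<rightarrow> {n \<in> ZN N. ?S n = l}"
      by (auto simp: ZN_def sum_subtractf)
  qed (auto simp: ZN_def fun_eq_iff)
  have "lcoef N uu \<tau> (?g n) = ?c * lcoef N uu \<tau> n" if "?S n = l" for n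
  proof -
    have l: "of_int l = (\<Sum>j\<in>{1..N}. of_int (n j) :: complex)" using that by (metis of_int_sum)
    have "lcoef N uu \<tau> (?g n) = (\<Prod>j\<in>{1..N}. exp (pi_i - two_pi_i * uu j + two_pi_i * (of_int (n j) + 1) * \<tau>) *
      gterm (pi_i * \<tau>) (pi_i * \<tau> + pi_i - two_pi_i * uu j) 0 (n j))"
      unfolding lcoef_def gterm_def exp_add[symmetric]
      by (intro prod.cong refl arg_cong[of _ _ exp]) (simp add: algebra_simps power2_eq_square)
    also have "\<dots> = exp (\<Sum>j\<in>{1..N}. pi_i - two_pi_i * uu j + two_pi_i * (of_int (n j) + 1) * \<tau>) * lcoef N uu \<tau> n"
      unfolding lcoef_def prod.distrib by (simp add: exp_sum)
    also have "(\<Sum>j\<in>{1..N}. pi_i - two_pi_i * uu j + two_pi_i * (of_int (n j) + 1) * \<tau>) =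
      of_nat N * (pi_i) + (neg_two_pi_i * (\<Sum>j\<in>{1..N}. uu j)) + two_pi_i * (of_int l + of_nat N) * \<tau>"
      unfolding l by (simp add: sum.distrib sum_subtractf sum_distrib_left sum_distrib_right algebra_simps)
    also have "exp \<dots> = ?c" unfolding exp_add exp_of_nat_mult qpow_def by simp
    finally show ?thesis .
  qed
  then have "(\<Sum>\<^sub>\<infinity>n\<in>{n\<in>ZN N. ?S n = l}. lcoef N uu \<tau> (?g n)) = ?c * acoef N uu \<tau> l"
    unfolding acoef_def infsum_cmult_right'[symmetric] by (intro infsum_cong) auto
  then show ?thesis using infsum_reindex_bij_betw[OF bij, of "lcoef N uu \<tau>"] by (simp add: acoef_def)
qed

section \<open>The kernel of the Appell sum\<close>

definition psi :: "complex \<Rightarrow> int \<Rightarrow> complex \<Rightarrow> complex" where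
  "psi \<tau> l z = exp (pi_i * z) / (1 - exp (two_pi_i * z) * qpow \<tau> (of_int l))"

lemma exp_qpow_eq_1_iff:
  "exp (two_pi_i * z) * qpow \<tau> (of_int l) = 1 \<longleftrightarrow> z + of_int l * \<tau> \<in> \<int>"
proof -
  have "exp (two_pi_i * z) * qpow \<tau> (of_int l) = exp (two_pi_i * (z + of_int l * \<tau>))"
    unfolding qpow_def exp_add[symmetric] by (simp add: algebra_simps)
  then show ?thesis using exp_2pi_eq_1_iff[of "z + of_int l * \<tau>"] by simp
qed

text \<open>For large |l| the product of exponential and q-power in the denominator has modulus at
  most 1/2 or at least 2 throughout a ball, so the denominator is at least 1/2 in modulus; the
  finitely many other indices are handled by continuity. Indices with a pole at \<open>z0\<close>
  are exempt, so the bound also works around lattice points, where it isolates the polar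
  term.\<close>

lemma psi_locally_bounded:
  assumes \<tau>: "Im \<tau> > 0"
  obtains K where "eventually (\<lambda>z. \<forall>l. z0 + of_int l * \<tau> \<notin> \<int> \<longrightarrow>
      exp (two_pi_i * z) * qpow \<tau> (of_int l) \<noteq> 1 \<and> norm (psi \<tau> l z) \<le> K) (nhds z0)"
proof -
  define E where "E = exp (pi * (\<bar>Im z0\<bar> + 1))"
  have E1: "E \<ge> 1" by (simp add: E_def)
  \<comment> \<open>\<open>L\<close> makes \<open>2 * pi * L * Im \<tau>\<close> at least ln 2 plus
    a bound for \<open>2 * pi * |Im z|\<close> on the ball of radius 1 about
    \<open>z0\<close>.\<close>
  define L where "L = nat \<lceil>(ln 2 + 2 * pi * (\<bar>Im z0\<bar> + 1)) / (2 * pi * Im \<tau>)\<rceil>"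
  let ?I = "{l. \<bar>l\<bar> \<le> int L \<and> z0 + of_int l * \<tau> \<notin> \<int>}"
  define K where "K = 2 * E + (\<Sum>l\<in>?I. norm (psi \<tau> l z0) + 1)"
  have finI: "finite ?I" by (rule finite_subset[of _ "{- int L..int L}"]) auto
  have K1: "2 * E \<le> K" unfolding K_def by (simp add: sum_nonneg)
  have K2: "norm (psi \<tau> l z0) + 1 \<le> K" if "l \<in> ?I" for l
    using member_le_sum[OF that, of "\<lambda>l. norm (psi \<tau> l z0) + 1"] finI E1 unfolding K_def by simp
  let ?X = "\<lambda>l z. exp (two_pi_i * z) * qpow \<tau> (of_int l)"
  have small: "eventually (\<lambda>z. ?X l z \<noteq> 1 \<and> norm (psi \<tau> l z) < norm (psi \<tau> l z0) + 1) (nhds z0)"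
    if "l \<in> ?I" for l
  proof -
    have "?X l z0 \<noteq> 1" using that exp_qpow_eq_1_iff by auto
    have "isCont (?X l) z0" by (intro continuous_intros)
    then have "(?X l \<longlongrightarrow> ?X l z0) (nhds z0)"
      using tendsto_at_iff_tendsto_nhds[of "?X l" z0] by (simp only: isCont_def)
    then have 1: "eventually (\<lambda>z. ?X l z \<noteq> 1) (nhds z0)"
      using \<open>?X l z0 \<noteq> 1\<close> by (rule tendsto_imp_eventually_ne)
    have "isCont (\<lambda>z. norm (psi \<tau> l z)) z0"
      unfolding psi_def using \<open>?X l z0 \<noteq> 1\<close> by (intro continuous_intros) auto
    then have "((\<lambda>z. norm (psi \<tau> l z)) \<longlongrightarrow> norm (psi \<tau> l z0)) (nhds z0)"
      using tendsto_at_iff_tendsto_nhds[of "\<lambda>z. norm (psi \<tau> l z)" z0] by (simp only: isCont_def)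
    then have 2: "eventually (\<lambda>z. norm (psi \<tau> l z) < norm (psi \<tau> l z0) + 1) (nhds z0)"
      by (rule order_tendstoD) simp
    show ?thesis using 1 2 by eventually_elim auto
  qed
  have ev1: "eventually (\<lambda>z. \<forall>l\<in>?I. ?X l z \<noteq> 1 \<and> norm (psi \<tau> l z) < norm (psi \<tau> l z0) + 1) (nhds z0)"
    using small finI by (intro eventually_ball_finite) auto
  have ev2: "eventually (\<lambda>z. z \<in> ball z0 1) (nhds z0)"
    by (intro eventually_nhds_in_open) auto
  have big: "?X l z \<noteq> 1 \<and> norm (psi \<tau> l z) \<le> 2 * E" if z: "z \<in> ball z0 1" and l: "\<bar>l\<bar> > int L" for z l
  proof -
    have Im: "\<bar>Im z\<bar> \<le> \<bar>Im z0\<bar> + 1"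
      using z abs_Im_le_cmod[of "z0 - z"] by (simp add: dist_norm)
    have nE: "norm (exp (pi_i * z)) \<le> E"
    proof -
      have "pi * - Im z \<le> pi * (\<bar>Im z0\<bar> + 1)" using Im by (intro mult_left_mono) auto
      then show ?thesis unfolding E_def by simp
    qed
    have nX: "norm (?X l z) = exp (- 2 * pi * (Im z + of_int l * Im \<tau>))"
      by (simp add: norm_mult qpow_def algebra_simps exp_add[symmetric] exp_diff[symmetric] flip: exp_add)
    have "real L \<ge> (ln 2 + 2 * pi * (\<bar>Im z0\<bar> + 1)) / (2 * pi * Im \<tau>)"
      unfolding L_def by linarith
    then have "real L * (2 * pi * Im \<tau>) \<ge> ln 2 + 2 * pi * (\<bar>Im z0\<bar> + 1)"
      using \<tau> by (simp add: divide_le_eq)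
    moreover have "real L * (2 * pi * Im \<tau>) \<le> \<bar>of_int l\<bar> * (2 * pi * Im \<tau>)"
      using l \<tau> by (intro mult_right_mono) (linarith, simp)
    ultimately have lb: "ln 2 + 2 * pi * (\<bar>Im z0\<bar> + 1) \<le> \<bar>of_int l\<bar> * (2 * pi * Im \<tau>)" by linarith
    have Im2: "2 * pi * \<bar>Im z\<bar> \<le> 2 * pi * (\<bar>Im z0\<bar> + 1)" using Im by (intro mult_left_mono) auto
    have "norm (?X l z) \<le> 1/2 \<or> norm (?X l z) \<ge> 2"
    proof (cases "l > 0")
      case True
      have "- 2 * pi * (Im z + of_int l * Im \<tau>) \<le> 2 * pi * \<bar>Im z\<bar> - \<bar>of_int l\<bar> * (2 * pi * Im \<tau>)"
        using True abs_ge_minus_self[of "2 * pi * Im z"] by (simp add: algebra_simps abs_mult)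
      then have "- 2 * pi * (Im z + of_int l * Im \<tau>) \<le> - ln 2" using lb Im2 by linarith
      then have "exp (- 2 * pi * (Im z + of_int l * Im \<tau>)) \<le> exp (- ln 2)" by (rule exp_le_cancel_iff[THEN iffD2])
      then show ?thesis unfolding nX by (simp add: exp_minus)
    next
      case False
      have "- 2 * pi * (Im z + of_int l * Im \<tau>) \<ge> - (2 * pi * \<bar>Im z\<bar>) + \<bar>of_int l\<bar> * (2 * pi * Im \<tau>)"
        using False abs_ge_self[of "2 * pi * Im z"] by (simp add: algebra_simps abs_mult)
      then have "- 2 * pi * (Im z + of_int l * Im \<tau>) \<ge> ln 2" using lb Im2 by linarith
      then have "exp (ln 2) \<le> exp (- 2 * pi * (Im z + of_int l * Im \<tau>))" by (rule exp_le_cancel_iff[THEN iffD2])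
      then show ?thesis unfolding nX by simp
    qed
    then have d: "norm (1 - ?X l z) \<ge> 1/2"
      using norm_triangle_ineq2[of 1 "?X l z"] norm_triangle_ineq2[of "?X l z" 1] by (auto simp: norm_minus_commute)
    have "norm (psi \<tau> l z) \<le> E / (1/2)"
      unfolding psi_def norm_divide by (intro frac_le nE d) (use E1 in auto)
    then show ?thesis using d by auto
  qed
  show thesis
  proof (rule that[of K], use ev1 ev2 in eventually_elim, intro allI impI)
    fix z l assume z: "\<forall>l\<in>?I. ?X l z \<noteq> 1 \<and> norm (psi \<tau> l z) < norm (psi \<tau> l z0) + 1"
      "z \<in> ball z0 1" "z0 + of_int l * \<tau> \<notin> \<int>"
    show "?X l z \<noteq> 1 \<and> norm (psi \<tau> l z) \<le> K"
    proof (cases "\<bar>l\<bar> \<le> int L")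
      case True
      then have "l \<in> ?I" using z(3) by simp
      then show ?thesis using z(1) K2[of l] by force
    next
      case False
      then show ?thesis using big[OF z(2), of l] K1 by force
    qed
  qed
qed

section \<open>One-dimensional Appell functions\<close>

text \<open>The imaginary part determines the coefficient of \<tau>, after which the real part
  determines the integer; hence the two entries of the minimum.\<close>

lemma lattice_separated:
  assumes \<tau>: "Im \<tau> > 0" and p: "p \<in> lattice \<tau>" "p' \<in> lattice \<tau>" and d: "dist p' p < min 1 (Im \<tau>)"
  shows "p' = p"
proof -
  obtain a b a' b' where ab: "p = of_int a + of_int b * \<tau>" "p' = of_int a' + of_int b' * \<tau>"
    using p by (auto simp: lattice_def)
  have diff: "p' - p = of_int (a' - a) + of_int (b' - b) * \<tau>" by (simp add: ab algebra_simps)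
  have "\<bar>Im (p' - p)\<bar> < Im \<tau>" using d abs_Im_le_cmod[of "p' - p"] by (simp add: dist_norm)
  then have "\<bar>of_int (b' - b)\<bar> * Im \<tau> < 1 * Im \<tau>" using \<tau> unfolding diff by (simp add: abs_mult)
  then have "\<bar>real_of_int (b' - b)\<bar> < 1" using \<tau> mult_less_cancel_right_pos by blast
  then have b: "b' = b" by linarith
  have "\<bar>Re (p' - p)\<bar> < 1" using d abs_Re_le_cmod[of "p' - p"] by (simp add: dist_norm)
  then have "\<bar>real_of_int (a' - a)\<bar> < 1" unfolding diff b by simp
  then have "a' = a" by linarith
  then show ?thesis using b ab by simp
qed

lemma closed_lattice:
  assumes "Im \<tau> > 0" shows "closed (lattice \<tau>)"
  by (rule discrete_imp_closed[of "min 1 (Im \<tau>)"]) (use assms lattice_separated[OF assms] in auto)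

lemma lattice_isolated:
  assumes "Im \<tau> > 0" "p \<in> lattice \<tau>"
  shows "\<exists>r>0. ball p r \<inter> lattice \<tau> \<subseteq> {p}"
  using assms lattice_separated[OF assms(1,2)]
  by (intro exI[of _ "min 1 (Im \<tau>)"]) (auto simp: dist_commute)

lemma countable_lattice: "countable (lattice \<tau>)"
proof -
  have "lattice \<tau> = range (\<lambda>(a, b). of_int a + of_int b * \<tau>)" by (auto simp: lattice_def)
  then show ?thesis by simp
qed

lemma lattice_add:
  assumes "w \<in> lattice \<tau>" shows "w + of_int a + of_int b * \<tau> \<in> lattice \<tau>"
proof -
  obtain a' b' where "w = of_int a' + of_int b' * \<tau>" using assms by (auto simp: lattice_def)
  then have "w + of_int a + of_int b * \<tau> = of_int (a' + a) + of_int (b' + b) * \<tau>" by (simp add: algebra_simps)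
  then show ?thesis unfolding lattice_def by blast
qed

lemma lattice_add_iff: "w + of_int a + of_int b * \<tau> \<in> lattice \<tau> \<longleftrightarrow> w \<in> lattice \<tau>"
proof
  assume "w + of_int a + of_int b * \<tau> \<in> lattice \<tau>"
  from lattice_add[OF this, of "-a" "-b"] show "w \<in> lattice \<tau>" by (simp add: algebra_simps)
qed (rule lattice_add)

lemma notin_lattice_imp: "z \<notin> lattice \<tau> \<Longrightarrow> z + of_int l * \<tau> \<notin> \<int>"
proof
  assume z: "z \<notin> lattice \<tau>" and "z + of_int l * \<tau> \<in> \<int>"
  then obtain a where "z + of_int l * \<tau> = of_int a" by (auto elim: Ints_cases)
  then have "z = of_int a + of_int (- l) * \<tau>" by (simp add: algebra_simps)
  then show False using z unfolding lattice_def by blast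
qed

text \<open>For Im \<tau> > 0 the kernel tends to exp (pi i z) as l tends to +\<infinity> and does
  not decay, so convergence rests on the absolute summability of \<open>A\<close>.\<close>

definition appell :: "(int \<Rightarrow> complex) \<Rightarrow> complex \<Rightarrow> complex \<Rightarrow> complex" where
  "appell A \<tau> z = (\<Sum>\<^sub>\<infinity>l. A l * psi \<tau> l z)"

lemma psi_bounded:
  assumes "Im \<tau> > 0" "z \<notin> lattice \<tau>"
  obtains K where "\<And>l. norm (psi \<tau> l z) \<le> K"
proof -
  obtain K where "eventually (\<lambda>w. \<forall>l. z + of_int l * \<tau> \<notin> \<int> \<longrightarrow>
      exp (two_pi_i * w) * qpow \<tau> (of_int l) \<noteq> 1 \<and> norm (psi \<tau> l w) \<le> K) (nhds z)"
    by (rule psi_locally_bounded[OF assms(1)])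
  then have "norm (psi \<tau> l z) \<le> K" for l
    using eventually_nhds_x_imp_x notin_lattice_imp[OF assms(2), of l] by (auto dest!: eventually_nhds_x_imp_x)
  then show thesis by (rule that)
qed

lemma summable_mult_bounded:
  fixes f g :: "'a \<Rightarrow> complex"
  assumes "(\<lambda>l. norm (f l)) summable_on X" "\<And>l. l \<in> X \<Longrightarrow> norm (g l) \<le> K"
  shows "(\<lambda>l. norm (f l * g l)) summable_on X"
proof (rule summable_on_comparison_test)
  show "(\<lambda>l. norm (f l) * K) summable_on X" by (rule summable_on_cmult_left[OF assms(1)])
qed (use assms(2) in \<open>auto simp: norm_mult mult_left_mono\<close>)

lemma appell_summable:
  assumes "Im \<tau> > 0" "z \<notin> lattice \<tau>" and sm: "(\<lambda>l. norm (A l)) summable_on UNIV"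
  shows "(\<lambda>l. norm (A l * psi \<tau> l z)) summable_on UNIV" "(\<lambda>l. A l * psi \<tau> l z) summable_on UNIV"
proof -
  obtain K where "\<And>l. norm (psi \<tau> l z) \<le> K" using psi_bounded[OF assms(1,2)] by metis
  with sm show 1: "(\<lambda>l. norm (A l * psi \<tau> l z)) summable_on UNIV" by (rule summable_mult_bounded)
  then show "(\<lambda>l. A l * psi \<tau> l z) summable_on UNIV" by (rule abs_summable_summable)
qed

lemma holomorphic_appell:
  assumes \<tau>: "Im \<tau> > 0" and sm: "(\<lambda>l. norm (A l)) summable_on UNIV"
  shows "appell A \<tau> holomorphic_on - lattice \<tau>"
  unfolding appell_def
proof (rule holomorphic_on_infsum)
  show "(\<lambda>z. A l * psi \<tau> l z) holomorphic_on - lattice \<tau>" for l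
    unfolding psi_def using exp_qpow_eq_1_iff[of _ \<tau> l] notin_lattice_imp[of _ \<tau> l]
    by (intro holomorphic_intros) auto
  fix z assume z: "z \<in> - lattice \<tau>"
  obtain K where "eventually (\<lambda>w. \<forall>l. z + of_int l * \<tau> \<notin> \<int> \<longrightarrow>
      exp (two_pi_i * w) * qpow \<tau> (of_int l) \<noteq> 1 \<and> norm (psi \<tau> l w) \<le> K) (nhds z)"
    by (rule psi_locally_bounded[OF \<tau>])
  moreover have "eventually (\<lambda>w. w \<in> - lattice \<tau>) (nhds z)"
    using z closed_lattice[OF \<tau>] by (intro eventually_nhds_in_open) auto
  ultimately have "eventually (\<lambda>w. w \<in> - lattice \<tau> \<and> (\<forall>l. norm (psi \<tau> l w) \<le> K)) (nhds z)"
    by eventually_elim (use notin_lattice_imp[of z \<tau>] z in auto)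
  then obtain r where r0: "r > 0 \<and> (\<forall>w. dist w z < r \<longrightarrow> w \<in> - lattice \<tau> \<and> (\<forall>l. norm (psi \<tau> l w) \<le> K))"
    unfolding eventually_nhds_metric by (elim exE)
  then have r: "r > 0" "\<And>w. dist w z < r \<Longrightarrow> w \<in> - lattice \<tau> \<and> (\<forall>l. norm (psi \<tau> l w) \<le> K)" by auto
  have r2: "w \<in> - lattice \<tau> \<and> (\<forall>l. norm (psi \<tau> l w) \<le> K)" if "w \<in> cball z (r / 2)" for w
    using r(2)[of w] r(1) that by (simp add: dist_commute)
  show "\<exists>r>0. \<exists>M. cball z r \<subseteq> - lattice \<tau> \<and> M summable_on UNIV \<and>
      (\<forall>l\<in>UNIV. \<forall>w\<in>cball z r. norm (A l * psi \<tau> l w) \<le> M l)"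
  proof (intro exI[of _ "r / 2"] exI[of _ "\<lambda>l. norm (A l) * K"] conjI ballI)
    show "(\<lambda>l. norm (A l) * K) summable_on UNIV" by (rule summable_on_cmult_left[OF sm])
    show "norm (A l * psi \<tau> l w) \<le> norm (A l) * K" if "w \<in> cball z (r / 2)" for l w
      using r2[OF that] by (simp add: norm_mult mult_left_mono)
  qed (use r r2 in auto)
qed

text \<open>Only the term of index \<open>m\<close> is singular at \<open>w0\<close>. The others are
  bounded uniformly near \<open>w0\<close>, so the factor z - w0 kills their sum. The result is a
  limit rather than a residue because \<open>entire_extension\<close> asks for limits.\<close>

lemma appell_residue:
  assumes \<tau>: "Im \<tau> > 0" and sm: "(\<lambda>l. norm (A l)) summable_on UNIV" and w0: "w0 = of_int c - of_int m * \<tau>"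
  shows "((\<lambda>z. (z - w0) * appell A \<tau> z) \<longlongrightarrow> - A m * exp (pi_i * w0) / (two_pi_i)) (at w0)"
proof -
  have lat: "w0 \<in> lattice \<tau>" unfolding lattice_def w0
    by (rule CollectI, rule exI[of _ c], rule exI[of _ "- m"]) simp
  have notint: "w0 + of_int l * \<tau> \<notin> \<int>" if "l \<noteq> m" for l
  proof
    assume "w0 + of_int l * \<tau> \<in> \<int>"
    then obtain a where "w0 + of_int l * \<tau> = of_int a" by (auto elim: Ints_cases)
    then have "Im (w0 + of_int l * \<tau>) = Im (of_int a)" by (rule arg_cong)
    then have "of_int (l - m) * Im \<tau> = 0" by (simp add: w0 algebra_simps)
    then show False using that \<tau> by simp
  qed
  obtain K where K: "eventually (\<lambda>w. \<forall>l. w0 + of_int l * \<tau> \<notin> \<int> \<longrightarrow>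
      exp (two_pi_i * w) * qpow \<tau> (of_int l) \<noteq> 1 \<and> norm (psi \<tau> l w) \<le> K) (nhds w0)"
    by (rule psi_locally_bounded[OF \<tau>])
  obtain r where r: "r > 0" "ball w0 r \<inter> lattice \<tau> \<subseteq> {w0}" using lattice_isolated[OF \<tau> lat] by blast
  have "eventually (\<lambda>z. z \<in> ball w0 r - {w0}) (at w0)" by (intro eventually_at_in_open) (use r in auto)
  then have ev: "eventually (\<lambda>z. z \<notin> lattice \<tau>) (at w0)" by eventually_elim (use r in auto)
  have smm: "(\<lambda>l. norm (A l)) summable_on (UNIV - {m})" by (rule summable_on_subset_banach[OF sm]) auto
  define B where "B = (\<lambda>z. \<Sum>\<^sub>\<infinity>l\<in>UNIV - {m}. A l * psi \<tau> l z)"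
  have split: "appell A \<tau> z = A m * psi \<tau> m z + B z" if "z \<notin> lattice \<tau>" for z
  proof -
    have "(\<Sum>\<^sub>\<infinity>l\<in>insert m (UNIV - {m}). A l * psi \<tau> l z) = A m * psi \<tau> m z + B z"
      unfolding B_def using appell_summable(2)[OF \<tau> that sm]
      by (subst infsum_insert) (auto intro: summable_on_subset_banach)
    then show ?thesis unfolding appell_def by (simp add: insert_absorb)
  qed
  have "((\<lambda>z. (z - w0) * B z) \<longlongrightarrow> 0) (at w0)"
  proof (rule Lim_null_comparison)
    let ?M = "\<Sum>\<^sub>\<infinity>l\<in>UNIV - {m}. norm (A l) * K"
    have "((\<lambda>z. norm (z - w0) * ?M) \<longlongrightarrow> norm (w0 - w0) * ?M) (at w0)" by (intro tendsto_intros)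
    then show "((\<lambda>z. norm (z - w0) * ?M) \<longlongrightarrow> 0) (at w0)" by simp
    have "eventually (\<lambda>z. \<forall>l. w0 + of_int l * \<tau> \<notin> \<int> \<longrightarrow>
      exp (two_pi_i * z) * qpow \<tau> (of_int l) \<noteq> 1 \<and> norm (psi \<tau> l z) \<le> K) (at w0)"
      using K unfolding eventually_at_filter by (rule eventually_mono) simp
    then show "eventually (\<lambda>z. norm ((z - w0) * B z) \<le> norm (z - w0) * ?M) (at w0)"
    proof eventually_elim
      case (elim z)
      have K': "norm (psi \<tau> l z) \<le> K" if "l \<in> UNIV - {m}" for l
        using elim[rule_format, of l] notint[of l] that by simp
      have "norm (B z) \<le> ?M" unfolding B_def
      proof (rule norm_infsum_le)
        have s: "(\<lambda>l. norm (A l * psi \<tau> l z)) summable_on (UNIV - {m})"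
          by (rule summable_mult_bounded[OF smm K'])
        then show "((\<lambda>l. A l * psi \<tau> l z) has_sum (\<Sum>\<^sub>\<infinity>l\<in>UNIV - {m}. A l * psi \<tau> l z)) (UNIV - {m})"
          by (rule has_sum_infsum[OF abs_summable_summable])
        show "((\<lambda>l. norm (A l) * K) has_sum ?M) (UNIV - {m})"
          by (intro has_sum_infsum summable_on_cmult_left smm)
        show "norm (A l * psi \<tau> l z) \<le> norm (A l) * K" if "l \<in> UNIV - {m}" for l
          using K'[OF that] by (simp add: norm_mult mult_left_mono)
      qed
      then show ?case by (simp add: norm_mult mult_left_mono)
    qed
  qed
  moreover have "((\<lambda>z. (z - w0) * (A m * psi \<tau> m z)) \<longlongrightarrow> - A m * exp (pi_i * w0) / (two_pi_i)) (at w0)"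
  proof -
    let ?X = "\<lambda>z. 1 - exp (two_pi_i * z) * qpow \<tau> (of_int m)"
    have X0: "exp (two_pi_i * w0) * qpow \<tau> (of_int m) = 1"
      using exp_qpow_eq_1_iff[of w0 \<tau> m] by (simp add: w0)
    have "(?X has_field_derivative - (two_pi_i * (exp (two_pi_i * w0) * qpow \<tau> (of_int m)))) (at w0)"
      by (auto intro!: derivative_eq_intros)
    then have "((\<lambda>z. (?X z - ?X w0) / (z - w0)) \<longlongrightarrow> - (two_pi_i)) (at w0)"
      unfolding X0 has_field_derivative_iff by simp
    then have d: "((\<lambda>z. ?X z / (z - w0)) \<longlongrightarrow> - (two_pi_i)) (at w0)" by (simp add: X0)
    have "((\<lambda>z. A m * exp (pi_i * z) / (?X z / (z - w0))) \<longlongrightarrow>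
       A m * exp (pi_i * w0) / (- (two_pi_i))) (at w0)"
      by (intro tendsto_divide d tendsto_intros) auto
    then show ?thesis by (simp add: psi_def mult_ac)
  qed
  ultimately have "((\<lambda>z. (z - w0) * (A m * psi \<tau> m z) + (z - w0) * B z) \<longlongrightarrow>
      - A m * exp (pi_i * w0) / (two_pi_i) + 0) (at w0)" by (rule tendsto_add[rotated])
  then show ?thesis
    by (rule Lim_transform_eventually[OF _ eventually_mono[OF ev], THEN tendsto_eq_rhs])
      (simp_all add: split distrib_left)
qed

lemma infsum_diff_complex:
  fixes f g :: "'a \<Rightarrow> complex"
  assumes "f summable_on A" "g summable_on A"
  shows "infsum f A - infsum g A = (\<Sum>\<^sub>\<infinity>x\<in>A. f x - g x)"
  using infsum_add[OF assms(1), of "\<lambda>x. - g x"] assms(2) by (simp add: infsum_uminus summable_on_uminus)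

text \<open>By the recursion, the prefactor and the shift by N \<tau> amount to the index shift l +
  N and the weight 1/X, where X is the exponential in the denominator of \<open>psi\<close>. The
  difference \<open>psi\<close> times (1 - 1/X) loses its denominator, and what remains is the
  Fourier series with coefficients \<open>A\<close> at the point \<tau>.\<close>

lemma appell_quasiperiodic:
  assumes \<tau>: "Im \<tau> > 0" and z: "z \<notin> lattice \<tau>" and sm: "(\<lambda>l. norm (A l)) summable_on UNIV"
    and rec: "\<And>l. A (l + int N) = (-1) ^ N * exp (neg_two_pi_i * U) * qpow \<tau> (of_int l + of_nat N) * A l"
  shows "appell A \<tau> z - (-1) ^ N * exp (neg_two_pi_i * (z + U)) * qpow \<tau> (- of_nat N / 2) * appell A \<tau> (z + of_nat N * \<tau>) =
    - exp (neg_pi_i * z) * (\<Sum>\<^sub>\<infinity>l. A l * exp (neg_two_pi_i * of_int l * \<tau>))"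
proof -
  let ?c = "(-1) ^ N * exp (neg_two_pi_i * (z + U)) * qpow \<tau> (- of_nat N / 2)"
  let ?f = "\<lambda>l. exp (neg_two_pi_i * (z + of_int l * \<tau>)) * (A l * psi \<tau> l z)"
  have z': "z + of_nat N * \<tau> \<notin> lattice \<tau>" using z lattice_add_iff[of z 0 "int N" \<tau>] by simp
  have eq: "?c * (A l * psi \<tau> l (z + of_nat N * \<tau>)) = ?f (l + int N)" for l
  proof -
    have den: "exp (two_pi_i * (z + of_nat N * \<tau>)) * qpow \<tau> (of_int l) =
       exp (two_pi_i * z) * qpow \<tau> (of_int (l + int N))"
      unfolding qpow_def exp_add[symmetric] by (rule arg_cong[of _ _ exp]) (simp add: algebra_simps)
    have "exp (neg_two_pi_i * (z + U)) * qpow \<tau> (- of_nat N / 2) * exp (pi_i * (z + of_nat N * \<tau>)) =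
       exp (neg_two_pi_i * (z + of_int (l + int N) * \<tau>)) * exp (neg_two_pi_i * U) *
       qpow \<tau> (of_int l + of_nat N) * exp (pi_i * z)" (is "?L = ?R")
      unfolding qpow_def exp_add[symmetric] by (rule arg_cong[of _ _ exp]) (simp add: algebra_simps)
    then have e: "?L = ?R" .
    let ?D = "1 - exp (two_pi_i * z) * qpow \<tau> (of_int (l + int N))"
    have "?c * (A l * psi \<tau> l (z + of_nat N * \<tau>)) = ?L * ((-1) ^ N * A l / ?D)"
      unfolding psi_def den by (simp only: times_divide_eq_left times_divide_eq_right mult_ac)
    also have "\<dots> = ?f (l + int N)"
      unfolding e psi_def rec by (simp only: times_divide_eq_left times_divide_eq_right mult_ac)
    finally show ?thesis .
  qed
  have s1: "(\<lambda>l. A l * psi \<tau> l z) summable_on UNIV" by (rule appell_summable[OF \<tau> z sm])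
  have "(\<lambda>l. ?c * (A l * psi \<tau> l (z + of_nat N * \<tau>))) summable_on UNIV"
    by (intro summable_on_cmult_right appell_summable(2)[OF \<tau> z' sm])
  then have "(\<lambda>l. ?f (l + int N)) summable_on UNIV" unfolding eq .
  moreover have bij: "bij_betw (\<lambda>l::int. l + int N) UNIV UNIV"
    by (rule bij_betwI[where g = "\<lambda>n. n - int N"]) auto
  ultimately have s2: "?f summable_on UNIV" using summable_on_reindex_bij_betw[OF bij, of ?f] by blast
  have "?c * appell A \<tau> (z + of_nat N * \<tau>) = (\<Sum>\<^sub>\<infinity>l. ?f (l + int N))"
    unfolding appell_def infsum_cmult_right'[symmetric] eq ..
  also have "\<dots> = (\<Sum>\<^sub>\<infinity>l. ?f l)" by (rule infsum_shift_int)
  finally have "appell A \<tau> z - ?c * appell A \<tau> (z + of_nat N * \<tau>) = (\<Sum>\<^sub>\<infinity>l. A l * psi \<tau> l z - ?f l)"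
    unfolding appell_def using infsum_diff_complex[OF s1 s2] by simp
  also have "\<dots> = (\<Sum>\<^sub>\<infinity>l. - exp (neg_pi_i * z) * (A l * exp (neg_two_pi_i * of_int l * \<tau>)))"
  proof (intro infsum_cong)
    fix l
    define X where "X = exp (two_pi_i * z) * qpow \<tau> (of_int l)"
    have X: "X \<noteq> 1" "X \<noteq> 0"
      using exp_qpow_eq_1_iff[of z \<tau> l] notin_lattice_imp[OF z, of l] unfolding X_def by (auto simp: qpow_def)
    have "exp (neg_two_pi_i * (z + of_int l * \<tau>)) * X = exp 0"
      unfolding X_def qpow_def exp_add[symmetric] by (rule arg_cong[of _ _ exp]) (simp add: algebra_simps)
    then have i: "exp (neg_two_pi_i * (z + of_int l * \<tau>)) = 1 / X"
      using X(2) by (simp add: eq_divide_eq)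
    have p: "psi \<tau> l z = exp (pi_i * z) / (1 - X)" by (simp add: psi_def X_def)
    have "exp (neg_pi_i * z) * exp (neg_two_pi_i * of_int l * \<tau>) = exp (pi_i * z) * (1 / X)"
      unfolding i[symmetric] exp_add[symmetric] by (rule arg_cong[of _ _ exp]) (simp add: algebra_simps)
    then have h: "- exp (neg_pi_i * z) * (A l * exp (neg_two_pi_i * of_int l * \<tau>)) = - A l * (exp (pi_i * z) * (1 / X))"
      by (simp add: mult_ac)
    have "a * (e / (1 - X)) - 1 / X * (a * (e / (1 - X))) = - a * (e * (1 / X))" for a e :: complex
      using X by (simp add: divide_simps) algebra
    then show "A l * psi \<tau> l z - ?f l = - exp (neg_pi_i * z) * (A l * exp (neg_two_pi_i * of_int l * \<tau>))"
      unfolding h i p .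
  qed
  finally show ?thesis by (simp only: infsum_cmult_right')
qed

lemma muN_eq_appell:
  assumes "Im \<tau> > 0" "u0 \<notin> lattice \<tau>"
  shows "muN N u0 uu \<tau> = appell (acoef N uu \<tau>) \<tau> u0 / (\<Prod>j\<in>{1..N}. theta (uu j) \<tau>)"
proof -
  obtain K where K: "\<And>l. norm (psi \<tau> l u0) \<le> K" using psi_bounded[OF assms] by metis
  have "(-1) powi m * exp (neg_two_pi_i * of_int m * u) * qpow \<tau> (of_int (m * (m + 1)) / 2) =
     gterm (pi_i * \<tau>) (pi_i * \<tau> + pi_i - two_pi_i * u) 0 m" for m u
    unfolding exp_pi_int[symmetric] qpow_def gterm_def exp_add[symmetric]
    by (rule arg_cong[of _ _ exp]) (simp add: field_simps power2_eq_square)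
  then have P: "(\<Prod>j\<in>{1..N}. (-1) powi (n j) * exp (neg_two_pi_i * of_int (n j) * uu j)
           * qpow \<tau> (of_int (n j * (n j + 1)) / 2) / theta (uu j) \<tau>) =
      lcoef N uu \<tau> n / (\<Prod>j\<in>{1..N}. theta (uu j) \<tau>)" for n
    unfolding lcoef_def by (simp only: prod_dividef)
  have "muN N u0 uu \<tau> = (\<Sum>\<^sub>\<infinity>n\<in>ZN N. (psi \<tau> (\<Sum>j\<in>{1..N}. n j) u0 * lcoef N uu \<tau> n) * inverse (\<Prod>j\<in>{1..N}. theta (uu j) \<tau>))"
    unfolding muN_def P psi_def by (intro infsum_cong) (simp only: divide_inverse mult_ac)
  also have "\<dots> = (\<Sum>\<^sub>\<infinity>l. psi \<tau> l u0 * acoef N uu \<tau> l) * inverse (\<Prod>j\<in>{1..N}. theta (uu j) \<tau>)"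
    unfolding infsum_cmult_left' infsum_acoef_weighted[OF assms(1), of "\<lambda>l. psi \<tau> l u0", OF K] ..
  finally show ?thesis unfolding appell_def by (simp add: divide_inverse mult_ac)
qed

section \<open>The error function and the nonholomorphic series\<close>

lemma Efun_has_derivative: "(Efun has_real_derivative 2 * exp (- pi * x\<^sup>2)) (at x)"
proof -
  let ?g = "\<lambda>z::real. exp (- pi * z\<^sup>2)"
  \<comment> \<open>With the base point moved to -M, to the left of both 0 and x, the two branches
    of the definition share one formula near x.\<close>
  define M where "M = \<bar>x\<bar> + 1"
  have int: "?g integrable_on {a..b}" for a b by (intro integrable_continuous_real continuous_intros)
  have eq: "Efun y = 2 * integral {- M..y} ?g - 2 * integral {- M..0} ?g" if "y \<in> {- M<..<M}" for y
  proof (cases "0 \<le> y")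
    case True
    then show ?thesis using Henstock_Kurzweil_Integration.integral_combine[of "- M" 0 y ?g] int that
      unfolding Efun_def M_def by simp
  next
    case False
    then show ?thesis using Henstock_Kurzweil_Integration.integral_combine[of "- M" y 0 ?g] int that
      unfolding Efun_def by simp
  qed
  have "((\<lambda>y. integral {- M..y} ?g) has_real_derivative ?g x) (at x within {- M..M})"
    by (rule integral_has_real_derivative) (auto intro!: continuous_intros simp: M_def)
  then have "((\<lambda>y. integral {- M..y} ?g) has_real_derivative ?g x) (at x)"
    by (subst (asm) at_within_interior) (auto simp: M_def)
  then have "((\<lambda>y. 2 * integral {- M..y} ?g - 2 * integral {- M..0} ?g) has_real_derivative 2 * ?g x) (at x)"
    by (auto intro!: derivative_eq_intros)
  moreover have "eventually (\<lambda>y. y \<in> {- M<..<M}) (nhds x)"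
    by (intro eventually_nhds_in_open) (auto simp: M_def)
  ultimately show ?thesis
    by (subst DERIV_cong_ev[OF refl _ refl, of _ "\<lambda>y. 2 * integral {- M..y} ?g - 2 * integral {- M..0} ?g"])
      (auto elim!: eventually_mono simp: eq)
qed

lemma Efun_mono: "x \<le> y \<Longrightarrow> Efun x \<le> Efun y"
  by (rule DERIV_nonneg_imp_nondecreasing) (use Efun_has_derivative in \<open>force\<close>)+

lemma Efun_minus: "Efun (- x) = - Efun x"
proof -
  have "integral {- y..0} (\<lambda>z. exp (- pi * z\<^sup>2)) = integral {0..y} (\<lambda>z::real. exp (- pi * z\<^sup>2))" for y
    using Henstock_Kurzweil_Integration.integral_reflect_real[where a = 0 and b = y and f = "\<lambda>z. exp (- pi * z\<^sup>2)"] by simp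
  from this[of x] this[of "-x"] show ?thesis unfolding Efun_def by auto
qed

lemma Efun_0 [simp]: "Efun 0 = 0" by (simp add: Efun_def)

lemma Efun_tendsto: "(\<lambda>m::nat. Efun (real m)) \<longlonglongrightarrow> 1"
proof -
  have "integral {- real m..real m} (\<lambda>x. exp (- pi * x\<^sup>2 / 1)) = Efun (real m)" for m
  proof -
    have "integral {- real m..0} (\<lambda>z. exp (- pi * z\<^sup>2)) + integral {0..real m} (\<lambda>z. exp (- pi * z\<^sup>2)) =
       integral {- real m..real m} (\<lambda>z. exp (- pi * z\<^sup>2))"
      by (rule Henstock_Kurzweil_Integration.integral_combine)
        (auto intro!: integrable_continuous_real continuous_intros)
    moreover have "integral {- real m..0} (\<lambda>z. exp (- pi * z\<^sup>2)) = integral {0..real m} (\<lambda>z::real. exp (- pi * z\<^sup>2))"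
      using Henstock_Kurzweil_Integration.integral_reflect_real[where a = 0 and b = "real m" and f = "\<lambda>z. exp (- pi * z\<^sup>2)"] by simp
    ultimately show ?thesis by (simp add: Efun_def)
  qed
  then show ?thesis using gaussian_integral_tendsto[of 1] by simp
qed

lemma Efun_le_1: "Efun x \<le> 1"
proof (rule LIMSEQ_le_const[OF Efun_tendsto])
  show "\<exists>N. \<forall>n\<ge>N. Efun x \<le> Efun (real n)"
    by (intro exI[of _ "nat \<lceil>x\<rceil>"] allI impI Efun_mono) linarith
qed

text \<open>The increment E(y) - E(x) is compared with exp (- pi x^2) E(y - x). Their derivatives at
  s are ordered because s^2 \<ge> x^2 + (s - x)^2 for 0 \<le> x \<le> s. Then y tends to
  infinity.\<close>

lemma one_minus_Efun_le:
  assumes x: "x \<ge> 0" shows "\<bar>1 - Efun x\<bar> \<le> exp (- pi * x\<^sup>2)"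
proof -
  have "Efun y - Efun x \<le> exp (- pi * x\<^sup>2)" if xy: "x \<le> y" for y
  proof -
    let ?h = "\<lambda>y. exp (- pi * x\<^sup>2) * Efun (y - x) - (Efun y - Efun x)"
    have "?h x \<le> ?h y"
    proof (rule DERIV_nonneg_imp_nondecreasing[OF xy])
      fix s assume s: "x \<le> s" "s \<le> y"
      have "(?h has_real_derivative exp (- pi * x\<^sup>2) * (2 * exp (- pi * (s - x)\<^sup>2)) - 2 * exp (- pi * s\<^sup>2)) (at s)"
        by (auto intro!: derivative_eq_intros DERIV_chain2[OF Efun_has_derivative] Efun_has_derivative)
      moreover have "exp (- pi * s\<^sup>2) \<le> exp (- pi * x\<^sup>2) * exp (- pi * (s - x)\<^sup>2)"
      proof -
        have "x\<^sup>2 + (s - x)\<^sup>2 + 2 * x * (s - x) = s\<^sup>2" by (simp add: power2_eq_square algebra_simps)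
        moreover have "0 \<le> 2 * x * (s - x)" using x s by simp
        ultimately have "pi * (x\<^sup>2 + (s - x)\<^sup>2) \<le> pi * s\<^sup>2" by (intro mult_left_mono) auto
        then show ?thesis unfolding exp_add[symmetric] by (simp add: algebra_simps)
      qed
      ultimately show "\<exists>d. (?h has_real_derivative d) (at s) \<and> 0 \<le> d" by (intro exI conjI) auto
    qed
    then have "Efun y - Efun x \<le> exp (- pi * x\<^sup>2) * Efun (y - x)" by simp
    also have "\<dots> \<le> exp (- pi * x\<^sup>2) * 1"
      by (intro mult_left_mono Efun_le_1) auto
    finally show ?thesis by simp
  qed
  note le = this
  have "Efun (real n) - Efun x \<le> exp (- pi * x\<^sup>2)" if "n \<ge> nat \<lceil>x\<rceil>" for n
    using le[of "real n"] that by linarith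
  then have "1 - Efun x \<le> exp (- pi * x\<^sup>2)"
    by (intro LIMSEQ_le_const2[OF tendsto_diff[OF Efun_tendsto tendsto_const]]) blast
  then show ?thesis using Efun_le_1[of x] by simp
qed

section \<open>Convergence of the completed series\<close>

definition sg :: "int \<Rightarrow> real" where "sg n = sgn (of_int n + 1/2)"

lemma sg_cases: "sg n = (if n \<ge> 0 then 1 else - 1)"
  unfolding sg_def sgn_if by auto

text \<open>The tail estimate applies unless n + b and \<open>sg n\<close> have opposite signs. In
  that case |n + b| \<le> |b| + 1, the difference is at most 2, and the first exponential
  compensates for the Gaussian. Precisely this Gaussian is wanted: it outweighs the growth of the
  terms it will multiply.\<close>

lemma sg_minus_Efun_le:
  assumes t: "t > 0"
  shows "\<bar>sg n - Efun ((of_int n + b) * sqrt (2 * t))\<bar> \<le>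
    2 * exp (2 * pi * t * (\<bar>b\<bar> + 1)\<^sup>2) * exp (- 2 * pi * t * (of_int n + b)\<^sup>2)"
proof -
  define p where "p = of_int n + b"
  let ?x = "p * sqrt (2 * t)"
  have sq: "pi * ?x\<^sup>2 = 2 * pi * t * p\<^sup>2" using t by (simp add: power_mult_distrib)
  have good: "\<bar>sg n - Efun ?x\<bar> \<le> exp (- 2 * pi * t * p\<^sup>2)" if "sg n * p \<ge> 0"
  proof (cases "n \<ge> 0")
    case True
    then have "?x \<ge> 0" using that t by (simp add: sg_cases)
    from one_minus_Efun_le[OF this] True show ?thesis by (simp add: sg_cases sq)
  next
    case False
    then have "- ?x \<ge> 0" using that t by (simp add: sg_cases mult_nonpos_nonneg)
    from one_minus_Efun_le[OF this] False show ?thesis by (simp add: sg_cases sq Efun_minus)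
  qed
  have big: "exp (2 * pi * t * (\<bar>b\<bar> + 1)\<^sup>2) \<ge> 1" using t by simp
  show ?thesis
  proof (cases "sg n * p \<ge> 0")
    case True
    have "exp (- 2 * pi * t * p\<^sup>2) \<le> (2 * exp (2 * pi * t * (\<bar>b\<bar> + 1)\<^sup>2)) * exp (- 2 * pi * t * p\<^sup>2)"
      using big by (simp add: mult_ge1_I)
    with good[OF True] show ?thesis unfolding p_def by linarith
  next
    case False
    have "\<bar>p\<bar> \<le> \<bar>b\<bar> + 1"
    proof (cases "n \<ge> 0")
      case True
      then have "p < 0" using False by (simp add: sg_cases not_le)
      then show ?thesis using True unfolding p_def by (simp add: abs_if)
    next
      case n: False
      then have "p > 0" using False by (simp add: sg_cases not_le)
      then show ?thesis using n unfolding p_def by (simp add: abs_if)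
    qed
    then have "p\<^sup>2 \<le> (\<bar>b\<bar> + 1)\<^sup>2" by (metis abs_ge_zero power2_abs power_mono)
    then have "2 * pi * t * p\<^sup>2 \<le> 2 * pi * t * (\<bar>b\<bar> + 1)\<^sup>2" using t by (intro mult_left_mono) auto
    then have "1 \<le> exp (2 * pi * t * (\<bar>b\<bar> + 1)\<^sup>2) * exp (- 2 * pi * t * p\<^sup>2)"
      unfolding exp_add[symmetric] by simp
    moreover have "\<bar>sg n - Efun ?x\<bar> \<le> 2"
      using Efun_le_1[of ?x] Efun_le_1[of "- ?x"] by (auto simp: sg_cases Efun_minus abs_if)
    ultimately show ?thesis unfolding p_def by linarith
  qed
qed

text \<open>For Im \<sigma> > 0 these terms grow like a Gaussian with positive exponent. They become
  summable with a compensating Gaussian factor, or with the conjugate of \<sigma> in place of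
  \<sigma>.\<close>

definition Xterm :: "real \<Rightarrow> complex \<Rightarrow> complex \<Rightarrow> int \<Rightarrow> complex" where
  "Xterm \<alpha> \<sigma> w n = exp (neg_two_pi_i * (of_int n + of_real \<alpha>) * w - pi_i * (of_int n + of_real \<alpha>)\<^sup>2 * \<sigma>)"

lemma Xterm_gterm: "Xterm \<alpha> \<sigma> w = gterm (neg_pi_i * \<sigma>)
   (neg_two_pi_i * w - two_pi_i * of_real \<alpha> * \<sigma>)
   (neg_two_pi_i * of_real \<alpha> * w - pi_i * (of_real \<alpha>)\<^sup>2 * \<sigma>)"
  unfolding Xterm_def gterm_def
  by (rule ext, rule arg_cong[of _ _ exp]) (simp add: algebra_simps power2_eq_square)

text \<open>Completing the square: as the conjugate of \<sigma> is \<sigma> - 2 i Im \<sigma>, a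
  real Gaussian factor is absorbed into the modulus at the price of shifting \<open>w\<close> by a
  purely imaginary amount. This is the origin of the conjugate modulus in the nonholomorphic
  part.\<close>

lemma gauss_Xterm:
  "of_real (exp (- 2 * pi * Im \<sigma> * (of_int n + \<alpha> + s)\<^sup>2)) * Xterm \<alpha> \<sigma> w n =
   exp (- 2 * of_real pi * of_real (Im \<sigma>) * (of_real s)\<^sup>2) * Xterm \<alpha> (cnj \<sigma>) (w - 2 * \<i> * of_real (Im \<sigma>) * of_real s) n"
proof -
  have \<sigma>: "cnj \<sigma> = \<sigma> - 2 * \<i> * of_real (Im \<sigma>)" by (simp add: complex_eq_iff)
  show ?thesis
    unfolding Xterm_def exp_of_real[symmetric] exp_add[symmetric] \<sigma>
    by (rule arg_cong[of _ _ exp]) (simp add: algebra_simps power2_eq_square)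
qed

text \<open>For fixed \<open>a\<close> the series is entire in \<open>w\<close>. The component \<open>k = 0\<close> of \<open>R\<^sub>N(u;\<tau>)\<close> is a value of \<open>Qfun\<close> with
  \<open>\<alpha> = 1/2\<close>, \<open>\<sigma> = N\<tau>\<close>; the sum of all components of \<open>R\<^sub>N(u/\<tau>;-1/\<tau>)\<close> is one with \<open>\<alpha> = N/2\<close> and
  \<open>-1/\<sigma>\<close> in place of \<open>\<sigma>\<close>.\<close>

definition Qpart :: "(int \<Rightarrow> complex) \<Rightarrow> real \<Rightarrow> complex \<Rightarrow> real \<Rightarrow> complex \<Rightarrow> complex" where
  "Qpart k \<alpha> \<sigma> a w = (\<Sum>\<^sub>\<infinity>n. k n * of_real (sg n - Efun ((of_int n + (\<alpha> + a)) * sqrt (2 * Im \<sigma>))) * Xterm \<alpha> \<sigma> w n)"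

definition Qfun :: "(int \<Rightarrow> complex) \<Rightarrow> real \<Rightarrow> complex \<Rightarrow> complex \<Rightarrow> complex" where
  "Qfun k \<alpha> \<sigma> w = Qpart k \<alpha> \<sigma> (Im w / Im \<sigma>) w"

definition Thfun :: "(int \<Rightarrow> complex) \<Rightarrow> real \<Rightarrow> complex \<Rightarrow> complex \<Rightarrow> complex" where
  "Thfun k \<alpha> \<sigma> v = (\<Sum>\<^sub>\<infinity>n. k n * Xterm \<alpha> (cnj \<sigma>) v n)"

text \<open>The sign-minus-error factor divided by its Gaussian is bounded in n, so it joins the
  weight. What remains is a decaying series that \<open>w\<close> enters holomorphically.\<close>

lemma Qpart_terms:
  assumes \<sigma>: "Im \<sigma> > 0" and k: "\<And>n. norm (k n) \<le> K"
  obtains k' K' where "\<And>n. norm (k' n) \<le> K'"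
    "\<And>w n. k n * of_real (sg n - Efun ((of_int n + (\<alpha> + a)) * sqrt (2 * Im \<sigma>))) * Xterm \<alpha> \<sigma> w n =
       k' n * Xterm \<alpha> (cnj \<sigma>) (w - 2 * \<i> * of_real (Im \<sigma>) * of_real a) n"
proof -
  let ?e = "\<lambda>n::int. sg n - Efun ((of_int n + (\<alpha> + a)) * sqrt (2 * Im \<sigma>))"
  let ?G = "\<lambda>n::int. exp (- 2 * pi * Im \<sigma> * (of_int n + (\<alpha> + a))\<^sup>2)"
  let ?C = "exp (- 2 * of_real pi * of_real (Im \<sigma>) * (of_real a)\<^sup>2) :: complex"
  let ?B = "2 * exp (2 * pi * Im \<sigma> * (\<bar>\<alpha> + a\<bar> + 1)\<^sup>2)"
  define k' where "k' = (\<lambda>n. ?C * (k n * of_real (?e n / ?G n)))"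
  have "norm (k' n) \<le> norm ?C * (K * ?B)" for n
  proof -
    have "\<bar>?e n\<bar> \<le> ?B * ?G n" by (rule sg_minus_Efun_le[OF \<sigma>])
    then have "\<bar>?e n / ?G n\<bar> \<le> ?B" by (simp add: abs_divide divide_le_eq)
    then show ?thesis unfolding k'_def norm_mult norm_of_real using k[of n]
      by (intro mult_left_mono mult_mono) (auto intro: order_trans[OF norm_ge_zero])
  qed
  moreover have "k n * of_real (?e n) * Xterm \<alpha> \<sigma> w n = k' n * Xterm \<alpha> (cnj \<sigma>) (w - 2 * \<i> * of_real (Im \<sigma>) * of_real a) n" for w n
  proof -
    have "of_real (?e n) = (of_real (?e n / ?G n) * of_real (?G n) :: complex)"
      unfolding of_real_mult[symmetric] by simp
    then have "k n * of_real (?e n) * Xterm \<alpha> \<sigma> w n = k n * of_real (?e n / ?G n) * (of_real (?G n) * Xterm \<alpha> \<sigma> w n)"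
      by (simp only: mult_ac)
    also have "of_real (?G n) * Xterm \<alpha> \<sigma> w n = ?C * Xterm \<alpha> (cnj \<sigma>) (w - 2 * \<i> * of_real (Im \<sigma>) * of_real a) n"
      using gauss_Xterm[of \<sigma> n \<alpha> a w] by (simp only: add.assoc)
    finally show ?thesis unfolding k'_def by (simp only: mult_ac)
  qed
  ultimately show thesis using that by blast
qed

lemma Xterm_cnj_summable:
  assumes "Im \<sigma> > 0" "\<And>n. norm (k n) \<le> K"
  shows "(\<lambda>n. norm (k n * Xterm \<alpha> (cnj \<sigma>) v n)) summable_on UNIV"
  unfolding Xterm_gterm by (rule gterm_abs_summable[of _ k K]) (use assms in auto)

lemma holomorphic_Xterm_cnj_series:
  assumes "Im \<sigma> > 0" "\<And>n. norm (k n) \<le> K" "g holomorphic_on UNIV"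
  shows "(\<lambda>w. \<Sum>\<^sub>\<infinity>n. k n * Xterm \<alpha> (cnj \<sigma>) (g w) n) holomorphic_on UNIV"
  unfolding Xterm_gterm
  by (rule holomorphic_on_gterm_series[of _ _ _ _ k K]) (use assms in \<open>auto intro!: holomorphic_intros\<close>)

lemma holomorphic_Thfun:
  assumes "Im \<sigma> > 0" "\<And>n. norm (k n) \<le> K"
  shows "Thfun k \<alpha> \<sigma> holomorphic_on UNIV"
  unfolding Thfun_def by (rule holomorphic_Xterm_cnj_series[OF assms]) (rule holomorphic_on_ident)

lemma Qpart_summable:
  assumes "Im \<sigma> > 0" "\<And>n. norm (k n) \<le> K"
  shows "(\<lambda>n. norm (k n * of_real (sg n - Efun ((of_int n + (\<alpha> + a)) * sqrt (2 * Im \<sigma>))) * Xterm \<alpha> \<sigma> w n)) summable_on UNIV"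
proof -
  obtain k' K' where k': "\<And>n. norm (k' n) \<le> K'"
    "\<And>w n. k n * of_real (sg n - Efun ((of_int n + (\<alpha> + a)) * sqrt (2 * Im \<sigma>))) * Xterm \<alpha> \<sigma> w n =
       k' n * Xterm \<alpha> (cnj \<sigma>) (w - 2 * \<i> * of_real (Im \<sigma>) * of_real a) n"
    by (rule Qpart_terms[where k = k and K = K and \<alpha> = \<alpha> and a = a and \<sigma> = \<sigma>]) (use assms in auto)
  show ?thesis unfolding k'(2) by (rule Xterm_cnj_summable[OF assms(1) k'(1)])
qed

lemma holomorphic_Qpart:
  assumes "Im \<sigma> > 0" "\<And>n. norm (k n) \<le> K"
  shows "(\<lambda>w. Qpart k \<alpha> \<sigma> a w) holomorphic_on UNIV"
proof -
  obtain k' K' where k': "\<And>n. norm (k' n) \<le> K'"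
    "\<And>w n. k n * of_real (sg n - Efun ((of_int n + (\<alpha> + a)) * sqrt (2 * Im \<sigma>))) * Xterm \<alpha> \<sigma> w n =
       k' n * Xterm \<alpha> (cnj \<sigma>) (w - 2 * \<i> * of_real (Im \<sigma>) * of_real a) n"
    by (rule Qpart_terms[where k = k and K = K and \<alpha> = \<alpha> and a = a and \<sigma> = \<sigma>]) (use assms in auto)
  show ?thesis unfolding Qpart_def k'(2)
    by (rule holomorphic_Xterm_cnj_series[OF assms(1) k'(1)]) (intro holomorphic_intros)
qed

text \<open>The integrand of the nonholomorphic part. At v = w - 2 i t a x with t = Im \<sigma>, its
  exponential is exp (- 2 pi t (a x)^2), the constant that \<open>gauss_Xterm\<close>
  produces.\<close>

definition Gker :: "(int \<Rightarrow> complex) \<Rightarrow> real \<Rightarrow> complex \<Rightarrow> complex \<Rightarrow> complex \<Rightarrow> complex" where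
  "Gker k \<alpha> \<sigma> w v = exp (of_real pi * (w - v)\<^sup>2 / (2 * of_real (Im \<sigma>))) * Thfun k \<alpha> \<sigma> v"

lemma holomorphic_Gker:
  assumes "Im \<sigma> > 0" "\<And>n. norm (k n) \<le> K"
  shows "Gker k \<alpha> \<sigma> w holomorphic_on UNIV"
  unfolding Gker_def using assms(1) by (intro holomorphic_intros holomorphic_Thfun[OF assms]) auto

text \<open>The change of E from shift 0 to shift a is an integral of Gaussians at the shifts a x
  with x in [0, 1]. Each Gaussian turns a growing term into a term of \<open>Thfun\<close> at w - 2
  i t a x. As a t = Im w, this point runs along the segment from w to its conjugate.\<close>

lemma Qfun_eq_contour_integral:
  assumes \<sigma>: "Im \<sigma> > 0" and k: "\<And>n. norm (k n) \<le> K"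
  shows "Qfun k \<alpha> \<sigma> w = Qpart k \<alpha> \<sigma> 0 w -
    \<i> * of_real (sqrt (2 * Im \<sigma>) / Im \<sigma>) * contour_integral (linepath w (cnj w)) (Gker k \<alpha> \<sigma> w)"
proof -
  define t where "t = Im \<sigma>"
  define a where "a = Im w / t"
  define c where "c = sqrt (2 * t)"
  have t: "t > 0" using \<sigma> by (simp add: t_def)
  have c2: "c\<^sup>2 = 2 * t" using t by (simp add: c_def)
  have at: "a * t = Im w" using t by (simp add: a_def)
  let ?e = "\<lambda>n::int. Efun ((of_int n + (\<alpha> + a)) * c) - Efun ((of_int n + (\<alpha> + 0)) * c)"
  let ?v = "\<lambda>x::real. w - 2 * \<i> * of_real t * of_real (a * x)"
  let ?C = "\<lambda>x::real. of_real (2 * c * a) * exp (- 2 * of_real pi * of_real t * (of_real (a * x))\<^sup>2) :: complex"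
  define T where "T = (\<lambda>n x. ?C x * (k n * Xterm \<alpha> (cnj \<sigma>) (?v x) n))"
  have T_alt: "T n x = of_real (2 * c * a * exp (- 2 * pi * t * (of_int n + \<alpha> + a * x)\<^sup>2)) * (k n * Xterm \<alpha> \<sigma> w n)" for n x
    using gauss_Xterm[of \<sigma> n \<alpha> "a * x" w] unfolding T_def t_def[symmetric] by (simp add: mult_ac)
  have intT: "integral {0..1} (T n) = k n * of_real (?e n) * Xterm \<alpha> \<sigma> w n" for n
  proof -
    have "((\<lambda>x. 2 * c * a * exp (- 2 * pi * t * (of_int n + \<alpha> + a * x)\<^sup>2)) has_integral
       (Efun ((of_int n + \<alpha> + a * 1) * c) - Efun ((of_int n + \<alpha> + a * 0) * c))) {0..1}"
    proof (rule fundamental_theorem_of_calculus)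
      fix x :: real
      have "((\<lambda>x. Efun ((of_int n + \<alpha> + a * x) * c)) has_real_derivative
         2 * exp (- pi * ((of_int n + \<alpha> + a * x) * c)\<^sup>2) * (a * c)) (at x within {0..1})"
        by (rule DERIV_chain2[OF Efun_has_derivative]) (auto intro!: derivative_eq_intros)
      also have "2 * exp (- pi * ((of_int n + \<alpha> + a * x) * c)\<^sup>2) * (a * c) =
         2 * c * a * exp (- 2 * pi * t * (of_int n + \<alpha> + a * x)\<^sup>2)"
        by (simp add: power_mult_distrib c2 mult_ac)
      finally show "((\<lambda>x. Efun ((of_int n + \<alpha> + a * x) * c)) has_vector_derivative
         2 * c * a * exp (- 2 * pi * t * (of_int n + \<alpha> + a * x)\<^sup>2)) (at x within {0..1})"
        by (simp add: has_real_derivative_iff_has_vector_derivative)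
    qed auto
    then have "((\<lambda>x. 2 * c * a * exp (- 2 * pi * t * (of_int n + \<alpha> + a * x)\<^sup>2)) has_integral ?e n) {0..1}"
      by (simp add: add.assoc)
    then have "((\<lambda>x. of_real (2 * c * a * exp (- 2 * pi * t * (of_int n + \<alpha> + a * x)\<^sup>2)) * (k n * Xterm \<alpha> \<sigma> w n))
       has_integral of_real (?e n) * (k n * Xterm \<alpha> \<sigma> w n)) {0..1}"
      by (intro has_integral_mult_left has_integral_of_real)
    then have "integral {0..1} (T n) = of_real (?e n) * (k n * Xterm \<alpha> \<sigma> w n)"
      unfolding T_alt by (rule integral_unique)
    then show ?thesis by (simp only: mult_ac)
  qed
  have contT: "continuous_on {0..1} (T n)" for n
    unfolding T_alt by (intro continuous_intros)
  let ?V = "norm w + 2 * t * \<bar>a\<bar>"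
  let ?B = "2 * pi * ?V + 2 * pi * \<bar>\<alpha>\<bar> * norm \<sigma>"
  let ?D = "2 * pi * \<bar>\<alpha>\<bar> * ?V + pi * \<alpha>\<^sup>2 * norm \<sigma>"
  \<comment> \<open>One Gaussian majorant for all x in [0, 1], built from the bound
    \<open>?V\<close> for |v| on the segment, which justifies integrating term by term.\<close>
  let ?M = "\<lambda>n::int. (\<bar>2 * c * a\<bar> * K) * exp (- (pi * t) * of_int n ^ 2 + ?B * \<bar>of_int n\<bar> + ?D)"
  have M: "?M summable_on UNIV" by (rule summable_on_int_gauss) (use t in simp)
  have bd: "norm (T n x) \<le> ?M n" if x: "x \<in> {0..1}" for n x
  proof -
    have "\<bar>a * x\<bar> \<le> \<bar>a\<bar> * 1" unfolding abs_mult using x by (intro mult_left_mono) auto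
    then have "norm (2 * \<i> * of_real t * of_real (a * x)) \<le> 2 * t * \<bar>a\<bar>"
      using t unfolding norm_mult norm_of_real by simp
    then have V: "norm (?v x) \<le> ?V" using norm_triangle_ineq4[of w "2 * \<i> * of_real t * of_real (a * x)"] by linarith
    have "norm (Xterm \<alpha> (cnj \<sigma>) (?v x) n) \<le> exp (- (pi * t) * of_int n ^ 2 + ?B * \<bar>of_int n\<bar> + ?D)"
      unfolding Xterm_gterm
    proof (rule norm_gterm_le)
      show "Re (neg_pi_i * cnj \<sigma>) \<le> - (pi * t)" by (simp add: t_def)
      have "norm (neg_two_pi_i * ?v x - two_pi_i * of_real \<alpha> * cnj \<sigma>) \<le>
        norm (neg_two_pi_i * ?v x) + norm (two_pi_i * of_real \<alpha> * cnj \<sigma>)" by (rule norm_triangle_ineq4)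
      also have "\<dots> = 2 * pi * norm (?v x) + 2 * pi * \<bar>\<alpha>\<bar> * norm \<sigma>" by (simp add: norm_mult)
      also have "\<dots> \<le> ?B" using V by (intro add_right_mono mult_left_mono) auto
      finally show "norm (neg_two_pi_i * ?v x - two_pi_i * of_real \<alpha> * cnj \<sigma>) \<le> ?B" .
      have "Re (neg_two_pi_i * of_real \<alpha> * ?v x - pi_i * (of_real \<alpha>)\<^sup>2 * cnj \<sigma>) \<le>
        norm (neg_two_pi_i * of_real \<alpha> * ?v x - pi_i * (of_real \<alpha>)\<^sup>2 * cnj \<sigma>)" by (rule complex_Re_le_cmod)
      also have "\<dots> \<le> norm (neg_two_pi_i * of_real \<alpha> * ?v x) + norm (pi_i * (of_real \<alpha>)\<^sup>2 * cnj \<sigma>)" by (rule norm_triangle_ineq4)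
      also have "\<dots> = 2 * pi * \<bar>\<alpha>\<bar> * norm (?v x) + pi * \<alpha>\<^sup>2 * norm \<sigma>" by (simp add: norm_mult norm_power)
      also have "\<dots> \<le> ?D" using V by (intro add_right_mono mult_left_mono) auto
      finally show "Re (neg_two_pi_i * of_real \<alpha> * ?v x - pi_i * (of_real \<alpha>)\<^sup>2 * cnj \<sigma>) \<le> ?D" .
    qed
    moreover have "norm (?C x) \<le> \<bar>2 * c * a\<bar>"
    proof -
      have "norm (exp (- 2 * of_real pi * of_real t * (of_real (a * x))\<^sup>2) :: complex) = exp (- 2 * pi * t * (a * x)\<^sup>2)"
        by (simp del: of_real_mult flip: of_real_power)
      also have "\<dots> \<le> 1" using t by simp
      finally show ?thesis unfolding norm_mult norm_of_real by (intro mult_left_le) auto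
    qed
    ultimately show ?thesis unfolding T_def norm_mult[of "?C x"] norm_mult[of "k n"] mult.assoc[of "\<bar>2 * c * a\<bar>"]
      using k[of n] by (intro mult_mono) (auto intro: order_trans[OF norm_ge_zero])
  qed
  have sumT: "(\<Sum>\<^sub>\<infinity>n. T n x) = ?C x * Thfun k \<alpha> \<sigma> (?v x)" for x
    unfolding T_def Thfun_def by (rule infsum_cmult_right')
  note swap = integral_infsum[OF contT M bd]
  have Q1: "Qfun k \<alpha> \<sigma> w = Qpart k \<alpha> \<sigma> 0 w - (\<Sum>\<^sub>\<infinity>n. k n * of_real (?e n) * Xterm \<alpha> \<sigma> w n)"
  proof -
    have s: "(\<lambda>n. k n * of_real (sg n - Efun ((of_int n + (\<alpha> + b)) * c)) * Xterm \<alpha> \<sigma> w n) summable_on UNIV" for b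
      unfolding c_def t_def by (rule abs_summable_summable[OF Qpart_summable[OF \<sigma> k]])
    have "Qpart k \<alpha> \<sigma> 0 w - Qfun k \<alpha> \<sigma> w = (\<Sum>\<^sub>\<infinity>n. k n * of_real (sg n - Efun ((of_int n + (\<alpha> + 0)) * c)) * Xterm \<alpha> \<sigma> w n -
      k n * of_real (sg n - Efun ((of_int n + (\<alpha> + a)) * c)) * Xterm \<alpha> \<sigma> w n)"
      unfolding Qfun_def Qpart_def t_def[symmetric] c_def[symmetric] a_def[symmetric]
      by (rule infsum_diff_complex[OF s s])
    also have "\<dots> = (\<Sum>\<^sub>\<infinity>n. k n * of_real (?e n) * Xterm \<alpha> \<sigma> w n)"
      by (intro infsum_cong) (simp add: algebra_simps)
    finally show ?thesis by (simp add: algebra_simps)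
  qed
  have "(\<Sum>\<^sub>\<infinity>n. k n * of_real (?e n) * Xterm \<alpha> \<sigma> w n) = integral {0..1} (\<lambda>x. ?C x * Thfun k \<alpha> \<sigma> (?v x))"
    using infsumI[OF swap] unfolding intT sumT .
  also have "\<dots> = integral {0..1} (\<lambda>x. \<i> * of_real (c / t) * (Gker k \<alpha> \<sigma> w (linepath w (cnj w) x) * (cnj w - w)))"
  proof (intro integral_cong)
    fix x :: real
    have cw: "cnj w - w = - 2 * \<i> * of_real (a * t)" unfolding at by (simp add: complex_eq_iff)
    have "linepath w (cnj w) x = w + of_real x * (cnj w - w)"
      unfolding linepath_def by (simp add: algebra_simps scaleR_conv_of_real)
    then have lp: "linepath w (cnj w) x = ?v x" unfolding cw by simp
    have h1: "of_real pi * (w - ?v x)\<^sup>2 / (2 * of_real t) = - 2 * of_real pi * of_real t * (of_real (a * x))\<^sup>2"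
      using t by (simp add: power_mult_distrib field_simps power2_eq_square)
    have h2: "\<i> * of_real (c / t) * (cnj w - w) = of_real (2 * c * a)"
      unfolding cw using t by simp
    have "\<i> * of_real (c / t) * (Gker k \<alpha> \<sigma> w (linepath w (cnj w) x) * (cnj w - w)) =
      (\<i> * of_real (c / t) * (cnj w - w)) * (exp (of_real pi * (w - ?v x)\<^sup>2 / (2 * of_real t)) * Thfun k \<alpha> \<sigma> (?v x))"
      unfolding Gker_def lp t_def[symmetric] by (simp only: mult_ac)
    then show "?C x * Thfun k \<alpha> \<sigma> (?v x) = \<i> * of_real (c / t) * (Gker k \<alpha> \<sigma> w (linepath w (cnj w) x) * (cnj w - w))"
      unfolding h1 h2 by (simp only: mult_ac)
  qed
  also have "\<dots> = \<i> * of_real (c / t) * contour_integral (linepath w (cnj w)) (Gker k \<alpha> \<sigma> w)"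
    by (simp add: contour_integral_integral linepath_def)
  finally show ?thesis unfolding Q1 c_def t_def by simp
qed

lemma contour_integral_linepath_split:
  assumes "f holomorphic_on UNIV"
  shows "contour_integral (linepath a b) f = contour_integral (linepath 0 b) f - contour_integral (linepath 0 a) f"
proof -
  obtain F where F: "\<And>x. (F has_field_derivative f x) (at x within UNIV)"
    using holomorphic_convex_primitive'[of UNIV f] assms by auto
  have "contour_integral (linepath x y) f = F y - F x" for x y
    using contour_integral_primitive[of UNIV F f "linepath x y"] F by (auto intro: contour_integral_unique)
  then show ?thesis by simp
qed

lemma contour_integral_linepath_0:
  "contour_integral (linepath 0 b) f = b * integral {0..1} (\<lambda>x. f (of_real x * b))"
proof -
  have "contour_integral (linepath 0 b) f = integral {0..1} (\<lambda>x. f (of_real x * b) * b)"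
    by (simp add: contour_integral_integral linepath_def scaleR_conv_of_real)
  then show ?thesis by (simp add: mult.commute)
qed

text \<open>Both the endpoint and the kernel move with \<open>w\<close>. Parametrising by the fixed
  interval [0, 1] puts the whole dependence into the integrand, where it can be differentiated under
  the integral.\<close>

lemma holomorphic_diagonal_Gker:
  assumes \<sigma>: "Im \<sigma> > 0" and k: "\<And>n. norm (k n) \<le> K"
  shows "(\<lambda>w. contour_integral (linepath 0 w) (Gker k \<alpha> \<sigma> w)) holomorphic_on UNIV"
proof -
  let ?Th = "Thfun k \<alpha> \<sigma>"
  let ?s = "2 * of_real (Im \<sigma>) :: complex"
  have hol: "?Th holomorphic_on UNIV" by (rule holomorphic_Thfun[OF assms])
  have cont: "continuous_on UNIV ?Th" "continuous_on UNIV (deriv ?Th)"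
    using hol holomorphic_deriv holomorphic_on_imp_continuous_on open_UNIV by blast+
  have d: "(?Th has_field_derivative deriv ?Th z) (at z)" for z
    using hol holomorphic_derivI open_UNIV by blast
  let ?f = "\<lambda>w x::real. exp (of_real pi * (w - of_real x * w)\<^sup>2 / ?s) * ?Th (of_real x * w)"
  let ?fx = "\<lambda>w x::real. exp (of_real pi * (w - of_real x * w)\<^sup>2 / ?s) * (deriv ?Th (of_real x * w) * of_real x)
     + exp (of_real pi * (w - of_real x * w)\<^sup>2 / ?s) * (of_real pi * (2 * (w - of_real x * w) * (1 - of_real x)) / ?s) * ?Th (of_real x * w)"
  have s: "?s \<noteq> 0" using \<sigma> by simp
  have "(\<lambda>w. integral (cbox 0 1) (?f w)) holomorphic_on UNIV"
  proof (rule leibniz_rule_holomorphic[where fx = ?fx])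
    fix w :: complex and x :: real
    have dT: "((\<lambda>w. ?Th (of_real x * w)) has_field_derivative deriv ?Th (of_real x * w) * of_real x) (at w within UNIV)"
      by (rule DERIV_chain2[OF d]) (auto intro!: derivative_eq_intros)
    show "((\<lambda>w. ?f w x) has_field_derivative ?fx w x) (at w within UNIV)"
    proof (rule DERIV_mult'[OF _ dT])
      have "((\<lambda>w. of_real pi * (w - of_real x * w)\<^sup>2 / ?s) has_field_derivative
         of_real pi * (2 * (w - of_real x * w) * (1 - of_real x)) / ?s) (at w within UNIV)"
        using s by (auto intro!: derivative_eq_intros simp: field_simps)
      then show "((\<lambda>w. exp (of_real pi * (w - of_real x * w)\<^sup>2 / ?s)) has_field_derivative
         exp (of_real pi * (w - of_real x * w)\<^sup>2 / ?s) * (of_real pi * (2 * (w - of_real x * w) * (1 - of_real x)) / ?s)) (at w within UNIV)"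
        by (rule DERIV_chain2[OF DERIV_exp])
    qed
  next
    show "(?f w) integrable_on cbox 0 1" for w
      by (intro integrable_continuous continuous_intros continuous_on_compose2[OF cont(1)]) (use s in auto)
    show "continuous_on (UNIV \<times> cbox 0 1) (\<lambda>(w, x). ?fx w x)"
      unfolding split_beta
      by (intro continuous_intros continuous_on_compose2[OF cont(1)] continuous_on_compose2[OF cont(2)]) (use s in auto)
  qed auto
  then show ?thesis unfolding contour_integral_linepath_0 Gker_def
    by (auto intro!: holomorphic_intros)
qed

text \<open>The segment from w to its conjugate is broken at 0. The piece ending at w is entire in w
  and joins the series of shift 0; the other piece carries the dependence on the conjugate.\<close>

lemma Qfun_decomposition:
  assumes \<sigma>: "Im \<sigma> > 0" and k: "\<And>n. norm (k n) \<le> K"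
  obtains H where "H holomorphic_on UNIV"
    "\<And>w. Qfun k \<alpha> \<sigma> w = H w - \<i> * of_real (sqrt (2 * Im \<sigma>) / Im \<sigma>) * contour_integral (linepath 0 (cnj w)) (Gker k \<alpha> \<sigma> w)"
proof
  let ?c = "\<i> * of_real (sqrt (2 * Im \<sigma>) / Im \<sigma>) :: complex"
  show "(\<lambda>w. Qpart k \<alpha> \<sigma> 0 w + ?c * contour_integral (linepath 0 w) (Gker k \<alpha> \<sigma> w)) holomorphic_on UNIV"
    by (intro holomorphic_intros holomorphic_Qpart[OF assms] holomorphic_diagonal_Gker[OF assms])
  show "Qfun k \<alpha> \<sigma> w = Qpart k \<alpha> \<sigma> 0 w + ?c * contour_integral (linepath 0 w) (Gker k \<alpha> \<sigma> w) -
     ?c * contour_integral (linepath 0 (cnj w)) (Gker k \<alpha> \<sigma> w)" for w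
    unfolding Qfun_eq_contour_integral[OF assms] contour_integral_linepath_split[OF holomorphic_Gker[OF assms], of w]
    by (simp add: algebra_simps)
qed

section \<open>Inversion of the unary theta function and of Q\<close>

lemma csqrt_cnj_upper:
  assumes "Im \<sigma> > 0"
  shows "csqrt (\<i> * cnj \<sigma>) = cnj (csqrt (- \<i> * \<sigma>))"
proof (rule csqrt_unique)
  have "(cnj (csqrt (- \<i> * \<sigma>)))\<^sup>2 = cnj ((csqrt (- \<i> * \<sigma>))\<^sup>2)" by (simp only: complex_cnj_power)
  then show "(cnj (csqrt (- \<i> * \<sigma>)))\<^sup>2 = \<i> * cnj \<sigma>" by simp
  \<comment> \<open>With a strictly positive real part the conjugate of the principal root is
    principal again. The real part cannot vanish because \<open>- \<i> * \<sigma>\<close> has real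
    part \<open>Im \<sigma>\<close>.\<close>
  have "Re (csqrt (- \<i> * \<sigma>)) \<noteq> 0"
  proof
    assume r: "Re (csqrt (- \<i> * \<sigma>)) = 0"
    have "Re ((csqrt (- \<i> * \<sigma>))\<^sup>2) = (Re (csqrt (- \<i> * \<sigma>)))\<^sup>2 - (Im (csqrt (- \<i> * \<sigma>)))\<^sup>2" by (rule Re_power2)
    then have "Im \<sigma> = - (Im (csqrt (- \<i> * \<sigma>)))\<^sup>2" unfolding r power2_csqrt by simp
    then show False using assms zero_le_power2[of "Im (csqrt (- \<i> * \<sigma>))"] by linarith
  qed
  then show "0 < Re (cnj (csqrt (- \<i> * \<sigma>))) \<or> Re (cnj (csqrt (- \<i> * \<sigma>))) = 0 \<and> 0 \<le> Im (cnj (csqrt (- \<i> * \<sigma>)))"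
    using csqrt_principal[of "- \<i> * \<sigma>"] by simp
qed

text \<open>What remains of the alternating sign in R after the shift of its argument by (N + 1)/2.
  \<open>sgnN 1\<close> is the plain alternating sign.\<close>

definition sgnN :: "nat \<Rightarrow> int \<Rightarrow> complex" where "sgnN N n = (-1) powi (int N * n)"

lemma norm_sgnN: "norm (sgnN N n) \<le> 1"
  by (simp add: sgnN_def norm_power_int)

lemma sgnN_exp: "sgnN N n = exp (pi_i * (of_nat N * of_int n))"
  using exp_pi_int[of "int N * n"] by (simp add: sgnN_def)

lemma exp_half_pi_i: "exp (pi_i * of_nat N / 2) = \<i> ^ N"
proof -
  have "exp (pi_i * of_nat N / 2) = exp (of_nat N * (pi_i / 2))" by (simp add: mult_ac)
  also have "\<dots> = exp (pi_i / 2) ^ N" by (rule exp_of_nat_mult)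
  also have "exp (pi_i / 2) = \<i>" using cis_pi_half by (simp add: cis_conv_exp mult_ac)
  finally show ?thesis .
qed

text \<open>The Jacobi transformation at minus the conjugate of \<sigma>, which lies in the upper
  half-plane. It exchanges characteristics and signs: the characteristic N/2 becomes the sign
  (-1)^(N n), and the alternating sign becomes the characteristic 1/2.\<close>

lemma Thfun_inversion:
  assumes \<sigma>: "Im \<sigma> > 0"
  shows "exp (pi_i * v\<^sup>2 / cnj \<sigma>) * Thfun (sgnN 1) (real N / 2) (- 1 / \<sigma>) (v / cnj \<sigma>) =
    \<i> ^ N * csqrt (\<i> * cnj \<sigma>) * Thfun (sgnN N) (1 / 2) \<sigma> v"
proof -
  define s where "s = - cnj \<sigma>"
  have s: "Im s > 0" "s \<noteq> 0" using \<sigma> by (auto simp: s_def)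
  define z where "z = of_nat N / 2 - v - s / 2"
  define C where "C = pi_i * (v - of_nat N / 2) + pi_i * s / 4"
  have cs: "cnj \<sigma> = - s" and c2: "cnj (- 1 / \<sigma>) = 1 / s" by (simp_all add: s_def)
  have "exp (pi_i * v\<^sup>2 / cnj \<sigma>) * Thfun (sgnN 1) (real N / 2) (- 1 / \<sigma>) (v / cnj \<sigma>) =
     (\<Sum>\<^sub>\<infinity>n. exp C * gterm (neg_pi_i / s) (neg_two_pi_i * z / s) (neg_pi_i * z\<^sup>2 / s) n)"
    unfolding Thfun_def infsum_cmult_right'[symmetric] cs c2
  proof (intro infsum_cong)
    fix n :: int
    show "exp (pi_i * v\<^sup>2 / - s) * (sgnN 1 n * Xterm (real N / 2) (1 / s) (v / - s) n) =
      exp C * gterm (neg_pi_i / s) (neg_two_pi_i * z / s) (neg_pi_i * z\<^sup>2 / s) n"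
      unfolding sgnN_exp Xterm_def gterm_def exp_add[symmetric] C_def z_def
      by (rule arg_cong[of _ _ exp]) (use s(2) in \<open>simp add: field_simps power2_eq_square\<close>)
  qed
  also have "\<dots> = exp C * (csqrt (- \<i> * s) * jtheta z s)"
    unfolding infsum_cmult_right' jgauss_def[symmetric] jacobi_transformation[OF s(1)] ..
  also have "exp C * (csqrt (- \<i> * s) * jtheta z s) = csqrt (- \<i> * s) * (exp C * jtheta z s)" by simp
  \<comment> \<open>The summand - s/2 of \<open>z\<close> produces the characteristic -1/2; raising
    the index by 1 turns it into 1/2.\<close>
  also have "exp C * jtheta z s = (\<Sum>\<^sub>\<infinity>n. exp C * gterm (pi_i * s) (two_pi_i * z) 0 (n + 1))"
    unfolding jtheta_def infsum_cmult_right'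
    using infsum_shift_int[of "gterm (pi_i * s) (two_pi_i * z) 0" 1] by simp
  also have "\<dots> = (\<Sum>\<^sub>\<infinity>n. \<i> ^ N * (sgnN N n * Xterm (1 / 2) (- s) v n))"
  proof (intro infsum_cong)
    fix n :: int
    show "exp C * gterm (pi_i * s) (two_pi_i * z) 0 (n + 1) = \<i> ^ N * (sgnN N n * Xterm (1 / 2) (- s) v n)"
      unfolding sgnN_exp Xterm_def gterm_def exp_half_pi_i[symmetric] exp_add[symmetric] C_def z_def
      by (rule arg_cong[of _ _ exp]) (simp add: field_simps power2_eq_square)
  qed
  finally show ?thesis unfolding Thfun_def infsum_cmult_right' cs by (simp add: mult_ac)
qed

text \<open>The nonholomorphic parts of \<open>Q\<close> at \<open>\<sigma>\<close> and at \<open>- 1 / \<sigma>\<close> cancel because their kernels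
  are matched by the inversion of the unary theta function \<open>Thfun\<close>.\<close>

lemma Qfun_modular:
  assumes \<sigma>: "Im \<sigma> > 0"
  shows "(\<lambda>w. (- \<i>) ^ (N + 1) / csqrt (- \<i> * \<sigma>) * exp (pi_i * w\<^sup>2 / \<sigma>) *
      Qfun (sgnN 1) (real N / 2) (- 1 / \<sigma>) (w / \<sigma>) - Qfun (sgnN N) (1 / 2) \<sigma> w) holomorphic_on UNIV"
proof -
  define r where "r = csqrt (- \<i> * \<sigma>)"
  define t where "t = Im \<sigma>"
  define \<sigma>' where "\<sigma>' = - 1 / \<sigma>"
  let ?Cz = "(- \<i>) ^ (N + 1) / r"
  have t: "t > 0" and s0: "\<sigma> \<noteq> 0" using \<sigma> by (auto simp: t_def)
  have t': "Im \<sigma>' = t / (norm \<sigma>)\<^sup>2"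
    by (simp add: \<sigma>'_def t_def Im_divide cmod_power2)
  have \<sigma>': "Im \<sigma>' > 0" unfolding t' using t s0 by simp
  obtain H1 where H1: "H1 holomorphic_on UNIV"
    "\<And>w. Qfun (sgnN N) (1 / 2) \<sigma> w = H1 w - \<i> * of_real (sqrt (2 * Im \<sigma>) / Im \<sigma>) * contour_integral (linepath 0 (cnj w)) (Gker (sgnN N) (1 / 2) \<sigma> w)"
    by (rule Qfun_decomposition[where k = "sgnN N" and K = 1 and \<alpha> = "1/2", OF \<sigma> norm_sgnN]) (rule that)
  obtain H2 where H2: "H2 holomorphic_on UNIV"
    "\<And>w. Qfun (sgnN 1) (real N / 2) \<sigma>' w = H2 w - \<i> * of_real (sqrt (2 * Im \<sigma>') / Im \<sigma>') * contour_integral (linepath 0 (cnj w)) (Gker (sgnN 1) (real N / 2) \<sigma>' w)"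
    by (rule Qfun_decomposition[where k = "sgnN 1" and K = 1 and \<alpha> = "real N / 2", OF \<sigma>' norm_sgnN]) (rule that)
  have ker: "exp (pi_i * w\<^sup>2 / \<sigma>) * Gker (sgnN 1) (real N / 2) \<sigma>' (w / \<sigma>) (v / cnj \<sigma>) =
     \<i> ^ N * cnj r * Gker (sgnN N) (1 / 2) \<sigma> w v" for w v
  proof -
    define T where "T = (of_real t :: complex)"
    have T: "T \<noteq> 0" "2 * \<i> * T = \<sigma> - cnj \<sigma>" using t by (auto simp: T_def t_def complex_eq_iff)
    have cs0: "cnj \<sigma> \<noteq> 0" using s0 by simp
    have iT: "of_real (Im \<sigma>') = T / (\<sigma> * cnj \<sigma>)"
      unfolding t' T_def complex_norm_square[symmetric] by simp
    \<comment> \<open>With 2 i T equal to \<sigma> minus its conjugate, the quadratic forms in w and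
      v match: the factor depending on w and \<sigma> is traded for one depending on v and the
      conjugate of \<sigma>, as \<open>Thfun_inversion\<close> requires.\<close>
    have "pi_i * w\<^sup>2 / \<sigma> + of_real pi * (w / \<sigma> - v / cnj \<sigma>)\<^sup>2 / (2 * of_real (Im \<sigma>')) =
       of_real pi / (2 * T) * ((2 * \<i> * T) * w\<^sup>2 / \<sigma> + (w / \<sigma> - v / cnj \<sigma>)\<^sup>2 * (\<sigma> * cnj \<sigma>))"
      unfolding iT using T(1) s0 cs0 by (simp add: field_simps)
    also have "(2 * \<i> * T) * w\<^sup>2 / \<sigma> + (w / \<sigma> - v / cnj \<sigma>)\<^sup>2 * (\<sigma> * cnj \<sigma>) =
       (w - v)\<^sup>2 + (2 * \<i> * T) * v\<^sup>2 / cnj \<sigma>"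
      unfolding T(2) using s0 cs0 by (simp add: field_simps power2_eq_square)
    also have "of_real pi / (2 * T) * ((w - v)\<^sup>2 + (2 * \<i> * T) * v\<^sup>2 / cnj \<sigma>) =
       of_real pi * (w - v)\<^sup>2 / (2 * of_real (Im \<sigma>)) + pi_i * v\<^sup>2 / cnj \<sigma>"
      using T(1) cs0 unfolding t_def[symmetric] T_def[symmetric] by (simp add: field_simps)
    finally have E: "exp (pi_i * w\<^sup>2 / \<sigma>) * exp (of_real pi * (w / \<sigma> - v / cnj \<sigma>)\<^sup>2 / (2 * of_real (Im \<sigma>'))) =
       exp (of_real pi * (w - v)\<^sup>2 / (2 * of_real (Im \<sigma>))) * exp (pi_i * v\<^sup>2 / cnj \<sigma>)"
      unfolding exp_add[symmetric] by simp
    have "exp (pi_i * w\<^sup>2 / \<sigma>) * Gker (sgnN 1) (real N / 2) \<sigma>' (w / \<sigma>) (v / cnj \<sigma>) =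
       exp (of_real pi * (w - v)\<^sup>2 / (2 * of_real (Im \<sigma>))) * (exp (pi_i * v\<^sup>2 / cnj \<sigma>) *
       Thfun (sgnN 1) (real N / 2) \<sigma>' (v / cnj \<sigma>))"
      unfolding Gker_def mult.assoc[symmetric] E ..
    also have "\<dots> = \<i> ^ N * cnj r * Gker (sgnN N) (1 / 2) \<sigma> w v"
      unfolding \<sigma>'_def Thfun_inversion[OF \<sigma>] csqrt_cnj_upper[OF \<sigma>] r_def Gker_def by (simp only: mult_ac)
    finally show ?thesis .
  qed
  have P: "exp (pi_i * w\<^sup>2 / \<sigma>) * contour_integral (linepath 0 (cnj (w / \<sigma>))) (Gker (sgnN 1) (real N / 2) \<sigma>' (w / \<sigma>)) =
     \<i> ^ N * cnj r / cnj \<sigma> * contour_integral (linepath 0 (cnj w)) (Gker (sgnN N) (1 / 2) \<sigma> w)" for w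
  proof -
    have "exp (pi_i * w\<^sup>2 / \<sigma>) * contour_integral (linepath 0 (cnj (w / \<sigma>))) (Gker (sgnN 1) (real N / 2) \<sigma>' (w / \<sigma>)) =
       cnj w / cnj \<sigma> * integral {0..1} (\<lambda>x. exp (pi_i * w\<^sup>2 / \<sigma>) * Gker (sgnN 1) (real N / 2) \<sigma>' (w / \<sigma>) ((of_real x * cnj w) / cnj \<sigma>))"
      unfolding contour_integral_linepath_0 integral_mult_right by (simp add: mult_ac)
    also have "\<dots> = \<i> ^ N * cnj r / cnj \<sigma> * contour_integral (linepath 0 (cnj w)) (Gker (sgnN N) (1 / 2) \<sigma> w)"
      unfolding contour_integral_linepath_0 ker integral_mult_right by simp
    finally show ?thesis .
  qed
  \<comment> \<open>Here |\<sigma>| is r times its conjugate, and the square of \<open>cnj r\<close>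
    is i times \<open>cnj \<sigma>\<close>; this removes the factor 1 / \<open>cnj \<sigma>\<close>
    that comes from rescaling the path.\<close>
  have const: "?Cz * (\<i> * of_real (sqrt (2 * Im \<sigma>') / Im \<sigma>')) * (\<i> ^ N * cnj r / cnj \<sigma>) = \<i> * of_real (sqrt (2 * t) / t)"
  proof -
    have r2: "r\<^sup>2 = - \<i> * \<sigma>" by (simp add: r_def)
    have r0: "r \<noteq> 0" using r2 s0 by auto
    have nr: "of_real (norm \<sigma>) = r * cnj r"
    proof -
      have "(norm r)\<^sup>2 = norm \<sigma>" using arg_cong[OF r2, of norm] by (simp add: norm_power norm_mult)
      then show ?thesis using complex_norm_square[of r] by (metis of_real_power)
    qed
    have cr2: "cnj r * cnj r = \<i> * cnj \<sigma>"
      using arg_cong[OF r2, of cnj] by (simp add: power2_eq_square)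
    have "sqrt (2 * Im \<sigma>') / Im \<sigma>' = norm \<sigma> * (sqrt (2 * t) / t)"
      unfolding t' using s0 t by (simp add: real_sqrt_divide field_simps power2_eq_square)
    then have e: "of_real (sqrt (2 * Im \<sigma>') / Im \<sigma>') = r * cnj r * of_real (sqrt (2 * t) / t)"
      unfolding nr[symmetric] of_real_mult[symmetric] by simp
    have "(- \<i>) ^ N * \<i> ^ N = 1" unfolding power_mult_distrib[symmetric] by simp
    then have ii: "(- \<i>) ^ (N + 1) * \<i> ^ N = - \<i>" by simp
    have "?Cz * (\<i> * (r * cnj r * of_real (sqrt (2 * t) / t))) * (\<i> ^ N * cnj r / cnj \<sigma>) =
       ((- \<i>) ^ (N + 1) * \<i> ^ N) * (\<i> * of_real (sqrt (2 * t) / t)) * (cnj r * cnj r / cnj \<sigma>)"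
      using r0 by (simp add: field_simps)
    also have "\<dots> = \<i> * of_real (sqrt (2 * t) / t)"
      unfolding ii cr2 using s0 by simp
    finally show ?thesis unfolding e .
  qed
  have "?Cz * exp (pi_i * w\<^sup>2 / \<sigma>) * Qfun (sgnN 1) (real N / 2) \<sigma>' (w / \<sigma>) - Qfun (sgnN N) (1 / 2) \<sigma> w =
     ?Cz * exp (pi_i * w\<^sup>2 / \<sigma>) * H2 (w / \<sigma>) - H1 w" for w
  proof -
    have "?Cz * exp (pi_i * w\<^sup>2 / \<sigma>) * (\<i> * of_real (sqrt (2 * Im \<sigma>') / Im \<sigma>') *
        contour_integral (linepath 0 (cnj (w / \<sigma>))) (Gker (sgnN 1) (real N / 2) \<sigma>' (w / \<sigma>))) =
       ?Cz * (\<i> * of_real (sqrt (2 * Im \<sigma>') / Im \<sigma>')) * (exp (pi_i * w\<^sup>2 / \<sigma>) *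
        contour_integral (linepath 0 (cnj (w / \<sigma>))) (Gker (sgnN 1) (real N / 2) \<sigma>' (w / \<sigma>)))"
      by (simp only: mult_ac)
    also have "\<dots> = ?Cz * (\<i> * of_real (sqrt (2 * Im \<sigma>') / Im \<sigma>')) * (\<i> ^ N * cnj r / cnj \<sigma>) *
       contour_integral (linepath 0 (cnj w)) (Gker (sgnN N) (1 / 2) \<sigma> w)"
      unfolding P by (simp only: mult.assoc)
    also have "\<dots> = \<i> * of_real (sqrt (2 * Im \<sigma>) / Im \<sigma>) * contour_integral (linepath 0 (cnj w)) (Gker (sgnN N) (1 / 2) \<sigma> w)"
      unfolding const t_def ..
    finally show ?thesis unfolding H1(2) H2(2) right_diff_distrib by simp
  qed
  moreover have "(\<lambda>w. ?Cz * exp (pi_i * w\<^sup>2 / \<sigma>) * H2 (w / \<sigma>) - H1 w) holomorphic_on UNIV"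
    using s0 by (intro holomorphic_intros holomorphic_on_compose_entire[OF H2(1)] H1(1)) auto
  ultimately show ?thesis unfolding \<sigma>'_def r_def by simp
qed

text \<open>Adding \<sigma> to w raises the shift a by 1, so after an index shift the error
  functions agree and only the signs differ: \<open>sg n - sg (n - 1)\<close> is 2 at n = 0 and 0
  elsewhere. A single exponential survives.\<close>

lemma Qfun_quasiperiodic:
  assumes \<sigma>: "Im \<sigma> > 0"
  shows "Qfun (sgnN N) (1 / 2) \<sigma> w - (-1) ^ N * exp (neg_two_pi_i * w - pi_i * \<sigma>) * Qfun (sgnN N) (1 / 2) \<sigma> (w + \<sigma>) =
    2 * exp (neg_pi_i * w - pi_i * \<sigma> / 4)"
proof -
  let ?a = "Im w / Im \<sigma>"
  let ?E = "\<lambda>n::int. Efun ((of_int n + (1 / 2 + ?a)) * sqrt (2 * Im \<sigma>))"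
  let ?f = "\<lambda>n. sgnN N n * of_real (sg n - ?E n) * Xterm (1 / 2) \<sigma> w n"
  let ?g = "\<lambda>n. sgnN N n * of_real (sg (n - 1) - ?E n) * Xterm (1 / 2) \<sigma> w n"
  let ?c = "(-1) ^ N * exp (neg_two_pi_i * w - pi_i * \<sigma>)"
  have a': "Im (w + \<sigma>) / Im \<sigma> = ?a + 1" using \<sigma> by (simp add: add_divide_distrib)
  have sgs: "sgnN N (n + 1) = (-1) ^ N * sgnN N n" for n
    unfolding sgnN_def by (simp add: distrib_left power_int_add)
  have m1: "(-1) ^ N * (-1) ^ N = (1::complex)" by (metis left_minus_one_mult_self mult_1_right)
  let ?h = "\<lambda>n. sgnN N n * of_real (sg n - Efun ((of_int n + (1 / 2 + (?a + 1))) * sqrt (2 * Im \<sigma>))) * Xterm (1 / 2) \<sigma> (w + \<sigma>) n"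
  have hg: "?c * ?h n = ?g (n + 1)" for n
  proof -
    have E: "Efun ((of_int n + (1 / 2 + (?a + 1))) * sqrt (2 * Im \<sigma>)) = ?E (n + 1)" by (simp add: algebra_simps)
    have X: "exp (neg_two_pi_i * w - pi_i * \<sigma>) * Xterm (1 / 2) \<sigma> (w + \<sigma>) n = Xterm (1 / 2) \<sigma> w (n + 1)"
      unfolding Xterm_def exp_add[symmetric] by (rule arg_cong[of _ _ exp]) (simp add: field_simps power2_eq_square)
    have "?c * ?h n = ((-1) ^ N * sgnN N n) * of_real (sg n - ?E (n + 1)) *
       (exp (neg_two_pi_i * w - pi_i * \<sigma>) * Xterm (1 / 2) \<sigma> (w + \<sigma>) n)"
      unfolding E by (simp only: mult_ac)
    also have "\<dots> = ?g (n + 1)" unfolding X sgs[symmetric] by simp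
    finally show ?thesis .
  qed
  have sf: "?f summable_on UNIV"
    by (rule abs_summable_summable[OF Qpart_summable[OF \<sigma> norm_sgnN]])
  have "?h summable_on UNIV"
    by (rule abs_summable_summable[OF Qpart_summable[OF \<sigma> norm_sgnN]])
  then have "(\<lambda>n. ?c * ?h n) summable_on UNIV" by (rule summable_on_cmult_right)
  then have "(\<lambda>n. ?g (n + 1)) summable_on UNIV" unfolding hg .
  moreover have bij: "bij_betw (\<lambda>l::int. l + 1) UNIV UNIV"
    by (rule bij_betwI[where g = "\<lambda>n. n - 1"]) auto
  ultimately have sg': "?g summable_on UNIV" using summable_on_reindex_bij_betw[OF bij, of ?g] by blast
  have Q2: "?c * Qfun (sgnN N) (1 / 2) \<sigma> (w + \<sigma>) = (\<Sum>\<^sub>\<infinity>n. ?g n)"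
  proof -
    have "?c * Qfun (sgnN N) (1 / 2) \<sigma> (w + \<sigma>) = (\<Sum>\<^sub>\<infinity>n. ?c * ?h n)"
      unfolding Qfun_def Qpart_def a' infsum_cmult_right' ..
    also have "\<dots> = (\<Sum>\<^sub>\<infinity>n. ?g n)" unfolding hg by (rule infsum_shift_int)
    finally show ?thesis .
  qed
  have "Qfun (sgnN N) (1 / 2) \<sigma> w - ?c * Qfun (sgnN N) (1 / 2) \<sigma> (w + \<sigma>) = (\<Sum>\<^sub>\<infinity>n. ?f n - ?g n)"
    unfolding Q2 unfolding Qfun_def Qpart_def by (rule infsum_diff_complex[OF sf sg'])
  also have "\<dots> = (\<Sum>\<^sub>\<infinity>n\<in>{0::int}. ?f n - ?g n)"
    by (rule infsum_cong_neutral) (auto simp: sg_cases algebra_simps)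
  also have "\<dots> = 2 * Xterm (1 / 2) \<sigma> w 0"
    by (simp add: sg_cases sgnN_def algebra_simps)
  also have "Xterm (1 / 2) \<sigma> w 0 = exp (neg_pi_i * w - pi_i * \<sigma> / 4)"
    unfolding Xterm_def by (simp add: power2_eq_square)
  finally show ?thesis .
qed

section \<open>The vector R as values of Q\<close>

lemma infsum_int_residues:
  fixes f :: "int \<Rightarrow> complex"
  assumes N: "N \<ge> 1" and sm: "(\<lambda>l. norm (f l)) summable_on UNIV"
  shows "(\<Sum>k<N. \<Sum>\<^sub>\<infinity>m. f (int N * m + int k)) = (\<Sum>\<^sub>\<infinity>l. f l)"
proof -
  let ?g = "\<lambda>l. nat (l mod int N)"
  have "(\<Sum>\<^sub>\<infinity>l. f l) = (\<Sum>\<^sub>\<infinity>k. \<Sum>\<^sub>\<infinity>l\<in>{l\<in>UNIV. ?g l = k}. f l)"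
    using infsum_fibres(1)[OF sm, of "\<lambda>_. 1" ?g 1] by simp
  also have "\<dots> = (\<Sum>\<^sub>\<infinity>k\<in>{..<N}. \<Sum>\<^sub>\<infinity>l\<in>{l\<in>UNIV. ?g l = k}. f l)"
  proof (rule infsum_cong_neutral)
    fix k assume "k \<in> UNIV - {..<N}"
    then have "k \<ge> N" by auto
    moreover have "?g l < N" for l using N by (simp add: nat_less_iff)
    ultimately have "{l \<in> UNIV. ?g l = k} = {}" by (auto simp: not_less[symmetric])
    then show "(\<Sum>\<^sub>\<infinity>l\<in>{l\<in>UNIV. ?g l = k}. f l) = 0" by (simp only: infsum_empty)
  qed auto
  also have "\<dots> = (\<Sum>k<N. \<Sum>\<^sub>\<infinity>l\<in>{l\<in>UNIV. ?g l = k}. f l)" by simp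
  also have "\<dots> = (\<Sum>k<N. \<Sum>\<^sub>\<infinity>m. f (int N * m + int k))"
  proof (intro sum.cong refl)
    fix k assume k: "k \<in> {..<N}"
    have "bij_betw (\<lambda>m. int N * m + int k) UNIV {l\<in>UNIV. ?g l = k}"
    proof (rule bij_betwI[where g = "\<lambda>l. l div int N"])
      show "(\<lambda>m. int N * m + int k) \<in> UNIV \<rightarrow> {l \<in> UNIV. ?g l = k}" using k by auto
      show "(int N * m + int k) div int N = m" for m using k by simp
      show "int N * (l div int N) + int k = l" if "l \<in> {l\<in>UNIV. ?g l = k}" for l
        using that N by auto
    qed auto
    from infsum_reindex_bij_betw[OF this, of f]
    show "(\<Sum>\<^sub>\<infinity>l\<in>{l\<in>UNIV. ?g l = k}. f l) = (\<Sum>\<^sub>\<infinity>m. f (int N * m + int k))" by simp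
  qed
  finally show ?thesis ..
qed

lemma neg_i_power: "(- \<i>) ^ N = exp (- (pi_i * of_nat N / 2))"
proof -
  have "exp (- (pi_i * of_nat N / 2)) = inverse (\<i> ^ N)"
    unfolding exp_minus exp_half_pi_i ..
  also have "\<dots> = (inverse \<i>) ^ N" by (rule power_inverse[symmetric])
  finally show ?thesis by simp
qed

lemma minus_one_power: "(-1) ^ k = exp (pi_i * of_nat k)"
  using exp_pi_int[of "int k"] by simp

text \<open>Since N (m + 1/2) + k = l + N/2 for l = N m + k, component k is the part of one series
  of modulus \<tau>/N and characteristic N/2 belonging to a residue class of l. The signs agree
  because 0 \<le> k < N makes m and l nonnegative simultaneously.\<close>

lemma RN_eq_series:
  assumes \<tau>: "Im \<tau> > 0" and k: "k < N"
  shows "RN N u \<tau> k = (\<Sum>\<^sub>\<infinity>m. (- \<i>) ^ (N + 1) * (sgnN 1 (int N * m + int k) *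
     of_real (sg (int N * m + int k) - Efun ((of_int (int N * m + int k) + (real N / 2 + Im (u / of_nat N) / Im (\<tau> / of_nat N))) * sqrt (2 * Im (\<tau> / of_nat N)))) *
     Xterm (real N / 2) (\<tau> / of_nat N) (u / of_nat N) (int N * m + int k)))"
proof -
  have N: "real N > 0" using k by simp
  let ?w = "u + of_nat k * \<tau> + (of_nat N + 1) / 2"
  show ?thesis
    unfolding RN_def Rfun_def Let_def infsum_cmult_right'[symmetric]
  proof (intro infsum_cong)
    fix m :: int
    let ?l = "int N * m + int k"
    let ?\<nu> = "real_of_int m + 1/2"
    have sgl: "sgn ?\<nu> = sg ?l"
    proof -
      have "(?l \<ge> 0) = (m \<ge> 0)"
      proof
        assume "?l \<ge> 0"
        show "m \<ge> 0"
        proof (rule ccontr)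
          assume "\<not> m \<ge> 0"
          then have "int N * m \<le> int N * (-1)" by (intro mult_left_mono) auto
          then show False using \<open>?l \<ge> 0\<close> k by simp
        qed
      qed simp
      then have "sg ?l = sg m" by (simp add: sg_cases)
      then show ?thesis by (simp add: sg_def)
    qed
    have arg: "(?\<nu> + Im ?w / Im (of_nat N * \<tau>)) * sqrt (2 * Im (of_nat N * \<tau>)) =
       (of_int ?l + (real N / 2 + Im (u / of_nat N) / Im (\<tau> / of_nat N))) * sqrt (2 * Im (\<tau> / of_nat N))"
    proof -
      have I: "Im (u / of_nat N) = Im u / real N" "Im (\<tau> / of_nat N) = Im \<tau> / real N"
        by (simp_all add: Im_divide_of_nat)
      have "sqrt (2 * (real N * Im \<tau>)) = sqrt ((real N)\<^sup>2 * (2 * (Im \<tau> / real N)))"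
        using N by (simp add: power2_eq_square)
      also have "\<dots> = real N * sqrt (2 * (Im \<tau> / real N))"
        unfolding real_sqrt_mult[of "(real N)\<^sup>2"] by simp
      finally have s: "sqrt (2 * (real N * Im \<tau>)) = real N * sqrt (2 * (Im \<tau> / real N))" .
      have ar: "(?\<nu> + (Im u + real k * Im \<tau>) / (real N * Im \<tau>)) * real N = of_int ?l + (real N / 2 + Im u / real N / (Im \<tau> / real N))"
        using N \<tau> by (simp add: field_simps)
      have Iw: "Im ?w = Im u + real k * Im \<tau>" "Im (of_nat N * \<tau>) = real N * Im \<tau>" by simp_all
      show ?thesis unfolding I Iw s ar[symmetric] by (simp only: mult_ac)
    qed
    have ex: "(-1) ^ k * exp (neg_two_pi_i * of_nat k * u / of_nat N) * qpow \<tau> (- of_nat (k\<^sup>2) / (2 * of_nat N)) *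
        ((-1) powi m * exp (neg_two_pi_i * of_real ?\<nu> * ?w) * exp (neg_pi_i * of_real (?\<nu>\<^sup>2) * (of_nat N * \<tau>))) =
      (- \<i>) ^ (N + 1) * (sgnN 1 ?l * Xterm (real N / 2) (\<tau> / of_nat N) (u / of_nat N) ?l)"
    proof -
      have N': "of_nat N \<noteq> (0::complex)" using N by simp
      have "(-1) ^ k * exp (neg_two_pi_i * of_nat k * u / of_nat N) * qpow \<tau> (- of_nat (k\<^sup>2) / (2 * of_nat N)) *
        ((-1) powi m * exp (neg_two_pi_i * of_real ?\<nu> * ?w) * exp (neg_pi_i * of_real (?\<nu>\<^sup>2) * (of_nat N * \<tau>))) =
        (- \<i>) ^ (N + 1) * (sgnN 1 ?l * Xterm (real N / 2) (\<tau> / of_nat N) (u / of_nat N) ?l) * exp (two_pi_i * of_int (- int N * m))"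
        unfolding minus_one_power exp_pi_int[symmetric] qpow_def neg_i_power sgnN_exp Xterm_def exp_add[symmetric]
        by (rule arg_cong[of _ _ exp]) (use N' in \<open>simp add: field_simps power2_eq_square\<close>)
      then show ?thesis unfolding exp_2pi_int by simp
    qed
    let ?R = "complex_of_real (sg ?l - Efun ((of_int ?l + (real N / 2 + Im (u / of_nat N) / Im (\<tau> / of_nat N))) * sqrt (2 * Im (\<tau> / of_nat N))))"
    have "(-1) ^ k * exp (neg_two_pi_i * of_nat k * u / of_nat N) * qpow \<tau> (- of_nat (k\<^sup>2) / (2 * of_nat N)) *
      (?R * (-1) powi m * exp (neg_two_pi_i * of_real ?\<nu> * ?w) * exp (neg_pi_i * of_real (?\<nu>\<^sup>2) * (of_nat N * \<tau>))) =
      ?R * ((-1) ^ k * exp (neg_two_pi_i * of_nat k * u / of_nat N) * qpow \<tau> (- of_nat (k\<^sup>2) / (2 * of_nat N)) *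
        ((-1) powi m * exp (neg_two_pi_i * of_real ?\<nu> * ?w) * exp (neg_pi_i * of_real (?\<nu>\<^sup>2) * (of_nat N * \<tau>))))"
      by (simp only: mult_ac)
    also have "\<dots> = (- \<i>) ^ (N + 1) * (sgnN 1 ?l * ?R * Xterm (real N / 2) (\<tau> / of_nat N) (u / of_nat N) ?l)"
      unfolding ex by (simp only: mult_ac)
    finally show "(-1) ^ k * exp (neg_two_pi_i * of_nat k * u / of_nat N) * qpow \<tau> (- of_nat (k\<^sup>2) / (2 * of_nat N)) *
      (of_real (sgn ?\<nu> - Efun ((?\<nu> + Im ?w / Im (of_nat N * \<tau>)) * sqrt (2 * Im (of_nat N * \<tau>)))) * (-1) powi m *
        exp (neg_two_pi_i * of_real ?\<nu> * ?w) * exp (neg_pi_i * of_real (?\<nu>\<^sup>2) * (of_nat N * \<tau>))) =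
      (- \<i>) ^ (N + 1) * (sgnN 1 ?l * ?R * Xterm (real N / 2) (\<tau> / of_nat N) (u / of_nat N) ?l)"
      unfolding sgl arg .
  qed
qed

lemma sum_RN_eq_Qfun:
  assumes \<tau>: "Im \<tau> > 0" and N: "N \<ge> 1"
  shows "(\<Sum>k<N. RN N u \<tau> k) = (- \<i>) ^ (N + 1) * Qfun (sgnN 1) (real N / 2) (\<tau> / of_nat N) (u / of_nat N)"
proof -
  let ?f = "\<lambda>l. sgnN 1 l * of_real (sg l - Efun ((of_int l + (real N / 2 + Im (u / of_nat N) / Im (\<tau> / of_nat N))) * sqrt (2 * Im (\<tau> / of_nat N)))) *
     Xterm (real N / 2) (\<tau> / of_nat N) (u / of_nat N) l"
  have t: "Im (\<tau> / of_nat N) > 0" using \<tau> N by (simp add: Im_divide_of_nat)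
  have "(\<Sum>k<N. RN N u \<tau> k) = (\<Sum>k<N. \<Sum>\<^sub>\<infinity>m. (- \<i>) ^ (N + 1) * ?f (int N * m + int k))"
    by (intro sum.cong refl RN_eq_series[OF \<tau>]) auto
  also have "\<dots> = (\<Sum>\<^sub>\<infinity>l. (- \<i>) ^ (N + 1) * ?f l)"
  proof (rule infsum_int_residues[OF N])
    have "(\<lambda>l. norm ((- \<i>) ^ (N + 1)) * norm (?f l)) summable_on UNIV"
      by (intro summable_on_cmult_right Qpart_summable[OF t norm_sgnN])
    then show "(\<lambda>l. norm ((- \<i>) ^ (N + 1) * ?f l)) summable_on UNIV" by (simp only: norm_mult)
  qed
  finally show ?thesis unfolding Qfun_def Qpart_def infsum_cmult_right' .
qed

text \<open>The shift of the argument by (N + 1)/2 contributes (- i)^(N + 1) and turns (-1)^m into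
  (-1)^(N m).\<close>

lemma RN_0_eq_Qfun:
  assumes \<tau>: "Im \<tau> > 0" and N: "N \<ge> 1"
  shows "RN N u \<tau> 0 = (- \<i>) ^ (N + 1) * Qfun (sgnN N) (1 / 2) (of_nat N * \<tau>) u"
proof -
  let ?w = "u + (of_nat N + 1) / 2"
  have "RN N u \<tau> 0 = Rfun ?w (of_nat N * \<tau>)" by (simp add: RN_def qpow_def)
  also have "\<dots> = (- \<i>) ^ (N + 1) * Qfun (sgnN N) (1 / 2) (of_nat N * \<tau>) u"
    unfolding Rfun_def Qfun_def Qpart_def Let_def infsum_cmult_right'[symmetric]
  proof (intro infsum_cong)
    fix m :: int
    let ?\<nu> = "real_of_int m + 1/2"
    have ex: "(-1) powi m * exp (neg_two_pi_i * of_real ?\<nu> * ?w) * exp (neg_pi_i * of_real (?\<nu>\<^sup>2) * (of_nat N * \<tau>)) =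
      (- \<i>) ^ (N + 1) * (sgnN N m * Xterm (1 / 2) (of_nat N * \<tau>) u m)"
    proof -
      have "(-1) powi m * exp (neg_two_pi_i * of_real ?\<nu> * ?w) * exp (neg_pi_i * of_real (?\<nu>\<^sup>2) * (of_nat N * \<tau>)) =
        (- \<i>) ^ (N + 1) * (sgnN N m * Xterm (1 / 2) (of_nat N * \<tau>) u m) * exp (two_pi_i * of_int (- int N * m))"
        unfolding exp_pi_int[symmetric] neg_i_power sgnN_exp Xterm_def exp_add[symmetric]
        by (rule arg_cong[of _ _ exp]) (simp add: field_simps power2_eq_square)
      then show ?thesis unfolding exp_2pi_int by simp
    qed
    let ?R = "complex_of_real (sg m - Efun ((of_int m + (1 / 2 + Im u / Im (of_nat N * \<tau>))) * sqrt (2 * Im (of_nat N * \<tau>))))"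
    have R: "complex_of_real (sgn ?\<nu> - Efun ((?\<nu> + Im ?w / Im (of_nat N * \<tau>)) * sqrt (2 * Im (of_nat N * \<tau>)))) = ?R"
      by (simp add: sg_def add.assoc)
    have "?R * (-1) powi m * exp (neg_two_pi_i * of_real ?\<nu> * ?w) * exp (neg_pi_i * of_real (?\<nu>\<^sup>2) * (of_nat N * \<tau>)) =
      ?R * ((-1) powi m * exp (neg_two_pi_i * of_real ?\<nu> * ?w) * exp (neg_pi_i * of_real (?\<nu>\<^sup>2) * (of_nat N * \<tau>)))"
      by (simp only: mult_ac)
    also have "\<dots> = (- \<i>) ^ (N + 1) * (sgnN N m * ?R * Xterm (1 / 2) (of_nat N * \<tau>) u m)"
      unfolding ex by (simp only: mult_ac)
    finally show "of_real (sgn ?\<nu> - Efun ((?\<nu> + Im ?w / Im (of_nat N * \<tau>)) * sqrt (2 * Im (of_nat N * \<tau>)))) * (-1) powi m *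
        exp (neg_two_pi_i * of_real ?\<nu> * ?w) * exp (neg_pi_i * of_real (?\<nu>\<^sup>2) * (of_nat N * \<tau>)) =
      (- \<i>) ^ (N + 1) * (sgnN N m * ?R * Xterm (1 / 2) (of_nat N * \<tau>) u m)"
      unfolding R .
  qed
  finally show ?thesis .
qed

section \<open>The inversion formula for residues\<close>

lemma sum_periodic_shift:
  fixes h :: "int \<Rightarrow> complex"
  assumes per: "\<And>k. h (k + int N) = h k"
  shows "(\<Sum>r<N. h (int r + c)) = (\<Sum>r<N. h (int r))"
proof -
  have step: "(\<Sum>r<N. h (int r + (c + 1))) = (\<Sum>r<N. h (int r + c))" for c
  proof -
    have "(\<Sum>r<N. h (int r + c)) + h (int N + c) = (\<Sum>r<Suc N. h (int r + c))" by simp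
    also have "\<dots> = h c + (\<Sum>r<N. h (int (Suc r) + c))"
      by (subst sum.lessThan_Suc_shift) simp
    finally show ?thesis using per[of c] by (simp add: algebra_simps)
  qed
  show ?thesis
  proof (induction c rule: int_induct[where k = 0])
    case (step1 i) then show ?case using step[of i] by simp
  next
    case (step2 i) then show ?case using step[of "i - 1"] by simp
  qed simp
qed

lemma roots_of_unity_sum:
  assumes N: "N \<ge> 1"
  shows "(\<Sum>r<N. exp (two_pi_i * of_int d * of_nat r / of_nat N)) = (if int N dvd d then of_nat N else 0 :: complex)"
proof -
  define w where "w = exp (two_pi_i * (of_int d / of_nat N))"
  have pw: "exp (two_pi_i * of_int d * of_nat r / of_nat N) = w ^ r" for r
    unfolding w_def exp_of_nat_mult[symmetric] by (rule arg_cong[of _ _ exp]) simp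
  have wN: "w ^ N = 1"
    using pw[of N] N by (simp del: exp_2pi_int) (metis exp_2pi_int)
  have w1: "w = 1 \<longleftrightarrow> int N dvd d"
  proof -
    have "w = 1 \<longleftrightarrow> of_int d / of_nat N \<in> (\<int> :: complex set)" unfolding w_def by (rule exp_2pi_eq_1_iff)
    also have "\<dots> \<longleftrightarrow> int N dvd d"
    proof
      assume "of_int d / of_nat N \<in> (\<int> :: complex set)"
      then obtain k where "of_int d / of_nat N = (of_int k :: complex)" by (auto elim: Ints_cases)
      then have "of_int d = (of_int (int N * k) :: complex)" using N by (simp add: field_simps)
      then show "int N dvd d" using of_int_eq_iff dvd_triv_left by metis
    next
      assume "int N dvd d"
      then obtain k where "d = int N * k" by blast
      then have "of_int d / of_nat N = (of_int k :: complex)" using N by simp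
      then show "of_int d / of_nat N \<in> (\<int> :: complex set)" by simp
    qed
    finally show ?thesis .
  qed
  show ?thesis
  proof (cases "w = 1")
    case True then show ?thesis using w1 unfolding pw by simp
  next
    case False
    have "(\<Sum>r<N. w ^ r) = (w ^ N - 1) / (w - 1)" using False by (rule geometric_sum)
    then show ?thesis using False w1 wN unfolding pw by simp
  qed
qed

text \<open>The recursion of \<open>acoef_rec\<close> determines the coefficients from their values modulo \<open>N\<close>; dividing out
  the Gaussian factor leaves an \<open>N\<close>-periodic sequence.\<close>

definition bcoef :: "(int \<Rightarrow> complex) \<Rightarrow> nat \<Rightarrow> complex \<Rightarrow> complex \<Rightarrow> int \<Rightarrow> complex" where
  "bcoef A N \<tau> U k = exp (pi_i * (of_int k + \<tau> * of_int k - \<tau> * of_int k ^ 2 / of_nat N - 2 * of_int k * U / of_nat N)) * A (- k)"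

lemma bcoef_inverse:
  "A l = exp (pi_i * (of_int l + \<tau> * of_int l + \<tau> * of_int l ^ 2 / of_nat N - 2 * of_int l * U / of_nat N)) * bcoef A N \<tau> U (- l)"
proof -
  have "exp (pi_i * (of_int l + \<tau> * of_int l + \<tau> * of_int l ^ 2 / of_nat N - 2 * of_int l * U / of_nat N)) *
     exp (pi_i * (of_int (- l) + \<tau> * of_int (- l) - \<tau> * of_int (- l) ^ 2 / of_nat N - 2 * of_int (- l) * U / of_nat N)) = exp 0"
    unfolding exp_add[symmetric] by (rule arg_cong[of _ _ exp]) (simp add: algebra_simps)
  then show ?thesis unfolding bcoef_def by (simp add: mult.assoc[symmetric])
qed

lemma bcoef_periodic:
  assumes N: "N \<ge> 1"
    and rec: "\<And>l. A (l + int N) = (-1) ^ N * exp (neg_two_pi_i * U) * qpow \<tau> (of_int l + of_nat N) * A l"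
  shows "bcoef A N \<tau> U (k + int N) = bcoef A N \<tau> U k"
proof -
  have N': "of_nat N \<noteq> (0::complex)" using N by simp
  have "A (- k) = (-1) ^ N * exp (neg_two_pi_i * U) * qpow \<tau> (of_int (- (k + int N)) + of_nat N) * A (- (k + int N))"
    using rec[of "- (k + int N)"] by simp
  moreover have "exp (pi_i * (of_int k + \<tau> * of_int k - \<tau> * of_int k ^ 2 / of_nat N - 2 * of_int k * U / of_nat N)) *
     ((-1) ^ N * exp (neg_two_pi_i * U) * qpow \<tau> (of_int (- (k + int N)) + of_nat N)) =
     exp (pi_i * (of_int (k + int N) + \<tau> * of_int (k + int N) - \<tau> * of_int (k + int N) ^ 2 / of_nat N - 2 * of_int (k + int N) * U / of_nat N))"
    unfolding minus_one_power qpow_def exp_add[symmetric]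
    by (rule arg_cong[of _ _ exp]) (use N' in \<open>simp add: field_simps power2_eq_square\<close>)
  ultimately show ?thesis unfolding bcoef_def by (simp only: mult.assoc[symmetric])
qed

lemma jtheta_not_identically_0:
  assumes "Im \<sigma> > 0" obtains z where "jtheta z \<sigma> \<noteq> 0"
proof -
  have "\<exists>z. jtheta z \<sigma> \<noteq> 0"
  proof (rule ccontr)
    assume "\<not> (\<exists>z. jtheta z \<sigma> \<noteq> 0)"
    then have "(\<lambda>z. jtheta z \<sigma>) = (\<lambda>_. 0)" by auto
    then show False using fourier_coeff_jtheta_0[OF assms] by (simp add: fourier_coeff_const)
  qed
  then show thesis using that by blast
qed

lemma infsum_finite_sum:
  fixes f :: "'b \<Rightarrow> 'a \<Rightarrow> complex"
  assumes "finite R" "\<And>r. r \<in> R \<Longrightarrow> f r summable_on A"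
  shows "(\<lambda>x. \<Sum>r\<in>R. f r x) summable_on A \<and> (\<Sum>\<^sub>\<infinity>x\<in>A. \<Sum>r\<in>R. f r x) = (\<Sum>r\<in>R. infsum (f r) A)"
  using assms
proof (induction R rule: finite_induct)
  case (insert r R)
  then show ?case using infsum_add[of "f r" A "\<lambda>x. \<Sum>r\<in>R. f r x"] summable_on_add[of "f r" A "\<lambda>x. \<Sum>r\<in>R. f r x"] by simp
qed simp

text \<open>Averaging against the character of \<open>p\<close> keeps the indices l congruent to -p
  modulo N. On this class the coefficients are one constant \<open>bcoef\<close> times a Gaussian in
  l, so the series is a single theta function of modulus N \<tau>. \<open>Y\<close> collects the
  linear terms of the exponent.\<close>

lemma acoef_average:
  assumes \<tau>: "Im \<tau> > 0" and N: "N \<ge> 1"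
    and sm: "\<And>x. (\<lambda>l. norm (A l * exp (neg_two_pi_i * of_int l * x))) summable_on UNIV"
    and rec: "\<And>l. A (l + int N) = (-1) ^ N * exp (neg_two_pi_i * U) * qpow \<tau> (of_int l + of_nat N) * A l"
    and Y: "Y = of_nat N * x + U + of_nat N * (1 - \<tau>) / 2"
  shows "(\<Sum>r<N. exp (neg_two_pi_i * of_int p * of_nat r / of_nat N) *
       (\<Sum>\<^sub>\<infinity>l. A l * exp (neg_two_pi_i * of_int l * (x + of_nat r / of_nat N)))) =
     of_nat N * bcoef A N \<tau> U p * (exp (two_pi_i * of_int p * Y / of_nat N + pi_i * of_int p ^ 2 * \<tau> / of_nat N) *
       jtheta (Y + of_int p * \<tau>) (of_nat N * \<tau>))"
proof -
  have N': "of_nat N \<noteq> (0::complex)" using N by simp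
  let ?e = "\<lambda>l. A l * exp (neg_two_pi_i * of_int l * x)"
  let ?t = "\<lambda>r l. exp (neg_two_pi_i * of_int p * of_nat r / of_nat N) *
       (A l * exp (neg_two_pi_i * of_int l * (x + of_nat r / of_nat N)))"
  have "(\<Sum>r<N. exp (neg_two_pi_i * of_int p * of_nat r / of_nat N) *
       (\<Sum>\<^sub>\<infinity>l. A l * exp (neg_two_pi_i * of_int l * (x + of_nat r / of_nat N)))) = (\<Sum>r<N. \<Sum>\<^sub>\<infinity>l. ?t r l)"
    by (simp only: infsum_cmult_right')
  also have "\<dots> = (\<Sum>\<^sub>\<infinity>l. \<Sum>r<N. ?t r l)"
  proof (rule conjunct2[OF infsum_finite_sum, symmetric])
    show "?t r summable_on UNIV" for r
      by (rule summable_on_cmult_right[OF abs_summable_summable[OF sm]])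
  qed simp
  also have "\<dots> = (\<Sum>\<^sub>\<infinity>l. ?e l * (\<Sum>r<N. exp (two_pi_i * of_int (- (l + p)) * of_nat r / of_nat N)))"
  proof (intro infsum_cong)
    fix l :: int
    have "?t r l = ?e l * exp (two_pi_i * of_int (- (l + p)) * of_nat r / of_nat N)" for r
    proof -
      have "exp (neg_two_pi_i * of_int p * of_nat r / of_nat N) * exp (neg_two_pi_i * of_int l * (x + of_nat r / of_nat N)) =
         exp (neg_two_pi_i * of_int l * x) * exp (two_pi_i * of_int (- (l + p)) * of_nat r / of_nat N)"
        unfolding exp_add[symmetric] by (rule arg_cong[of _ _ exp]) (use N' in \<open>simp add: field_simps\<close>)
      then show ?thesis by (simp only: mult_ac)
    qed
    then show "(\<Sum>r<N. ?t r l) = ?e l * (\<Sum>r<N. exp (two_pi_i * of_int (- (l + p)) * of_nat r / of_nat N))"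
      by (simp only: sum_distrib_left)
  qed
  also have "\<dots> = (\<Sum>\<^sub>\<infinity>l. if int N dvd - (l + p) then of_nat N * ?e l else 0)"
    unfolding roots_of_unity_sum[OF N] by (intro infsum_cong) simp
  also have "\<dots> = (\<Sum>\<^sub>\<infinity>l\<in>{l. int N dvd - (l + p)}. of_nat N * ?e l)"
    by (rule infsum_cong_neutral) auto
  also have "\<dots> = (\<Sum>\<^sub>\<infinity>m. of_nat N * ?e (- (int N * m + p)))"
  proof -
    have "bij_betw (\<lambda>m. - (int N * m + p)) UNIV {l. int N dvd - (l + p)}"
    proof (rule bij_betwI[where g = "\<lambda>l. - (l + p) div int N"])
      show "- (- (int N * m + p) + p) div int N = m" for m using N by simp
      show "- (int N * (- (l + p) div int N) + p) = l" if "l \<in> {l. int N dvd - (l + p)}" for l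
      proof -
        have "int N * (- (l + p) div int N) = - (l + p)" using that by (intro dvd_mult_div_cancel) simp
        then show ?thesis by simp
      qed
    qed auto
    from infsum_reindex_bij_betw[OF this, of "\<lambda>l. of_nat N * ?e l"] show ?thesis by simp
  qed
  also have "\<dots> = (\<Sum>\<^sub>\<infinity>m. of_nat N * bcoef A N \<tau> U p * exp (two_pi_i * of_int p * Y / of_nat N + pi_i * of_int p ^ 2 * \<tau> / of_nat N) *
       gterm (pi_i * (of_nat N * \<tau>)) (two_pi_i * (Y + of_int p * \<tau>)) 0 m)"
  proof (intro infsum_cong)
    fix m :: int
    let ?l = "- (int N * m + p)"
    have per: "bcoef A N \<tau> U (k + int N * int j) = bcoef A N \<tau> U k" for k j
    proof (induction j)
      case (Suc j)
      then show ?case using bcoef_periodic[OF N rec, of "k + int N * int j"] by (simp add: algebra_simps)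
    qed simp
    have "bcoef A N \<tau> U (int N * m + p) = bcoef A N \<tau> U p"
    proof (cases "m \<ge> 0")
      case True
      then show ?thesis using per[of p "nat m"] by (simp add: add.commute)
    next
      case False
      then show ?thesis using per[of "int N * m + p" "nat (- m)"] by simp
    qed
    note hB = this
    have Al: "A ?l = exp (pi_i * (of_int ?l + \<tau> * of_int ?l + \<tau> * of_int ?l ^ 2 / of_nat N - 2 * of_int ?l * U / of_nat N)) * bcoef A N \<tau> U p"
      using bcoef_inverse[of A ?l \<tau> N U] hB by (simp only: minus_minus)
    have "exp (pi_i * (of_int ?l + \<tau> * of_int ?l + \<tau> * of_int ?l ^ 2 / of_nat N - 2 * of_int ?l * U / of_nat N)) *
      exp (neg_two_pi_i * of_int ?l * x) =
      exp (two_pi_i * of_int p * Y / of_nat N + pi_i * of_int p ^ 2 * \<tau> / of_nat N) *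
      gterm (pi_i * (of_nat N * \<tau>)) (two_pi_i * (Y + of_int p * \<tau>)) 0 m *
      exp (two_pi_i * of_int (- (int N * m + p)))"
      unfolding gterm_def exp_add[symmetric] Y
      by (rule arg_cong[of _ _ exp]) (use N' in \<open>simp add: field_simps power2_eq_square\<close>)
    then have E: "exp (pi_i * (of_int ?l + \<tau> * of_int ?l + \<tau> * of_int ?l ^ 2 / of_nat N - 2 * of_int ?l * U / of_nat N)) *
      exp (neg_two_pi_i * of_int ?l * x) =
      exp (two_pi_i * of_int p * Y / of_nat N + pi_i * of_int p ^ 2 * \<tau> / of_nat N) *
      gterm (pi_i * (of_nat N * \<tau>)) (two_pi_i * (Y + of_int p * \<tau>)) 0 m"
      unfolding exp_2pi_int mult_1_right .
    have "of_nat N * ?e ?l = of_nat N * bcoef A N \<tau> U p * (exp (pi_i * (of_int ?l + \<tau> * of_int ?l + \<tau> * of_int ?l ^ 2 / of_nat N - 2 * of_int ?l * U / of_nat N)) *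
      exp (neg_two_pi_i * of_int ?l * x))" unfolding Al by (simp only: mult_ac)
    then show "of_nat N * ?e ?l = of_nat N * bcoef A N \<tau> U p * exp (two_pi_i * of_int p * Y / of_nat N + pi_i * of_int p ^ 2 * \<tau> / of_nat N) *
       gterm (pi_i * (of_nat N * \<tau>)) (two_pi_i * (Y + of_int p * \<tau>)) 0 m"
      unfolding E by (simp only: mult_ac)
  qed
  also have "\<dots> = of_nat N * bcoef A N \<tau> U p * (exp (two_pi_i * of_int p * Y / of_nat N + pi_i * of_int p ^ 2 * \<tau> / of_nat N) *
       jtheta (Y + of_int p * \<tau>) (of_nat N * \<tau>))"
    unfolding infsum_cmult_right' jtheta_def by (simp only: mult.assoc)
  finally show ?thesis .
qed

lemma Im_minus_inverse_pos: "Im \<tau> > 0 \<Longrightarrow> Im (- 1 / \<tau>) > 0"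
  by (simp add: Im_divide cmod_power2 sum_power2_gt_zero_iff complex_eq_iff)

text \<open>The quadratic exponent of the coefficient and the linear terms in x complete to the
  square of l plus an affine function of x, as a comparison with \<open>jgauss\<close> demands. The
  prefactor is the quotient of automorphy factors arising in
  \<open>theta_product_inversion\<close>.\<close>

lemma bcoef_gauss:
  fixes N :: nat and \<tau> x U :: complex
  assumes t0: "\<tau> \<noteq> 0" and N: "N \<ge> 1"
  shows "exp (pi_i * ((U + of_nat N * x) * (1 - 1 / \<tau>) - of_nat N * \<tau> / 4 - of_nat N / (4 * \<tau>) - (2 * x * U + of_nat N * x\<^sup>2) / \<tau>)) *
       (A l * exp (neg_two_pi_i * of_int l * (x / \<tau>))) =
     ((- \<i>) ^ N * exp (pi_i * U\<^sup>2 / (of_nat N * \<tau>))) * (bcoef A N (- 1 / \<tau>) (U / \<tau>) (- l) *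
      exp (neg_pi_i * (of_nat N * x + U + of_nat N * (1 - \<tau>) / 2 + of_int l)\<^sup>2 / (of_nat N * \<tau>)))" (is "exp ?E * _ = _")
proof -
  have N': "of_nat N \<noteq> (0::complex)" using N by simp
  have "exp ?E * (exp (pi_i * (of_int l + (- 1 / \<tau>) * of_int l + (- 1 / \<tau>) * of_int l ^ 2 / of_nat N - 2 * of_int l * (U / \<tau>) / of_nat N)) *
      exp (neg_two_pi_i * of_int l * (x / \<tau>))) =
     ((- \<i>) ^ N * exp (pi_i * U\<^sup>2 / (of_nat N * \<tau>))) *
     exp (neg_pi_i * (of_nat N * x + U + of_nat N * (1 - \<tau>) / 2 + of_int l)\<^sup>2 / (of_nat N * \<tau>))"
    unfolding neg_i_power exp_add[symmetric]
    by (rule arg_cong[of _ _ exp]) (use N' t0 in \<open>simp add: field_simps power2_eq_square\<close>)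
  then have "(exp ?E * (exp (pi_i * (of_int l + (- 1 / \<tau>) * of_int l + (- 1 / \<tau>) * of_int l ^ 2 / of_nat N - 2 * of_int l * (U / \<tau>) / of_nat N)) *
      exp (neg_two_pi_i * of_int l * (x / \<tau>)))) * bcoef A N (- 1 / \<tau>) (U / \<tau>) (- l) =
     (((- \<i>) ^ N * exp (pi_i * U\<^sup>2 / (of_nat N * \<tau>))) *
     exp (neg_pi_i * (of_nat N * x + U + of_nat N * (1 - \<tau>) / 2 + of_int l)\<^sup>2 / (of_nat N * \<tau>))) * bcoef A N (- 1 / \<tau>) (U / \<tau>) (- l)"
    by (rule arg_cong)
  then show ?thesis
    using bcoef_inverse[of A l "- 1 / \<tau>" N "U / \<tau>"] by (simp only: mult_ac)
qed

text \<open>Theta is inverted both at \<open>uu j + x\<close> and at \<open>uu j\<close>. In the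
  cross-multiplied form the square roots occur to the same power on the two sides, so no branch has
  to be tracked.\<close>

lemma theta_product_inversion:
  fixes uu :: "nat \<Rightarrow> complex" and N :: nat and x :: complex
  defines "U \<equiv> (\<Sum>j\<in>{1..N}. uu j)"
  assumes \<tau>: "Im \<tau> > 0" and N: "N \<ge> 1"
  shows "(\<Sum>\<^sub>\<infinity>l. acoef N uu \<tau> l * exp (neg_two_pi_i * of_int l * x)) * (\<Prod>j\<in>{1..N}. theta (uu j / \<tau>) (- 1 / \<tau>)) =
    (- \<i>) ^ N * exp (pi_i * U\<^sup>2 / (of_nat N * \<tau>)) * (\<Prod>j\<in>{1..N}. theta (uu j) \<tau>) *
    (\<Sum>\<^sub>\<infinity>l. bcoef (acoef N (\<lambda>j. uu j / \<tau>) (- 1 / \<tau>)) N (- 1 / \<tau>) (U / \<tau>) (- l) *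
      exp (neg_pi_i * (of_nat N * x + U + of_nat N * (1 - \<tau>) / 2 + of_int l)\<^sup>2 / (of_nat N * \<tau>)))"
proof -
  have N': "of_nat N \<noteq> (0::complex)" and t0: "\<tau> \<noteq> 0" using N \<tau> by auto
  have \<tau>': "Im (- 1 / \<tau>) > 0" by (rule Im_minus_inverse_pos[OF \<tau>])
  let ?r = "csqrt (- \<i> * \<tau>)"
  let ?A' = "acoef N (\<lambda>j. uu j / \<tau>) (- 1 / \<tau>)"
  let ?e = "\<lambda>j. pi_i * ((uu j + x) * (1 - 1 / \<tau>) - \<tau> / 4 - 1 / (4 * \<tau>) - (2 * x * uu j + x\<^sup>2) / \<tau>)"
  let ?E = "pi_i * ((U + of_nat N * x) * (1 - 1 / \<tau>) - of_nat N * \<tau> / 4 - of_nat N / (4 * \<tau>) - (2 * x * U + of_nat N * x\<^sup>2) / \<tau>)"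
  have sumE: "(\<Sum>j\<in>{1..N}. ?e j) = ?E"
  proof -
    have "(\<Sum>j\<in>{1..N}. ?e j) = pi_i * (\<Sum>j\<in>{1..N}. uu j * (1 - 1 / \<tau> - 2 * x / \<tau>) + (x * (1 - 1 / \<tau>) - \<tau> / 4 - 1 / (4 * \<tau>) - x\<^sup>2 / \<tau>))"
      unfolding sum_distrib_left by (intro sum.cong refl) (use t0 in \<open>simp add: field_simps\<close>)
    also have "\<dots> = pi_i * (U * (1 - 1 / \<tau> - 2 * x / \<tau>) + of_nat N * (x * (1 - 1 / \<tau>) - \<tau> / 4 - 1 / (4 * \<tau>) - x\<^sup>2 / \<tau>))"
      unfolding sum.distrib sum_distrib_right[symmetric] U_def by simp
    also have "\<dots> = ?E" using t0 by (simp add: field_simps)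
    finally show ?thesis .
  qed
  have th: "theta (uu j / \<tau> + x / \<tau>) (- 1 / \<tau>) = - \<i> * ?r * exp (pi_i * (uu j + x)\<^sup>2 / \<tau>) * theta (uu j + x) \<tau>" for j
    using theta_inversion[OF \<tau>, of "uu j + x"] by (simp add: add_divide_distrib)
  have "(\<Sum>\<^sub>\<infinity>l. acoef N uu \<tau> l * exp (neg_two_pi_i * of_int l * x)) * (\<Prod>j\<in>{1..N}. theta (uu j / \<tau>) (- 1 / \<tau>)) =
    (\<Prod>j\<in>{1..N}. (\<i> * exp (pi_i * (uu j + x)) * qpow \<tau> (- 1 / 8) * theta (uu j + x) \<tau>) *
       (- \<i> * ?r * exp (pi_i * (uu j)\<^sup>2 / \<tau>) * theta (uu j) \<tau>))"
    unfolding infsum_acoef_exp[OF \<tau>] theta_inversion[OF \<tau>] prod.distrib[symmetric] ..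
  also have "\<dots> = (\<Prod>j\<in>{1..N}. exp (?e j) * ((\<i> * exp (pi_i * (uu j / \<tau> + x / \<tau>)) * qpow (- 1 / \<tau>) (- 1 / 8) * theta (uu j / \<tau> + x / \<tau>) (- 1 / \<tau>)) *
       theta (uu j) \<tau>))"
  proof (intro prod.cong refl)
    fix j
    have "exp (pi_i * (uu j + x)) * qpow \<tau> (- 1 / 8) * exp (pi_i * (uu j)\<^sup>2 / \<tau>) =
       exp (?e j) * exp (pi_i * (uu j / \<tau> + x / \<tau>)) * qpow (- 1 / \<tau>) (- 1 / 8) * exp (pi_i * (uu j + x)\<^sup>2 / \<tau>)"
      unfolding qpow_def exp_add[symmetric]
      by (rule arg_cong[of _ _ exp]) (use t0 in \<open>simp add: field_simps power2_eq_square\<close>)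
    then have "(exp (pi_i * (uu j + x)) * qpow \<tau> (- 1 / 8) * exp (pi_i * (uu j)\<^sup>2 / \<tau>)) * (\<i> * theta (uu j + x) \<tau> * (- \<i> * ?r * theta (uu j) \<tau>)) =
       (exp (?e j) * exp (pi_i * (uu j / \<tau> + x / \<tau>)) * qpow (- 1 / \<tau>) (- 1 / 8) * exp (pi_i * (uu j + x)\<^sup>2 / \<tau>)) * (\<i> * theta (uu j + x) \<tau> * (- \<i> * ?r * theta (uu j) \<tau>))"
      by (rule arg_cong)
    then show "(\<i> * exp (pi_i * (uu j + x)) * qpow \<tau> (- 1 / 8) * theta (uu j + x) \<tau>) *
       (- \<i> * ?r * exp (pi_i * (uu j)\<^sup>2 / \<tau>) * theta (uu j) \<tau>) =
       exp (?e j) * ((\<i> * exp (pi_i * (uu j / \<tau> + x / \<tau>)) * qpow (- 1 / \<tau>) (- 1 / 8) * theta (uu j / \<tau> + x / \<tau>) (- 1 / \<tau>)) *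
       theta (uu j) \<tau>)"
      unfolding th by (simp only: mult_ac)
  qed
  also have "\<dots> = exp ?E * (\<Sum>\<^sub>\<infinity>l. ?A' l * exp (neg_two_pi_i * of_int l * (x / \<tau>))) * (\<Prod>j\<in>{1..N}. theta (uu j) \<tau>)"
    unfolding infsum_acoef_exp[OF \<tau>'] prod.distrib[of "\<lambda>j. exp (?e j)"] sumE[symmetric] exp_sum[OF finite_atLeastAtMost]
    by (simp only: prod.distrib mult.assoc)
  also have "exp ?E * (\<Sum>\<^sub>\<infinity>l. ?A' l * exp (neg_two_pi_i * of_int l * (x / \<tau>))) =
     (\<Sum>\<^sub>\<infinity>l. ((- \<i>) ^ N * exp (pi_i * U\<^sup>2 / (of_nat N * \<tau>))) * (bcoef ?A' N (- 1 / \<tau>) (U / \<tau>) (- l) *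
      exp (neg_pi_i * (of_nat N * x + U + of_nat N * (1 - \<tau>) / 2 + of_int l)\<^sup>2 / (of_nat N * \<tau>))))"
    unfolding infsum_cmult_right'[symmetric]
  proof (intro infsum_cong)
    fix l :: int
    show "exp ?E * (?A' l * exp (neg_two_pi_i * of_int l * (x / \<tau>))) =
       ((- \<i>) ^ N * exp (pi_i * U\<^sup>2 / (of_nat N * \<tau>))) * (bcoef ?A' N (- 1 / \<tau>) (U / \<tau>) (- l) *
      exp (neg_pi_i * (of_nat N * x + U + of_nat N * (1 - \<tau>) / 2 + of_int l)\<^sup>2 / (of_nat N * \<tau>)))"
      by (rule bcoef_gauss[OF t0 N])
  qed
  finally show ?thesis by (simp only: infsum_cmult_right' mult_ac)
qed


text \<open>The averaged theta product is expanded in two ways. At \<tau> it is \<open>bcoef\<close>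
  times a theta function of modulus N \<tau>; through -1/\<tau> it is a finite Fourier transform of
  the dual \<open>bcoef\<close> times the Poisson dual of the same theta function. The Jacobi
  transformation relates the two theta factors, leaving only its square root.\<close>

lemma residue_identity:
  fixes uu :: "nat \<Rightarrow> complex" and N :: nat and p :: int
  defines "U \<equiv> (\<Sum>j\<in>{1..N}. uu j)"
  assumes \<tau>: "Im \<tau> > 0" and N: "N \<ge> 1"
  shows "of_nat N * bcoef (acoef N uu \<tau>) N \<tau> U p * (\<Prod>j\<in>{1..N}. theta (uu j / \<tau>) (- 1 / \<tau>)) =
    (- \<i>) ^ N * exp (pi_i * U\<^sup>2 / (of_nat N * \<tau>)) * csqrt (- \<i> * (of_nat N * \<tau>)) *
    (\<Sum>k<N. exp (neg_two_pi_i * of_int p * of_nat k / of_nat N) *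
       bcoef (acoef N (\<lambda>j. uu j / \<tau>) (- 1 / \<tau>)) N (- 1 / \<tau>) (U / \<tau>) (int k)) * (\<Prod>j\<in>{1..N}. theta (uu j) \<tau>)"
proof -
  have N': "of_nat N \<noteq> (0::complex)" and t0: "\<tau> \<noteq> 0" using N \<tau> by auto
  have \<tau>': "Im (- 1 / \<tau>) > 0" by (rule Im_minus_inverse_pos[OF \<tau>])
  have N\<tau>: "Im (of_nat N * \<tau>) > 0" using \<tau> N by simp
  let ?A = "acoef N uu \<tau>" and ?A' = "acoef N (\<lambda>j. uu j / \<tau>) (- 1 / \<tau>)"
  let ?T = "\<Prod>j\<in>{1..N}. theta (uu j) \<tau>" and ?T' = "\<Prod>j\<in>{1..N}. theta (uu j / \<tau>) (- 1 / \<tau>)"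
  let ?b' = "bcoef ?A' N (- 1 / \<tau>) (U / \<tau>)"
  let ?c = "(- \<i>) ^ N * exp (pi_i * U\<^sup>2 / (of_nat N * \<tau>))"
  let ?e = "\<lambda>r::nat. exp (neg_two_pi_i * of_int p * of_nat r / of_nat N)"
  let ?S = "\<Sum>k<N. ?e k * ?b' (int k)"
  \<comment> \<open>The free point \<open>x\<close> is placed so that the theta factor common to
    both sides is nonzero and can be cancelled.\<close>
  obtain z where z: "jtheta z (of_nat N * \<tau>) \<noteq> 0" by (rule jtheta_not_identically_0[OF N\<tau>])
  define x where "x = (z - of_int p * \<tau> - U - of_nat N * (1 - \<tau>) / 2) / of_nat N"
  define Y where "Y = of_nat N * x + U + of_nat N * (1 - \<tau>) / 2"
  have Yz: "Y + of_int p * \<tau> = z" using N' by (simp add: Y_def x_def)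
  define W where "W = exp (two_pi_i * of_int p * Y / of_nat N + pi_i * of_int p ^ 2 * \<tau> / of_nat N) *
       jtheta (Y + of_int p * \<tau>) (of_nat N * \<tau>)"
  have W0: "W \<noteq> 0" using z unfolding W_def Yz by simp
  let ?G = "\<lambda>n. exp (neg_pi_i * (Y + of_int n)\<^sup>2 / (of_nat N * \<tau>))"
  have recA: "?A (l + int N) = (-1) ^ N * exp (neg_two_pi_i * U) * qpow \<tau> (of_int l + of_nat N) * ?A l" for l
    unfolding U_def by (rule acoef_rec)
  have recA': "?A' (l + int N) = (-1) ^ N * exp (neg_two_pi_i * (U / \<tau>)) * qpow (- 1 / \<tau>) (of_int l + of_nat N) * ?A' l" for l
    using acoef_rec[of N "\<lambda>j. uu j / \<tau>" "- 1 / \<tau>" l] unfolding U_def sum_divide_distrib .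
  note per = bcoef_periodic[OF N recA']
  define h where "h = (\<lambda>k::int. exp (neg_two_pi_i * of_int p * of_int k / of_nat N) * ?b' k)"
  have hper: "h (k + int N) = h k" for k
  proof -
    have "exp (neg_two_pi_i * of_int p * of_int (k + int N) / of_nat N) =
       exp (neg_two_pi_i * of_int p * of_int k / of_nat N) * exp (two_pi_i * of_int (- p))"
      unfolding exp_add[symmetric] by (rule arg_cong[of _ _ exp]) (use N' in \<open>simp add: field_simps\<close>)
    then show ?thesis unfolding h_def exp_2pi_int per by simp
  qed
  have gs: "(\<lambda>l. ?b' (- l) * exp (neg_pi_i * (Y + of_nat r + of_int l)\<^sup>2 / (of_nat N * \<tau>))) summable_on UNIV" for r :: nat
  proof -
    let ?x = "x + of_nat r / of_nat N"
    have Yr: "of_nat N * ?x + U + of_nat N * (1 - \<tau>) / 2 = Y + of_nat r"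
      using N' by (simp add: Y_def algebra_simps)
    have "(\<lambda>l. ?c * (?b' (- l) * exp (neg_pi_i * (Y + of_nat r + of_int l)\<^sup>2 / (of_nat N * \<tau>)))) summable_on UNIV"
      unfolding Yr[symmetric] bcoef_gauss[OF t0 N, symmetric]
      by (intro summable_on_cmult_right abs_summable_summable[OF acoef_exp_summable[OF \<tau>']])
    then have "(\<lambda>l. inverse ?c * (?c * (?b' (- l) * exp (neg_pi_i * (Y + of_nat r + of_int l)\<^sup>2 / (of_nat N * \<tau>))))) summable_on UNIV"
      by (rule summable_on_cmult_right)
    moreover have "inverse ?c * (?c * z) = z" for z
      by (subst mult.assoc[symmetric], subst left_inverse) simp_all
    ultimately show ?thesis by (simp only:)
  qed
  have "of_nat N * bcoef ?A N \<tau> U p * W * ?T' = (\<Sum>r<N. ?e r *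
       (\<Sum>\<^sub>\<infinity>l. ?A l * exp (neg_two_pi_i * of_int l * (x + of_nat r / of_nat N)))) * ?T'"
    unfolding W_def acoef_average[OF \<tau> N acoef_exp_summable[OF \<tau>] recA Y_def] ..
  also have "\<dots> = (\<Sum>r<N. ?e r * (?c * ?T * (\<Sum>\<^sub>\<infinity>l. ?b' (- l) *
      exp (neg_pi_i * (Y + of_nat r + of_int l)\<^sup>2 / (of_nat N * \<tau>)))))"
    unfolding sum_distrib_right
  proof (intro sum.cong refl)
    fix r
    have Yr: "of_nat N * (x + of_nat r / of_nat N) + U + of_nat N * (1 - \<tau>) / 2 = Y + of_nat r"
      using N' by (simp add: Y_def algebra_simps)
    show "?e r * (\<Sum>\<^sub>\<infinity>l. ?A l * exp (neg_two_pi_i * of_int l * (x + of_nat r / of_nat N))) * ?T' =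
      ?e r * (?c * ?T * (\<Sum>\<^sub>\<infinity>l. ?b' (- l) * exp (neg_pi_i * (Y + of_nat r + of_int l)\<^sup>2 / (of_nat N * \<tau>))))"
      using theta_product_inversion[OF \<tau> N, of uu "x + of_nat r / of_nat N", folded U_def]
      unfolding Yr by (simp only: mult.assoc)
  qed
  also have "\<dots> = ?c * ?T * (\<Sum>r<N. ?e r * (\<Sum>\<^sub>\<infinity>l. ?b' (- l) *
      exp (neg_pi_i * (Y + of_nat r + of_int l)\<^sup>2 / (of_nat N * \<tau>))))"
    unfolding sum_distrib_left by (intro sum.cong refl) (simp only: mult_ac)
  also have "(\<Sum>r<N. ?e r * (\<Sum>\<^sub>\<infinity>l. ?b' (- l) * exp (neg_pi_i * (Y + of_nat r + of_int l)\<^sup>2 / (of_nat N * \<tau>)))) =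
     (\<Sum>r<N. \<Sum>\<^sub>\<infinity>n. ?e r * (?b' (int r - n) * ?G n))"
  proof (intro sum.cong refl)
    fix r
    have "(\<Sum>\<^sub>\<infinity>l. ?b' (- l) * exp (neg_pi_i * (Y + of_nat r + of_int l)\<^sup>2 / (of_nat N * \<tau>))) = (\<Sum>\<^sub>\<infinity>n. ?b' (int r - n) * ?G n)"
      using infsum_shift_int[of "\<lambda>n. ?b' (int r - n) * ?G n" "int r"] by (simp add: add_ac)
    then show "?e r * (\<Sum>\<^sub>\<infinity>l. ?b' (- l) * exp (neg_pi_i * (Y + of_nat r + of_int l)\<^sup>2 / (of_nat N * \<tau>))) =
       (\<Sum>\<^sub>\<infinity>n. ?e r * (?b' (int r - n) * ?G n))" by (simp only: infsum_cmult_right')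
  qed
  also have "\<dots> = (\<Sum>\<^sub>\<infinity>n. \<Sum>r<N. ?e r * (?b' (int r - n) * ?G n))"
  proof (rule conjunct2[OF infsum_finite_sum, symmetric])
    fix r
    have bij: "bij_betw (\<lambda>l::int. l + int r) UNIV UNIV"
      by (rule bij_betwI[where g = "\<lambda>n. n - int r"]) auto
    have "(\<lambda>l. ?b' (int r - (l + int r)) * ?G (l + int r)) summable_on UNIV"
      using gs[of r] by (simp add: add_ac)
    then have "(\<lambda>n. ?b' (int r - n) * ?G n) summable_on UNIV"
      using summable_on_reindex_bij_betw[OF bij, of "\<lambda>n. ?b' (int r - n) * ?G n"] by blast
    then show "(\<lambda>n. ?e r * (?b' (int r - n) * ?G n)) summable_on UNIV" by (rule summable_on_cmult_right)
  qed simp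
  \<comment> \<open>For fixed n the sum over r runs through one full period of \<open>h\<close>,
    whatever n is. The finite Fourier transform therefore separates from the Gaussian
    series.\<close>
  also have "\<dots> = (\<Sum>\<^sub>\<infinity>n. ?S * (?G n * exp (neg_two_pi_i * of_int p * of_int n / of_nat N)))"
  proof (intro infsum_cong)
    fix n :: int
    have "?e r * (?b' (int r - n) * ?G n) = h (int r + - n) * (?G n * exp (neg_two_pi_i * of_int p * of_int n / of_nat N))" for r
    proof -
      have "?e r = exp (neg_two_pi_i * of_int p * of_int (int r + - n) / of_nat N) * exp (neg_two_pi_i * of_int p * of_int n / of_nat N)"
        unfolding exp_add[symmetric] by (rule arg_cong[of _ _ exp]) (use N' in \<open>simp add: field_simps\<close>)
      then show ?thesis unfolding h_def by (simp add: mult_ac)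
    qed
    then have "(\<Sum>r<N. ?e r * (?b' (int r - n) * ?G n)) = (\<Sum>r<N. h (int r + - n)) * (?G n * exp (neg_two_pi_i * of_int p * of_int n / of_nat N))"
      by (simp only: sum_distrib_right)
    also have "(\<Sum>r<N. h (int r + - n)) = ?S"
      unfolding sum_periodic_shift[of h N, OF hper] by (simp add: h_def)
    finally show "(\<Sum>r<N. ?e r * (?b' (int r - n) * ?G n)) = ?S * (?G n * exp (neg_two_pi_i * of_int p * of_int n / of_nat N))" .
  qed
  also have "\<dots> = ?S * (\<Sum>\<^sub>\<infinity>n. ?G n * exp (neg_two_pi_i * of_int p * of_int n / of_nat N))"
    by (rule infsum_cmult_right')
  also have "(\<Sum>\<^sub>\<infinity>n. ?G n * exp (neg_two_pi_i * of_int p * of_int n / of_nat N)) =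
     exp (two_pi_i * of_int p * Y / of_nat N + pi_i * of_int p ^ 2 * \<tau> / of_nat N) * jgauss (Y + of_int p * \<tau>) (of_nat N * \<tau>)"
    unfolding jgauss_def infsum_cmult_right'[symmetric] gterm_def exp_add[symmetric]
    by (intro infsum_cong arg_cong[of _ _ exp]) (use N' t0 in \<open>simp add: field_simps power2_eq_square\<close>)
  also have "\<dots> = csqrt (- \<i> * (of_nat N * \<tau>)) * W"
    unfolding jacobi_transformation[OF N\<tau>] W_def by (simp only: mult_ac)
  finally have "of_nat N * bcoef ?A N \<tau> U p * W * ?T' = ?c * ?T * (?S * (csqrt (- \<i> * (of_nat N * \<tau>)) * W))" .
  then have "W * (of_nat N * bcoef ?A N \<tau> U p * ?T') = W * (?c * csqrt (- \<i> * (of_nat N * \<tau>)) * ?S * ?T)"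
    by (simp only: mult_ac)
  then show ?thesis using W0 by simp
qed

section \<open>The completed vector\<close>

lemma sum_upd_0: "(\<Sum>j\<le>N. (uu(0 := z)) j) = z + (\<Sum>j\<in>{1..N}. uu j)" for uu :: "nat \<Rightarrow> complex"
proof -
  have "{..N} = insert 0 {1..N}" by auto
  moreover have "(\<Sum>j\<in>{1..N}. (uu(0 := z)) j) = (\<Sum>j\<in>{1..N}. uu j)" by (rule sum.cong) auto
  ultimately show ?thesis by simp
qed

lemma muN_upd_0: "muN N z (uu(0 := y)) \<tau> = muN N z uu \<tau>"
  unfolding muN_def by (intro infsum_cong arg_cong2[of _ _ _ _ "(*)"] refl prod.cong) auto

lemma theta_plus_period: "theta (u + \<tau>) \<tau> = - exp (neg_two_pi_i * u - pi_i * \<tau>) * theta u \<tau>"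
proof -
  have J: "jtheta (u + \<tau> + 1/2 + \<tau>/2) \<tau> = exp (neg_pi_i * \<tau> - two_pi_i * (u + 1/2 + \<tau>/2)) * jtheta (u + 1/2 + \<tau>/2) \<tau>"
    using jtheta_plus_period[of "u + 1/2 + \<tau>/2" \<tau>] by (simp add: algebra_simps)
  have "exp (pi_i * \<tau> / 4 + pi_i * (u + \<tau> + 1/2)) * exp (neg_pi_i * \<tau> - two_pi_i * (u + 1/2 + \<tau>/2)) =
     exp (pi_i * of_int (- 1)) * exp (neg_two_pi_i * u - pi_i * \<tau>) * exp (pi_i * \<tau> / 4 + pi_i * (u + 1/2))"
    unfolding exp_add[symmetric] by (rule arg_cong[of _ _ exp]) (simp add: field_simps)
  then show ?thesis unfolding theta_eq_jtheta J exp_pi_int by (simp add: mult.assoc[symmetric])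
qed

text \<open>At x = \<tau> each theta returns to itself up to an exponential. The product on the
  right is the denominator of \<open>muN\<close>, so the quasiperiodicity defect of M is
  elementary.\<close>

lemma infsum_acoef_at_period:
  assumes "Im \<tau> > 0"
  shows "(\<Sum>\<^sub>\<infinity>l. acoef N uu \<tau> l * exp (neg_two_pi_i * of_int l * \<tau>)) =
    (- \<i>) ^ N * exp (neg_pi_i * (\<Sum>j\<in>{1..N}. uu j) - pi_i * of_nat N * \<tau> / 4) * (\<Prod>j\<in>{1..N}. theta (uu j) \<tau>)"
proof -
  have "\<i> * exp (pi_i * (u + \<tau>)) * qpow \<tau> (- 1 / 8) * theta (u + \<tau>) \<tau> =
     (- \<i>) * exp (neg_pi_i * u - pi_i * \<tau> / 4) * theta u \<tau>" for u
  proof -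
    have "exp (pi_i * (u + \<tau>)) * qpow \<tau> (- 1 / 8) * exp (neg_two_pi_i * u - pi_i * \<tau>) =
       exp (neg_pi_i * u - pi_i * \<tau> / 4)"
      unfolding qpow_def exp_add[symmetric] by (rule arg_cong[of _ _ exp]) (simp add: field_simps)
    then show ?thesis unfolding theta_plus_period by (simp add: mult_ac)
  qed
  then have "(\<Sum>\<^sub>\<infinity>l. acoef N uu \<tau> l * exp (neg_two_pi_i * of_int l * \<tau>)) =
     (\<Prod>j\<in>{1..N}. (- \<i>) * exp (neg_pi_i * uu j - pi_i * \<tau> / 4) * theta (uu j) \<tau>)"
    unfolding infsum_acoef_exp[OF assms] by simp
  also have "\<dots> = (- \<i>) ^ N * exp (\<Sum>j\<in>{1..N}. - pi_i * uu j - pi_i * \<tau> / 4) * (\<Prod>j\<in>{1..N}. theta (uu j) \<tau>)"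
    unfolding prod.distrib exp_sum[OF finite_atLeastAtMost] by simp
  also have "(\<Sum>j\<in>{1..N}. - pi_i * uu j - pi_i * \<tau> / 4) =
     neg_pi_i * (\<Sum>j\<in>{1..N}. uu j) - pi_i * of_nat N * \<tau> / 4"
    unfolding sum_subtractf sum_distrib_left[symmetric] by simp
  finally show ?thesis .
qed

lemma psi_plus_1: "psi \<tau> l (z + 1) = - psi \<tau> l z"
proof -
  have "exp (pi_i * (z + 1)) = - exp (pi_i * z)" by (simp add: ring_distribs exp_add)
  moreover have "exp (two_pi_i * (z + 1)) = exp (two_pi_i * z)" by (simp add: ring_distribs exp_add)
  ultimately show ?thesis by (simp add: psi_def)
qed

lemma appell_plus_1: "appell A \<tau> (z + 1) = - appell A \<tau> z"
  unfolding appell_def psi_plus_1 by (simp add: infsum_uminus)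

lemma Rfun_plus_1: "Rfun (w + 1) \<sigma> = - Rfun w \<sigma>"
proof -
  have e: "exp (neg_two_pi_i * of_real (real_of_int m + 1/2) * (w + 1)) = - exp (neg_two_pi_i * of_real (real_of_int m + 1/2) * w)" for m
  proof -
    have "exp (neg_two_pi_i * of_real (real_of_int m + 1/2) * (w + 1)) =
       exp (neg_two_pi_i * of_real (real_of_int m + 1/2) * w) * (exp (pi_i * of_int (- 1)) * exp (two_pi_i * of_int (- m)))"
      unfolding exp_add[symmetric] by (rule arg_cong[of _ _ exp]) (simp add: field_simps)
    then show ?thesis unfolding exp_2pi_int exp_pi_int by simp
  qed
  show ?thesis unfolding Rfun_def Let_def e infsum_uminus[symmetric] by (intro infsum_cong) simp
qed

section \<open>Shifts of the first variable of the completed vector\<close>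

context
  fixes N :: nat and uu :: "nat \<Rightarrow> complex" and \<tau> :: complex
  assumes N: "N \<ge> 1" and \<tau>: "Im \<tau> > 0"
begin

lemma MN_formula:
  assumes "z \<notin> lattice \<tau>"
  shows "MN N (uu(0 := z)) \<tau> k = (-1) ^ k * exp (neg_two_pi_i * of_nat k * (z + (\<Sum>j\<in>{1..N}. uu j)) / of_nat N - pi_i * of_nat (k\<^sup>2) * \<tau> / of_nat N) *
     (appell (acoef N uu \<tau>) \<tau> (z + of_nat k * \<tau>) / (\<Prod>j\<in>{1..N}. theta (uu j) \<tau>))"
proof -
  have "z + of_nat k * \<tau> \<notin> lattice \<tau>" using assms lattice_add_iff[of z 0 "int k" \<tau>] by simp
  then show ?thesis unfolding MN_def Let_def sum_upd_0 muN_upd_0 fun_upd_same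
    by (subst muN_eq_appell[OF \<tau>]) auto
qed

lemma MtN_plus_1:
  assumes "z \<notin> lattice \<tau>"
  shows "MtN N (uu(0 := z + 1)) \<tau> k = - exp (neg_two_pi_i * of_nat k / of_nat N) * MtN N (uu(0 := z)) \<tau> k"
proof -
  have N': "of_nat N \<noteq> (0::complex)" using N by simp
  have z1: "z + 1 \<notin> lattice \<tau>" using assms lattice_add_iff[of z 1 0 \<tau>] by simp
  have ap: "appell A \<tau> (z + 1 + of_nat k * \<tau>) = - appell A \<tau> (z + of_nat k * \<tau>)" for A
    using appell_plus_1[of A \<tau> "z + of_nat k * \<tau>"] by (simp add: add_ac)
  have R: "Rfun (z + 1 + (\<Sum>j\<in>{1..N}. uu j) + of_nat k * \<tau> + (of_nat N + 1) / 2) \<sigma> = - Rfun (z + (\<Sum>j\<in>{1..N}. uu j) + of_nat k * \<tau> + (of_nat N + 1) / 2) \<sigma>" for \<sigma>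
    using Rfun_plus_1[of "z + (\<Sum>j\<in>{1..N}. uu j) + of_nat k * \<tau> + (of_nat N + 1) / 2" \<sigma>] by (simp add: add_ac)
  have e1: "exp (neg_two_pi_i * of_nat k * (z + 1 + (\<Sum>j\<in>{1..N}. uu j)) / of_nat N - pi_i * of_nat (k\<^sup>2) * \<tau> / of_nat N) =
     exp (neg_two_pi_i * of_nat k / of_nat N) * exp (neg_two_pi_i * of_nat k * (z + (\<Sum>j\<in>{1..N}. uu j)) / of_nat N - pi_i * of_nat (k\<^sup>2) * \<tau> / of_nat N)"
    unfolding exp_add[symmetric] by (rule arg_cong[of _ _ exp]) (use N' in \<open>simp add: field_simps\<close>)
  have e2: "exp (neg_two_pi_i * of_nat k * (z + 1 + (\<Sum>j\<in>{1..N}. uu j)) / of_nat N) =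
     exp (neg_two_pi_i * of_nat k / of_nat N) * exp (neg_two_pi_i * of_nat k * (z + (\<Sum>j\<in>{1..N}. uu j)) / of_nat N)"
    unfolding exp_add[symmetric] by (rule arg_cong[of _ _ exp]) (use N' in \<open>simp add: field_simps\<close>)
  show ?thesis
    unfolding MtN_def MN_formula[OF assms] MN_formula[OF z1] RN_def sum_upd_0 ap R e1 e2
    by (simp add: algebra_simps)
qed

text \<open>The prefactors of both vectors are such that index k + 1 at z is index k at z + \<tau>.
  The index is unrestricted, so component N is available as well; it expresses the wrap-around in
  P.\<close>

lemma MtN_Suc:
  "MtN N (uu(0 := z)) \<tau> (Suc k) = - exp (neg_two_pi_i * (z + (\<Sum>j\<in>{1..N}. uu j)) / of_nat N) * qpow \<tau> (- 1 / (2 * of_nat N)) *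
     MtN N (uu(0 := z + \<tau>)) \<tau> k"
proof -
  have N': "of_nat N \<noteq> (0::complex)" using N by simp
  let ?c = "exp (neg_two_pi_i * (z + (\<Sum>j\<in>{1..N}. uu j)) / of_nat N) * qpow \<tau> (- 1 / (2 * of_nat N))"
  have s: "z + of_nat (Suc k) * \<tau> = z + \<tau> + of_nat k * \<tau>" "z + (\<Sum>j\<in>{1..N}. uu j) + of_nat (Suc k) * \<tau> = z + \<tau> + (\<Sum>j\<in>{1..N}. uu j) + of_nat k * \<tau>"
    by (simp_all add: algebra_simps)
  have e1: "exp (neg_two_pi_i * of_nat (Suc k) * (z + (\<Sum>j\<in>{1..N}. uu j)) / of_nat N - pi_i * of_nat ((Suc k)\<^sup>2) * \<tau> / of_nat N) =
     ?c * exp (neg_two_pi_i * of_nat k * (z + \<tau> + (\<Sum>j\<in>{1..N}. uu j)) / of_nat N - pi_i * of_nat (k\<^sup>2) * \<tau> / of_nat N)"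
    unfolding qpow_def exp_add[symmetric]
    by (rule arg_cong[of _ _ exp]) (use N' in \<open>simp add: field_simps power2_eq_square\<close>)
  have e2: "exp (neg_two_pi_i * of_nat (Suc k) * (z + (\<Sum>j\<in>{1..N}. uu j)) / of_nat N) * qpow \<tau> (- of_nat ((Suc k)\<^sup>2) / (2 * of_nat N)) =
     ?c * (exp (neg_two_pi_i * of_nat k * (z + \<tau> + (\<Sum>j\<in>{1..N}. uu j)) / of_nat N) * qpow \<tau> (- of_nat (k\<^sup>2) / (2 * of_nat N)))"
    unfolding qpow_def exp_add[symmetric]
    by (rule arg_cong[of _ _ exp]) (use N' in \<open>simp add: field_simps power2_eq_square\<close>)
  have M: "MN N (uu(0 := z)) \<tau> (Suc k) = - ?c * MN N (uu(0 := z + \<tau>)) \<tau> k"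
    unfolding MN_def Let_def sum_upd_0 muN_upd_0 fun_upd_same e1 s by simp
  have R: "RN N (z + (\<Sum>j\<in>{1..N}. uu j)) \<tau> (Suc k) = - ?c * RN N (z + \<tau> + (\<Sum>j\<in>{1..N}. uu j)) \<tau> k"
  proof -
    have "RN N (z + (\<Sum>j\<in>{1..N}. uu j)) \<tau> (Suc k) = (-1) ^ Suc k * (exp (neg_two_pi_i * of_nat (Suc k) * (z + (\<Sum>j\<in>{1..N}. uu j)) / of_nat N) * qpow \<tau> (- of_nat ((Suc k)\<^sup>2) / (2 * of_nat N))) *
        Rfun (z + \<tau> + (\<Sum>j\<in>{1..N}. uu j) + of_nat k * \<tau> + (of_nat N + 1) / 2) (of_nat N * \<tau>)"
      unfolding RN_def s by (simp only: mult.assoc)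
    then show ?thesis unfolding e2 RN_def by simp
  qed
  show ?thesis unfolding MtN_def M sum_upd_0 R by (simp add: algebra_simps)
qed

lemma MtN_N_shift:
  "MtN N (uu(0 := z)) \<tau> N = (-1) ^ N * exp (neg_two_pi_i * (z + (\<Sum>j\<in>{1..N}. uu j)) - pi_i * of_nat N * \<tau>) *
     MtN N (uu(0 := z + of_nat N * \<tau>)) \<tau> 0"
proof -
  have N': "of_nat N \<noteq> (0::complex)" using N by simp
  have e1: "exp (neg_two_pi_i * of_nat N * (z + (\<Sum>j\<in>{1..N}. uu j)) / of_nat N - pi_i * of_nat (N\<^sup>2) * \<tau> / of_nat N) =
     exp (neg_two_pi_i * (z + (\<Sum>j\<in>{1..N}. uu j)) - pi_i * of_nat N * \<tau>)"
    by (rule arg_cong[of _ _ exp]) (use N' in \<open>simp add: field_simps power2_eq_square\<close>)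
  have e2: "exp (neg_two_pi_i * of_nat N * (z + (\<Sum>j\<in>{1..N}. uu j)) / of_nat N) * qpow \<tau> (- of_nat (N\<^sup>2) / (2 * of_nat N)) =
     exp (neg_two_pi_i * (z + (\<Sum>j\<in>{1..N}. uu j)) - pi_i * of_nat N * \<tau>)"
    unfolding qpow_def exp_add[symmetric]
    by (rule arg_cong[of _ _ exp]) (use N' in \<open>simp add: field_simps power2_eq_square\<close>)
  have R: "RN N (z + (\<Sum>j\<in>{1..N}. uu j)) \<tau> N = (-1) ^ N * exp (neg_two_pi_i * (z + (\<Sum>j\<in>{1..N}. uu j)) - pi_i * of_nat N * \<tau>) *
     RN N (z + of_nat N * \<tau> + (\<Sum>j\<in>{1..N}. uu j)) \<tau> 0"
  proof -
    have "RN N (z + (\<Sum>j\<in>{1..N}. uu j)) \<tau> N = (-1) ^ N * (exp (neg_two_pi_i * of_nat N * (z + (\<Sum>j\<in>{1..N}. uu j)) / of_nat N) * qpow \<tau> (- of_nat (N\<^sup>2) / (2 * of_nat N))) *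
        Rfun (z + (\<Sum>j\<in>{1..N}. uu j) + of_nat N * \<tau> + (of_nat N + 1) / 2) (of_nat N * \<tau>)"
      unfolding RN_def by (simp only: mult.assoc)
    also have "z + (\<Sum>j\<in>{1..N}. uu j) + of_nat N * \<tau> = z + of_nat N * \<tau> + (\<Sum>j\<in>{1..N}. uu j)" by simp
    finally show ?thesis unfolding e2 by (simp add: RN_def qpow_def)
  qed
  have M: "MN N (uu(0 := z)) \<tau> N = (-1) ^ N * exp (neg_two_pi_i * (z + (\<Sum>j\<in>{1..N}. uu j)) - pi_i * of_nat N * \<tau>) *
     MN N (uu(0 := z + of_nat N * \<tau>)) \<tau> 0"
    unfolding MN_def Let_def sum_upd_0 muN_upd_0 fun_upd_same e1 by simp
  show ?thesis unfolding MtN_def M sum_upd_0 R by (simp add: algebra_simps)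
qed

end

text \<open>With X the common exponential, the Appell part has defect - (- i)^N X and R has defect 2
  (- i)^(N + 1) X. As i/2 times the latter is (- i)^N X, they cancel in the completion.\<close>

lemma MtN_N_eq_0:
  assumes N: "N \<ge> 1" and \<tau>: "Im \<tau> > 0" and uu: "\<And>j. j \<in> {1..N} \<Longrightarrow> uu j \<notin> lattice \<tau>" and z: "z \<notin> lattice \<tau>"
  shows "MtN N (uu(0 := z)) \<tau> N = MtN N (uu(0 := z)) \<tau> 0"
proof -
  let ?U = "\<Sum>j\<in>{1..N}. uu j" and ?T = "\<Prod>j\<in>{1..N}. theta (uu j) \<tau>"
  let ?x = "exp (neg_two_pi_i * (z + ?U) - pi_i * of_nat N * \<tau>)"
  let ?A = "acoef N uu \<tau>"
  let ?X = "exp (neg_pi_i * (z + ?U) - pi_i * of_nat N * \<tau> / 4)"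
  have T: "?T \<noteq> 0" using theta_nonzero[OF \<tau> uu] by simp
  have zN: "z + of_nat N * \<tau> \<notin> lattice \<tau>" using z lattice_add_iff[of z 0 "int N" \<tau>] by simp
  have N\<tau>: "Im (of_nat N * \<tau>) > 0" using N \<tau> by simp
  have ap: "appell ?A \<tau> z - (-1) ^ N * ?x * appell ?A \<tau> (z + of_nat N * \<tau>) = - ((- \<i>) ^ N * ?X * ?T)"
  proof -
    have "?x = exp (neg_two_pi_i * (z + ?U)) * qpow \<tau> (- of_nat N / 2)"
      unfolding qpow_def exp_add[symmetric] by (rule arg_cong[of _ _ exp]) simp
    moreover have "exp (neg_pi_i * z) * exp (neg_pi_i * ?U - pi_i * of_nat N * \<tau> / 4) = ?X"
      unfolding exp_add[symmetric] by (rule arg_cong[of _ _ exp]) (simp add: algebra_simps)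
    ultimately show ?thesis
      using appell_quasiperiodic[OF \<tau> z acoef_summable[OF \<tau>] acoef_rec, of N uu]
      unfolding infsum_acoef_at_period[OF \<tau>] by (simp add: mult_ac)
  qed
  have M: "MN N (uu(0 := z)) \<tau> 0 - (-1) ^ N * ?x * MN N (uu(0 := z + of_nat N * \<tau>)) \<tau> 0 = - ((- \<i>) ^ N * ?X)"
  proof -
    have "MN N (uu(0 := z)) \<tau> 0 - (-1) ^ N * ?x * MN N (uu(0 := z + of_nat N * \<tau>)) \<tau> 0 =
       (appell ?A \<tau> z - (-1) ^ N * ?x * appell ?A \<tau> (z + of_nat N * \<tau>)) / ?T"
      unfolding MN_formula[OF N \<tau> z] MN_formula[OF N \<tau> zN] by (simp add: diff_divide_distrib)
    then show ?thesis unfolding ap using T by simp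
  qed
  have R: "RN N (z + ?U) \<tau> 0 - (-1) ^ N * ?x * RN N (z + of_nat N * \<tau> + ?U) \<tau> 0 = (- \<i>) ^ (N + 1) * (2 * ?X)"
  proof -
    have e1: "z + of_nat N * \<tau> + ?U = (z + ?U) + of_nat N * \<tau>" by simp
    have "?x = exp (neg_two_pi_i * (z + ?U) - pi_i * (of_nat N * \<tau>))"
      "?X = exp (neg_pi_i * (z + ?U) - pi_i * (of_nat N * \<tau>) / 4)" by (simp_all only: mult_ac)
    then have q: "Qfun (sgnN N) (1 / 2) (of_nat N * \<tau>) (z + ?U) - (-1) ^ N * ?x * Qfun (sgnN N) (1 / 2) (of_nat N * \<tau>) ((z + ?U) + of_nat N * \<tau>) = 2 * ?X"
      using Qfun_quasiperiodic[OF N\<tau>, of N "z + ?U"] by (simp only:)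
    show ?thesis unfolding RN_0_eq_Qfun[OF \<tau> N] e1 q[symmetric] by (simp only: right_diff_distrib mult_ac)
  qed
  have ii: "\<i> / 2 * ((- \<i>) ^ (N + 1) * (2 * ?X)) = (- \<i>) ^ N * ?X" by simp
  have "MtN N (uu(0 := z)) \<tau> 0 - MtN N (uu(0 := z)) \<tau> N =
     (MN N (uu(0 := z)) \<tau> 0 - (-1) ^ N * ?x * MN N (uu(0 := z + of_nat N * \<tau>)) \<tau> 0) +
     \<i> / 2 * (RN N (z + ?U) \<tau> 0 - (-1) ^ N * ?x * RN N (z + of_nat N * \<tau> + ?U) \<tau> 0)"
    unfolding MtN_N_shift[OF N \<tau>] unfolding MtN_def sum_upd_0 by (simp add: algebra_simps)
  then show ?thesis unfolding M R ii by simp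
qed

lemma MtN_plus_of_nat:
  assumes N: "N \<ge> 1" and \<tau>: "Im \<tau> > 0" and z: "z \<notin> lattice \<tau>"
  shows "MtN N (uu(0 := z + of_nat n)) \<tau> k = (-1) ^ n * exp (neg_two_pi_i * of_nat k / of_nat N) ^ n * MtN N (uu(0 := z)) \<tau> k"
proof (induction n)
  case (Suc n)
  have "z + of_nat n \<notin> lattice \<tau>" using z lattice_add_iff[of z "int n" 0 \<tau>] by simp
  note step = MtN_plus_1[OF N \<tau> this]
  have eq: "z + of_nat (Suc n) = z + of_nat n + 1" by simp
  show ?case unfolding eq step Suc.IH power_Suc by (simp only: mult_ac mult_minus_left mult_minus_right mult_1_left)
qed simp

lemma exp_minus_2pi_nat: "exp (neg_two_pi_i * of_nat k / of_nat N) ^ N = 1" if "N \<ge> 1"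
proof -
  have "exp (neg_two_pi_i * of_nat k / of_nat N) ^ N = exp (two_pi_i * of_int (- int k))"
    unfolding exp_of_nat_mult[symmetric] by (rule arg_cong[of _ _ exp]) (use that in simp)
  then show ?thesis unfolding exp_2pi_int .
qed

section \<open>The inversion formula\<close>

lemma entire_negative_degree_eq_0:
  assumes hol: "D holomorphic_on UNIV" and per: "\<And>z. D (z + 1) = D z" and s: "Im s > 0"
    and quasi: "\<And>z. D (z + s) = exp (\<kappa> + two_pi_i * z) * D z"
  shows "D z = 0"
proof (rule fourier_unique[OF hol per])
  have rec: "fourier_coeff D n = exp (\<kappa> - two_pi_i * of_int n * s) * fourier_coeff D (n - 1)" for n
    using fourier_coeff_quasiperiodic[OF hol per, of s \<kappa> "-1" n] quasi by simp
  have z: "fourier_coeff D n = 0 \<longleftrightarrow> fourier_coeff D (n - 1) = 0" for n using rec[of n] by simp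
  have all: "fourier_coeff D n = 0 \<longleftrightarrow> fourier_coeff D 0 = 0" for n
  proof (induction n rule: int_induct[where k = 0])
    case (step1 i) then show ?case using z[of "i + 1"] by simp
  next
    case (step2 i) then show ?case using z[of i] by simp
  qed simp
  \<comment> \<open>From this index on, Re \<kappa> + 2 pi n Im s is nonnegative, so the moduli of
    the coefficients no longer decrease; together with their decay this forces the coefficient at
    \<open>n0\<close>, and with it all others, to vanish.\<close>
  define n0 where "n0 = nat \<lceil>- Re \<kappa> / (2 * pi * Im s)\<rceil>"
  have grow: "norm (fourier_coeff D (int n0)) \<le> norm (fourier_coeff D (int (n0 + j)))" for j
  proof (induction j)
    case (Suc j)
    let ?n = "int (n0 + Suc j)"
    have "- Re \<kappa> / (2 * pi * Im s) \<le> real n0" unfolding n0_def by linarith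
    then have "- Re \<kappa> \<le> real n0 * (2 * pi * Im s)" using s by (subst (asm) pos_divide_le_eq) auto
    also have "\<dots> \<le> of_int ?n * (2 * pi * Im s)" using s by (intro mult_right_mono) auto
    finally have "1 \<le> norm (exp (\<kappa> - two_pi_i * of_int ?n * s))" by (simp add: mult_ac)
    then have "1 * norm (fourier_coeff D (?n - 1)) \<le> norm (exp (\<kappa> - two_pi_i * of_int ?n * s)) * norm (fourier_coeff D (?n - 1))"
      by (rule mult_right_mono) simp
    also have "\<dots> = norm (fourier_coeff D ?n)" unfolding norm_mult[symmetric] rec[symmetric] ..
    finally show ?case using Suc by simp
  qed simp
  have "(\<lambda>j. fourier_coeff D (int (j + n0))) \<longlonglongrightarrow> 0"
    by (rule LIMSEQ_ignore_initial_segment[OF fourier_coeff_decay(1)[OF hol per]])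
  then have "(\<lambda>j. norm (fourier_coeff D (int (n0 + j)))) \<longlonglongrightarrow> 0"
    using tendsto_norm_zero by (simp add: add.commute)
  then have "norm (fourier_coeff D (int n0)) \<le> 0"
    by (rule LIMSEQ_le_const) (use grow in auto)
  then have "fourier_coeff D 0 = 0" using all[of "int n0"] by simp
  then show "fourier_coeff D n = 0" for n using all by simp
qed

lemma csqrt_of_nat_mult:
  assumes "Im \<tau> > 0"
  shows "csqrt (- \<i> * (of_nat N * \<tau>)) = of_real (sqrt (real N)) * csqrt (- \<i> * \<tau>)"
proof (cases "N = 0")
  case False
  show ?thesis
  proof (rule csqrt_unique)
    have "(of_real (sqrt (real N)) :: complex)\<^sup>2 = of_nat N" by (simp flip: of_real_power)
    then show "(of_real (sqrt (real N)) * csqrt (- \<i> * \<tau>))\<^sup>2 = - \<i> * (of_nat N * \<tau>)"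
      by (simp add: power_mult_distrib)
    have "0 < Re (of_real (sqrt (real N)) * w) \<or> Re (of_real (sqrt (real N)) * w) = 0 \<and> 0 \<le> Im (of_real (sqrt (real N)) * w)"
      if "0 < Re w \<or> Re w = 0 \<and> 0 \<le> Im w" for w
      using that False by auto
    from this[OF csqrt_principal] show "0 < Re (of_real (sqrt (real N)) * csqrt (- \<i> * \<tau>)) \<or>
      Re (of_real (sqrt (real N)) * csqrt (- \<i> * \<tau>)) = 0 \<and> 0 \<le> Im (of_real (sqrt (real N)) * csqrt (- \<i> * \<tau>))" .
  qed
qed simp

lemma lattice_inversion:
  assumes "\<tau> \<noteq> 0" shows "z / \<tau> \<in> lattice (- 1 / \<tau>) \<longleftrightarrow> z \<in> lattice \<tau>"
proof
  assume "z / \<tau> \<in> lattice (- 1 / \<tau>)"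
  then obtain a b where "z / \<tau> = of_int a + of_int b * (- 1 / \<tau>)" by (auto simp: lattice_def)
  then have "z = of_int (- b) + of_int a * \<tau>" using assms by (simp add: field_simps)
  then show "z \<in> lattice \<tau>" unfolding lattice_def by blast
next
  assume "z \<in> lattice \<tau>"
  then obtain a b where "z = of_int a + of_int b * \<tau>" by (auto simp: lattice_def)
  then have "z / \<tau> = of_int b + of_int (- a) * (- 1 / \<tau>)" using assms by (simp add: field_simps)
  then show "z / \<tau> \<in> lattice (- 1 / \<tau>)" unfolding lattice_def by blast
qed

text \<open>The prefactor in (iv), with \<open>\<surd>N \<surd>(-i\<tau>)\<close> written as \<open>csqrt (-iN\<tau>)\<close>.\<close>

definition Cfac :: "nat \<Rightarrow> complex \<Rightarrow> complex \<Rightarrow> complex" where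
  "Cfac N \<tau> u = (- \<i>) ^ (N + 1) / csqrt (- \<i> * (of_nat N * \<tau>)) * exp (pi_i * u\<^sup>2 / (of_nat N * \<tau>))"

text \<open>The left-hand side of (iv) as a function of \<open>z = u\<^sub>0\<close>.\<close>

definition MtS :: "nat \<Rightarrow> (nat \<Rightarrow> complex) \<Rightarrow> complex \<Rightarrow> nat \<Rightarrow> complex \<Rightarrow> complex" where
  "MtS N uu \<tau> j z = Cfac N \<tau> (z + (\<Sum>j\<in>{1..N}. uu j)) *
     (\<Sum>k<N. exp (neg_two_pi_i * of_nat j * of_nat k / of_nat N) * MtN N ((\<lambda>j. uu j / \<tau>)(0 := z / \<tau>)) (- 1 / \<tau>) k)"

text \<open>The sum over all components at -1/\<tau> is one series of modulus -1/(N \<tau>), so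
  \<open>Qfun_modular\<close> applies with \<sigma> = N \<tau>. One factor (- i)^(N + 1) is common
  to both terms, the other comes from \<open>Cfac\<close>.\<close>

lemma holomorphic_RN_defect:
  assumes N: "N \<ge> 1" and \<tau>: "Im \<tau> > 0"
  shows "(\<lambda>u. Cfac N \<tau> u * (\<Sum>k<N. RN N (u / \<tau>) (- 1 / \<tau>) k) - RN N u \<tau> 0) holomorphic_on UNIV"
proof -
  let ?\<sigma> = "of_nat N * \<tau>"
  have N\<tau>: "Im ?\<sigma> > 0" using N \<tau> by simp
  have e: "Cfac N \<tau> u * (\<Sum>k<N. RN N (u / \<tau>) (- 1 / \<tau>) k) - RN N u \<tau> 0 =
    (- \<i>) ^ (N + 1) * ((- \<i>) ^ (N + 1) / csqrt (- \<i> * ?\<sigma>) * exp (pi_i * u\<^sup>2 / ?\<sigma>) *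
      Qfun (sgnN 1) (real N / 2) (- 1 / ?\<sigma>) (u / ?\<sigma>) - Qfun (sgnN N) (1 / 2) ?\<sigma> u)" for u
  proof -
    have "- 1 / \<tau> / of_nat N = - 1 / ?\<sigma>" "u / \<tau> / of_nat N = u / ?\<sigma>" by (simp_all add: mult.commute)
    then show ?thesis
      unfolding sum_RN_eq_Qfun[OF Im_minus_inverse_pos[OF \<tau>] N] RN_0_eq_Qfun[OF \<tau> N] Cfac_def
      by (simp only: right_diff_distrib mult_ac)
  qed
  show ?thesis unfolding e by (intro holomorphic_intros Qfun_modular[OF N\<tau>])
qed

text \<open>Matching of the poles at a + b \<tau>. Component k at -1/\<tau> contributes the
  coefficient of index a - k, so the sum over k is a finite Fourier transform at frequency b over a
  full period, to which \<open>residue_identity\<close> applies. The factor \<tau> stems from the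
  rescaling z / \<tau>; the right-hand side is the polar part of the Appell sum at \<tau>.\<close>

lemma MtS_residue_match:
  fixes uu :: "nat \<Rightarrow> complex" and N :: nat and a b :: int and \<tau> :: complex
  defines "U \<equiv> (\<Sum>j\<in>{1..N}. uu j)" and "T \<equiv> (\<Prod>j\<in>{1..N}. theta (uu j) \<tau>)"
    and "T' \<equiv> (\<Prod>j\<in>{1..N}. theta (uu j / \<tau>) (- 1 / \<tau>))"
  assumes N: "N \<ge> 1" and \<tau>: "Im \<tau> > 0" and T: "T \<noteq> 0" and T': "T' \<noteq> 0"
  shows "Cfac N \<tau> (of_int a + of_int b * \<tau> + U) * (\<Sum>k<N. (-1) ^ k *
      exp (neg_two_pi_i * of_nat k * ((of_int a + of_int b * \<tau>) / \<tau> + U / \<tau>) / of_nat N - pi_i * of_nat (k\<^sup>2) * (- 1 / \<tau>) / of_nat N) *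
      (\<tau> * (- acoef N (\<lambda>j. uu j / \<tau>) (- 1 / \<tau>) (a - int k) * exp (pi_i * (of_int b - of_int (a - int k) * (- 1 / \<tau>))) / (two_pi_i)) / T')) =
    - acoef N uu \<tau> (- b) * exp (pi_i * (of_int a - of_int (- b) * \<tau>)) / (two_pi_i) / T"
proof -
  have N': "of_nat N \<noteq> (0::complex)" and t0: "\<tau> \<noteq> 0" using N \<tau> by auto
  let ?A' = "acoef N (\<lambda>j. uu j / \<tau>) (- 1 / \<tau>)" and ?A = "acoef N uu \<tau>"
  let ?b' = "bcoef ?A' N (- 1 / \<tau>) (U / \<tau>)"
  let ?R = "csqrt (- \<i> * (of_nat N * \<tau>))"
  let ?u = "of_int a + of_int b * \<tau> + U"
  let ?E0 = "exp (pi_i * U\<^sup>2 / (of_nat N * \<tau>))"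
  let ?Eb = "exp (pi_i * (of_int a + of_int b + of_int b ^ 2 * \<tau> / of_nat N + 2 * of_int b * U / of_nat N))"
  define h where "h = (\<lambda>k::int. exp (neg_two_pi_i * of_int b * of_int k / of_nat N) * ?b' k)"
  define S where "S = (\<Sum>k<N. exp (neg_two_pi_i * of_int b * of_nat k / of_nat N) * ?b' (int k))"
  define p where "p = two_pi_i"
  have recA': "?A' (l + int N) = (-1) ^ N * exp (neg_two_pi_i * (U / \<tau>)) * qpow (- 1 / \<tau>) (of_int l + of_nat N) * ?A' l" for l
    using acoef_rec[of N "\<lambda>j. uu j / \<tau>" "- 1 / \<tau>" l] unfolding U_def sum_divide_distrib .
  have hper: "h (k + int N) = h k" for k
  proof -
    have "exp (neg_two_pi_i * of_int b * of_int (k + int N) / of_nat N) =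
       exp (neg_two_pi_i * of_int b * of_int k / of_nat N) * exp (two_pi_i * of_int (- b))"
      unfolding exp_add[symmetric] by (rule arg_cong[of _ _ exp]) (use N' in \<open>simp add: field_simps\<close>)
    then show ?thesis unfolding h_def exp_2pi_int bcoef_periodic[OF N recA'] by simp
  qed
  have hS: "(\<Sum>k<N. h (int k + - a)) = S"
    unfolding sum_periodic_shift[of h N, OF hper] S_def by (simp add: h_def)
  have summand: "exp (pi_i * ?u\<^sup>2 / (of_nat N * \<tau>)) * ((-1) ^ k *
      exp (neg_two_pi_i * of_nat k * ((of_int a + of_int b * \<tau>) / \<tau> + U / \<tau>) / of_nat N - pi_i * of_nat (k\<^sup>2) * (- 1 / \<tau>) / of_nat N) *
      (\<tau> * (- ?A' (a - int k) * exp (pi_i * (of_int b - of_int (a - int k) * (- 1 / \<tau>))) / p) / T')) =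
      - (\<tau> / (p * T')) * (?E0 * ?Eb) * h (int k + - a)" for k
  proof -
    have "exp (pi_i * ?u\<^sup>2 / (of_nat N * \<tau>)) * ((-1) ^ k *
      exp (neg_two_pi_i * of_nat k * ((of_int a + of_int b * \<tau>) / \<tau> + U / \<tau>) / of_nat N - pi_i * of_nat (k\<^sup>2) * (- 1 / \<tau>) / of_nat N) *
      (exp (pi_i * (of_int (a - int k) + (- 1 / \<tau>) * of_int (a - int k) + (- 1 / \<tau>) * of_int (a - int k) ^ 2 / of_nat N - 2 * of_int (a - int k) * (U / \<tau>) / of_nat N)) *
       exp (pi_i * (of_int b - of_int (a - int k) * (- 1 / \<tau>))))) =
      ?E0 * ?Eb * exp (neg_two_pi_i * of_int b * of_int (int k + - a) / of_nat N)"
      unfolding minus_one_power exp_add[symmetric]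
      by (rule arg_cong[of _ _ exp]) (use N' t0 in \<open>simp add: field_simps power2_eq_square\<close>)
    then have e: "exp (pi_i * ?u\<^sup>2 / (of_nat N * \<tau>)) * ((-1) ^ k *
      exp (neg_two_pi_i * of_nat k * ((of_int a + of_int b * \<tau>) / \<tau> + U / \<tau>) / of_nat N - pi_i * of_nat (k\<^sup>2) * (- 1 / \<tau>) / of_nat N) *
      (exp (pi_i * (of_int (a - int k) + (- 1 / \<tau>) * of_int (a - int k) + (- 1 / \<tau>) * of_int (a - int k) ^ 2 / of_nat N - 2 * of_int (a - int k) * (U / \<tau>) / of_nat N)) *
       exp (pi_i * (of_int b - of_int (a - int k) * (- 1 / \<tau>))))) * (- (\<tau> / (p * T')) * ?b' (- (a - int k))) =
      ?E0 * ?Eb * exp (neg_two_pi_i * of_int b * of_int (int k + - a) / of_nat N) * (- (\<tau> / (p * T')) * ?b' (- (a - int k)))"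
      by (rule arg_cong)
    have al: "x * (y * w * (\<tau> * (- (g * v) * f / p) / T')) = x * (y * w * (g * f)) * (- (\<tau> / (p * T')) * v)" for x y w g v f
      by (simp add: divide_inverse mult_ac)
    have idx: "- (a - int k) = int k + - a" by simp
    show ?thesis
      unfolding bcoef_inverse[of ?A' "a - int k" "- 1 / \<tau>" N "U / \<tau>"] al e
      unfolding h_def idx by (simp only: mult_ac)
  qed
  have gen: "c * e * sum f K = c * (\<Sum>k\<in>K. e * f k)" for c e :: complex and f :: "nat \<Rightarrow> complex" and K
    by (simp add: sum_distrib_left mult.assoc)
  have "Cfac N \<tau> ?u * (\<Sum>k<N. (-1) ^ k *
      exp (neg_two_pi_i * of_nat k * ((of_int a + of_int b * \<tau>) / \<tau> + U / \<tau>) / of_nat N - pi_i * of_nat (k\<^sup>2) * (- 1 / \<tau>) / of_nat N) *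
      (\<tau> * (- ?A' (a - int k) * exp (pi_i * (of_int b - of_int (a - int k) * (- 1 / \<tau>))) / p) / T')) =
     (- \<i>) ^ (N + 1) / ?R * (\<Sum>k<N. - (\<tau> / (p * T')) * (?E0 * ?Eb) * h (int k + - a))"
    unfolding Cfac_def gen summand ..
  also have "\<dots> = (- \<i>) ^ (N + 1) / ?R * (- (\<tau> / (p * T')) * (?E0 * ?Eb) * S)"
    unfolding sum_distrib_left[symmetric] hS ..
  also have "\<dots> = - (bcoef ?A N \<tau> U b * ?Eb) / (p * T)"
  proof -
    have R2: "?R\<^sup>2 = - \<i> * (of_nat N * \<tau>)" by (rule power2_csqrt)
    have R0: "?R \<noteq> 0" using R2 N' t0 by auto
    have id: "of_nat N * bcoef ?A N \<tau> U b * T' = (- \<i>) ^ N * ?E0 * ?R * S * T"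
      unfolding S_def U_def T_def T'_def by (rule residue_identity[OF \<tau> N])
    have p0: "p \<noteq> 0" by (simp add: p_def)
    have "(- \<i>) ^ (N + 1) * \<tau> / ?R = (- \<i>) ^ N * ?R / of_nat N"
      using R0 N' R2 by (simp add: field_simps power2_eq_square)
    then have c: "(- \<i>) ^ (N + 1) / ?R * \<tau> = (- \<i>) ^ N * ?R / of_nat N" by simp
    have "(- \<i>) ^ (N + 1) / ?R * (- (\<tau> / (p * T')) * (?E0 * ?Eb) * S) = ((- \<i>) ^ (N + 1) / ?R * \<tau>) * (- (?E0 * ?Eb * S) / (p * T'))"
      by (simp add: divide_inverse mult_ac)
    also have "\<dots> = - ((- \<i>) ^ N * ?E0 * ?R * S * T) * ?Eb / (of_nat N * p * T' * T)"
      unfolding c using T by (simp add: divide_inverse mult_ac)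
    also have "\<dots> = - (bcoef ?A N \<tau> U b * ?Eb) / (p * T)"
      unfolding id[symmetric] using N' T' T p0 by (simp add: field_simps)
    finally show ?thesis .
  qed
  also have "\<dots> = - ?A (- b) * exp (pi_i * (of_int a - of_int (- b) * \<tau>)) / p / T"
  proof -
    have "exp (pi_i * (of_int (- b) + \<tau> * of_int (- b) + \<tau> * of_int (- b) ^ 2 / of_nat N - 2 * of_int (- b) * U / of_nat N)) *
       exp (pi_i * (of_int a - of_int (- b) * \<tau>)) = ?Eb * exp (two_pi_i * of_int (- b))"
      unfolding exp_add[symmetric] by (rule arg_cong[of _ _ exp]) (use N' in \<open>simp add: field_simps power2_eq_square\<close>)
    then have "?A (- b) * exp (pi_i * (of_int a - of_int (- b) * \<tau>)) = bcoef ?A N \<tau> U b * ?Eb"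
      unfolding exp_2pi_int using bcoef_inverse[of ?A "- b" \<tau> N U] by (simp add: mult_ac)
    then show ?thesis by (simp add: divide_inverse mult_ac)
  qed
  finally show ?thesis unfolding p_def .
qed

lemma Cfac_add:
  assumes "\<tau> \<noteq> 0" "N \<ge> 1"
  shows "Cfac N \<tau> (u + v) = Cfac N \<tau> u * exp (pi_i * (2 * u * v + v\<^sup>2) / (of_nat N * \<tau>))"
proof -
  have "exp (pi_i * (u + v)\<^sup>2 / (of_nat N * \<tau>)) = exp (pi_i * u\<^sup>2 / (of_nat N * \<tau>)) * exp (pi_i * (2 * u * v + v\<^sup>2) / (of_nat N * \<tau>))"
    unfolding exp_add[symmetric] by (rule arg_cong[of _ _ exp]) (simp add: power2_sum add_divide_distrib[symmetric] algebra_simps)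
  then show ?thesis unfolding Cfac_def by (simp only: mult.assoc)
qed

text \<open>A shift by \<tau> is a shift by 1 in z / \<tau>. By (i) at -1/\<tau> it multiplies
  component k by - exp (- 2 pi i k / N), which raises the row index: inversion exchanges the roles
  of (i) and (ii).\<close>

lemma MtS_Suc:
  assumes N: "N \<ge> 1" and \<tau>: "Im \<tau> > 0" and z: "z \<notin> lattice \<tau>"
  shows "MtS N uu \<tau> (Suc j) z = - exp (neg_two_pi_i * (z + (\<Sum>j\<in>{1..N}. uu j)) / of_nat N) * qpow \<tau> (- 1 / (2 * of_nat N)) * MtS N uu \<tau> j (z + \<tau>)"
proof -
  have N': "of_nat N \<noteq> (0::complex)" and t0: "\<tau> \<noteq> 0" using N \<tau> by auto
  let ?U = "\<Sum>j\<in>{1..N}. uu j" and ?V = "\<lambda>z k. MtN N ((\<lambda>j. uu j / \<tau>)(0 := z)) (- 1 / \<tau>) k"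
  let ?c = "exp (neg_two_pi_i * (z + ?U) / of_nat N) * qpow \<tau> (- 1 / (2 * of_nat N))"
  have z': "z / \<tau> \<notin> lattice (- 1 / \<tau>)" using z lattice_inversion[OF t0] by simp
  have C: "?c * Cfac N \<tau> (z + \<tau> + ?U) = Cfac N \<tau> (z + ?U)"
  proof -
    have "?c * exp (pi_i * (2 * (z + ?U) * \<tau> + \<tau>\<^sup>2) / (of_nat N * \<tau>)) = exp 0"
      unfolding qpow_def exp_add[symmetric] by (rule arg_cong[of _ _ exp]) (use N' t0 in \<open>simp add: field_simps power2_eq_square\<close>)
    moreover have eq: "z + \<tau> + ?U = (z + ?U) + \<tau>" by simp
    ultimately show ?thesis unfolding eq Cfac_add[OF t0 N, of "z + ?U" "\<tau>"] by (simp add: mult_ac)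
  qed
  have "exp (neg_two_pi_i * of_nat j * of_nat k / of_nat N) * ?V ((z + \<tau>) / \<tau>) k =
     - (exp (neg_two_pi_i * of_nat (Suc j) * of_nat k / of_nat N) * ?V (z / \<tau>) k)" for k
  proof -
    have "(z + \<tau>) / \<tau> = z / \<tau> + 1" using t0 by (simp add: add_divide_distrib)
    moreover have "exp (neg_two_pi_i * of_nat j * of_nat k / of_nat N) * exp (neg_two_pi_i * of_nat k / of_nat N) =
       exp (neg_two_pi_i * of_nat (Suc j) * of_nat k / of_nat N)"
      unfolding exp_add[symmetric] by (rule arg_cong[of _ _ exp]) (use N' in \<open>simp add: field_simps\<close>)
    ultimately show ?thesis using MtN_plus_1[OF N Im_minus_inverse_pos[OF \<tau>] z', of "\<lambda>j. uu j / \<tau>" k]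
      by (simp add: mult.assoc[symmetric])
  qed
  then have "MtS N uu \<tau> j (z + \<tau>) = - (Cfac N \<tau> (z + \<tau> + ?U) *
     (\<Sum>k<N. exp (neg_two_pi_i * of_nat (Suc j) * of_nat k / of_nat N) * ?V (z / \<tau>) k))"
    unfolding MtS_def by (simp add: sum_negf)
  then have "- ?c * MtS N uu \<tau> j (z + \<tau>) = (?c * Cfac N \<tau> (z + \<tau> + ?U)) *
     (\<Sum>k<N. exp (neg_two_pi_i * of_nat (Suc j) * of_nat k / of_nat N) * ?V (z / \<tau>) k)"
    by (simp only: mult_minus_left mult_minus_right minus_minus mult.assoc)
  then show ?thesis unfolding C MtS_def by simp
qed

text \<open>A shift by 1 is a shift of z / \<tau> by minus the dual period. By (ii) at -1/\<tau> it
  permutes the components cyclically, with \<open>MtN_N_eq_0\<close> closing the cycle, so their sum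
  only gains a factor, which \<open>Cfac\<close> absorbs up to sign.\<close>

lemma MtS_0_plus_1:
  assumes N: "N \<ge> 1" and \<tau>: "Im \<tau> > 0" and uu: "\<And>j. j \<in> {1..N} \<Longrightarrow> uu j \<notin> lattice \<tau>" and z: "z \<notin> lattice \<tau>"
  shows "MtS N uu \<tau> 0 (z + 1) = - MtS N uu \<tau> 0 z"
proof -
  have N': "of_nat N \<noteq> (0::complex)" and t0: "\<tau> \<noteq> 0" using N \<tau> by auto
  let ?U = "\<Sum>j\<in>{1..N}. uu j" and ?V = "\<lambda>z k. MtN N ((\<lambda>j. uu j / \<tau>)(0 := z)) (- 1 / \<tau>) k"
  let ?y = "(z + 1) / \<tau>"
  let ?c = "exp (neg_two_pi_i * (?y + (\<Sum>j\<in>{1..N}. uu j / \<tau>)) / of_nat N) * qpow (- 1 / \<tau>) (- 1 / (2 * of_nat N))"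
  have "z + 1 \<notin> lattice \<tau>" using z lattice_add_iff[of z 1 0 \<tau>] by simp
  then have y: "?y \<notin> lattice (- 1 / \<tau>)" unfolding lattice_inversion[OF t0] .
  have uu': "uu j / \<tau> \<notin> lattice (- 1 / \<tau>)" if "j \<in> {1..N}" for j
    unfolding lattice_inversion[OF t0] by (rule uu[OF that])
  have yz: "?y + (- 1 / \<tau>) = z / \<tau>" using t0 by (simp add: field_simps)
  have "(\<Sum>k<N. ?V ?y k) + ?V ?y N = ?V ?y 0 + (\<Sum>k<N. ?V ?y (Suc k))"
    using sum.lessThan_Suc_shift[of "?V ?y" N] by simp
  moreover have "?V ?y N = ?V ?y 0"
    by (rule MtN_N_eq_0[OF N Im_minus_inverse_pos[OF \<tau>] uu' y])
  ultimately have "(\<Sum>k<N. ?V ?y k) = (\<Sum>k<N. ?V ?y (Suc k))" by simp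
  also have "\<dots> = (\<Sum>k<N. - ?c * ?V (z / \<tau>) k)"
    using MtN_Suc[OF N Im_minus_inverse_pos[OF \<tau>], of "\<lambda>j. uu j / \<tau>" ?y] unfolding yz by (intro sum.cong refl) simp
  also have "\<dots> = - ?c * (\<Sum>k<N. ?V (z / \<tau>) k)" by (rule sum_distrib_left[symmetric])
  finally have V: "(\<Sum>k<N. ?V ?y k) = - ?c * (\<Sum>k<N. ?V (z / \<tau>) k)" .
  have C: "Cfac N \<tau> (z + 1 + ?U) * ?c = Cfac N \<tau> (z + ?U)"
  proof -
    have "exp (pi_i * (2 * (z + ?U) * 1 + 1\<^sup>2) / (of_nat N * \<tau>)) * ?c = exp 0"
      unfolding qpow_def exp_add[symmetric] sum_divide_distrib[symmetric]
      by (rule arg_cong[of _ _ exp]) (use N' t0 in \<open>simp add: field_simps power2_eq_square\<close>)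
    moreover have eq: "z + 1 + ?U = (z + ?U) + 1" by simp
    ultimately show ?thesis unfolding eq Cfac_add[OF t0 N, of "z + ?U" "1"] by (simp add: mult.assoc)
  qed
  have "MtS N uu \<tau> 0 (z + 1) = Cfac N \<tau> (z + 1 + ?U) * (\<Sum>k<N. ?V ?y k)" unfolding MtS_def by simp
  also have "\<dots> = - ((Cfac N \<tau> (z + 1 + ?U) * ?c) * (\<Sum>k<N. ?V (z / \<tau>) k))"
    unfolding V by (simp only: mult_minus_left mult_minus_right mult.assoc)
  also have "\<dots> = - MtS N uu \<tau> 0 z" unfolding C MtS_def by simp
  finally show ?thesis .
qed

text \<open>This is a shift by N in z / \<tau>. The N-th power of each root of unity in (i) is 1, so
  all components change by the same sign and the exponential comes from \<open>Cfac\<close>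
  alone.\<close>

lemma MtS_0_plus_period:
  assumes N: "N \<ge> 1" and \<tau>: "Im \<tau> > 0" and z: "z \<notin> lattice \<tau>"
  shows "MtS N uu \<tau> 0 (z + of_nat N * \<tau>) =
    (-1) ^ N * exp (two_pi_i * (z + (\<Sum>j\<in>{1..N}. uu j)) + pi_i * of_nat N * \<tau>) * MtS N uu \<tau> 0 z"
proof -
  have N': "of_nat N \<noteq> (0::complex)" and t0: "\<tau> \<noteq> 0" using N \<tau> by auto
  let ?U = "\<Sum>j\<in>{1..N}. uu j" and ?V = "\<lambda>z k. MtN N ((\<lambda>j. uu j / \<tau>)(0 := z)) (- 1 / \<tau>) k"
  let ?x = "exp (two_pi_i * (z + ?U) + pi_i * of_nat N * \<tau>)"
  have z': "z / \<tau> \<notin> lattice (- 1 / \<tau>)" using z lattice_inversion[OF t0] by simp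
  have "(z + of_nat N * \<tau>) / \<tau> = z / \<tau> + of_nat N" using t0 by (simp add: add_divide_distrib)
  then have V: "?V ((z + of_nat N * \<tau>) / \<tau>) k = (-1) ^ N * ?V (z / \<tau>) k" for k
    using MtN_plus_of_nat[OF N Im_minus_inverse_pos[OF \<tau>] z', of "\<lambda>j. uu j / \<tau>" N k]
    unfolding exp_minus_2pi_nat[OF N] by simp
  have C: "Cfac N \<tau> (z + of_nat N * \<tau> + ?U) = Cfac N \<tau> (z + ?U) * ?x"
  proof -
    have "exp (pi_i * (2 * (z + ?U) * (of_nat N * \<tau>) + (of_nat N * \<tau>)\<^sup>2) / (of_nat N * \<tau>)) = ?x"
      by (rule arg_cong[of _ _ exp]) (use N' t0 in \<open>simp add: field_simps power2_eq_square\<close>)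
    moreover have eq: "z + of_nat N * \<tau> + ?U = (z + ?U) + of_nat N * \<tau>" by simp
    ultimately show ?thesis unfolding eq Cfac_add[OF t0 N, of "z + ?U" "of_nat N * \<tau>"] by simp
  qed
  show ?thesis unfolding MtS_def V C by (simp add: sum_distrib_left[symmetric] mult_ac)
qed

lemma MtS_0_eq_MtN:
  assumes N: "N \<ge> 1" and \<tau>: "Im \<tau> > 0" and uu: "\<And>j. j \<in> {1..N} \<Longrightarrow> uu j \<notin> lattice \<tau>" and z: "z \<notin> lattice \<tau>"
  shows "MtS N uu \<tau> 0 z = MtN N (uu(0 := z)) \<tau> 0"
proof -
  have N': "of_nat N \<noteq> (0::complex)" and t0: "\<tau> \<noteq> 0" using N \<tau> by auto
  note \<tau>' = Im_minus_inverse_pos[OF \<tau>]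
  define U where "U = (\<Sum>j\<in>{1..N}. uu j)"
  define T where "T = (\<Prod>j\<in>{1..N}. theta (uu j) \<tau>)"
  define T' where "T' = (\<Prod>j\<in>{1..N}. theta (uu j / \<tau>) (- 1 / \<tau>))"
  define A where "A = acoef N uu \<tau>"
  define A' where "A' = acoef N (\<lambda>j. uu j / \<tau>) (- 1 / \<tau>)"
  define Rd where "Rd = (\<lambda>u. Cfac N \<tau> u * (\<Sum>k<N. RN N (u / \<tau>) (- 1 / \<tau>) k) - RN N u \<tau> 0)"
  define E where "E = (\<lambda>k z. (-1) ^ k * exp (neg_two_pi_i * of_nat k * (z / \<tau> + U / \<tau>) / of_nat N - pi_i * of_nat (k\<^sup>2) * (- 1 / \<tau>) / of_nat N))"
  \<comment> \<open>\<open>F\<close> separates the polar Appell sums from the entire term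
    \<open>Rd\<close>. Its agreement with the difference of the two sides is asserted off the
    lattice, which is all that the extension \<open>g\<close> requires.\<close>
  define F where "F = (\<lambda>z. Cfac N \<tau> (z + U) * (\<Sum>k<N. E k z * (appell A' (- 1 / \<tau>) (z / \<tau> + of_nat k * (- 1 / \<tau>)) / T')) - appell A \<tau> z / T + \<i> / 2 * Rd (z + U))"
  have T0: "T \<noteq> 0" unfolding T_def using theta_nonzero[OF \<tau> uu] by simp
  have uu': "uu j / \<tau> \<notin> lattice (- 1 / \<tau>)" if "j \<in> {1..N}" for j
    unfolding lattice_inversion[OF t0] by (rule uu[OF that])
  have T0': "T' \<noteq> 0" unfolding T'_def using theta_nonzero[OF \<tau>' uu'] by simp
  have holR: "Rd holomorphic_on UNIV" unfolding Rd_def by (rule holomorphic_RN_defect[OF N \<tau>])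
  have holC: "(\<lambda>z. Cfac N \<tau> (z + U)) holomorphic_on S" for S
    unfolding Cfac_def using N' t0 by (intro holomorphic_intros) auto
  have holE: "E k holomorphic_on S" for k S
    unfolding E_def using N' t0 by (intro holomorphic_intros) auto
  have holA: "appell A \<tau> holomorphic_on - lattice \<tau>"
    unfolding A_def by (rule holomorphic_appell[OF \<tau> acoef_summable[OF \<tau>]])
  have holA': "(\<lambda>z. appell A' (- 1 / \<tau>) (z / \<tau> + of_nat k * (- 1 / \<tau>))) holomorphic_on - lattice \<tau>" for k
  proof -
    have "(\<lambda>z. z / \<tau> + of_nat k * (- 1 / \<tau>)) ` (- lattice \<tau>) \<subseteq> - lattice (- 1 / \<tau>)"
    proof (clarify)
      fix z assume "z \<notin> lattice \<tau>" "z / \<tau> + of_nat k * (- 1 / \<tau>) \<in> lattice (- 1 / \<tau>)"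
      then show False using lattice_add_iff[of "z / \<tau>" 0 "int k" "- 1 / \<tau>"] lattice_inversion[OF t0, of z] by simp
    qed
    moreover have "(\<lambda>z. z / \<tau> + of_nat k * (- 1 / \<tau>)) holomorphic_on - lattice \<tau>"
      using t0 by (intro holomorphic_intros) auto
    moreover have "appell A' (- 1 / \<tau>) holomorphic_on - lattice (- 1 / \<tau>)"
      unfolding A'_def by (rule holomorphic_appell[OF \<tau>' acoef_summable[OF \<tau>']])
    ultimately show ?thesis
      using holomorphic_on_compose_gen[of "\<lambda>z. z / \<tau> + of_nat k * (- 1 / \<tau>)" "- lattice \<tau>" "appell A' (- 1 / \<tau>)" "- lattice (- 1 / \<tau>)"]
      by (simp add: o_def image_subset_iff_funcset)
  qed
  have Feq: "MtS N uu \<tau> 0 z - MtN N (uu(0 := z)) \<tau> 0 = F z" if z: "z \<notin> lattice \<tau>" for z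
  proof -
    have z': "z / \<tau> \<notin> lattice (- 1 / \<tau>)" using z lattice_inversion[OF t0] by simp
    have U': "(\<Sum>j\<in>{1..N}. uu j / \<tau>) = U / \<tau>" by (simp add: U_def sum_divide_distrib)
    have zU: "z / \<tau> + U / \<tau> = (z + U) / \<tau>" by (simp add: add_divide_distrib)
    have k: "MtN N ((\<lambda>j. uu j / \<tau>)(0 := z / \<tau>)) (- 1 / \<tau>) k = E k z * (appell A' (- 1 / \<tau>) (z / \<tau> + of_nat k * (- 1 / \<tau>)) / T') +
       \<i> / 2 * RN N ((z + U) / \<tau>) (- 1 / \<tau>) k" for k
      unfolding MtN_def MN_formula[OF N \<tau>' z'] sum_upd_0 U' zU[symmetric] E_def A'_def T'_def ..
    have S: "(\<Sum>k<N. exp (neg_two_pi_i * of_nat 0 * of_nat k / of_nat N) * MtN N ((\<lambda>j. uu j / \<tau>)(0 := z / \<tau>)) (- 1 / \<tau>) k) =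
       (\<Sum>k<N. E k z * (appell A' (- 1 / \<tau>) (z / \<tau> + of_nat k * (- 1 / \<tau>)) / T')) + \<i> / 2 * (\<Sum>k<N. RN N ((z + U) / \<tau>) (- 1 / \<tau>) k)"
      unfolding k by (simp add: sum.distrib sum_distrib_left)
    have M0: "MtN N (uu(0 := z)) \<tau> 0 = appell A \<tau> z / T + \<i> / 2 * RN N (z + U) \<tau> 0"
      unfolding MtN_def MN_formula[OF N \<tau> z] sum_upd_0 U_def A_def T_def by simp
    show ?thesis unfolding MtS_def S M0 F_def Rd_def U_def[symmetric] by (simp add: algebra_simps)
  qed
  obtain g where g: "g holomorphic_on UNIV" "\<And>z. z \<notin> lattice \<tau> \<Longrightarrow> g z = F z"
  proof (rule entire_extension[of F "lattice \<tau>"])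
    show "F holomorphic_on - lattice \<tau>"
      unfolding F_def using T0 T0'
      by (intro holomorphic_intros holC holE holA holA' holomorphic_on_compose_entire[OF holR]) auto
    show "closed (lattice \<tau>)" by (rule closed_lattice[OF \<tau>])
    fix z0 assume z0: "z0 \<in> lattice \<tau>"
    then show "\<exists>r>0. ball z0 r \<inter> lattice \<tau> \<subseteq> {z0}" by (rule lattice_isolated[OF \<tau>])
    obtain a b where ab: "z0 = of_int a + of_int b * \<tau>" using z0 by (auto simp: lattice_def)
    have cont: "isCont f z0" if "f holomorphic_on UNIV" for f
      using that by (metis UNIV_I continuous_on_eq_continuous_at holomorphic_on_imp_continuous_on open_UNIV)
    \<comment> \<open>The residue of the dual Appell sum at b - (a - k)(-1/\<tau>), the image of
      \<open>z0\<close> under the affine map in its argument. The factor \<tau> is the derivative of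
      the inverse map.\<close>
    let ?L = "\<lambda>k. \<tau> * (- A' (a - int k) * exp (pi_i * (of_int b - of_int (a - int k) * (- 1 / \<tau>))) / (two_pi_i))"
    have L: "((\<lambda>z. (z - z0) * appell A' (- 1 / \<tau>) (z / \<tau> + of_nat k * (- 1 / \<tau>))) \<longlongrightarrow> ?L k) (at z0)" for k
    proof -
      let ?pt = "of_int b - of_int (a - int k) * (- 1 / \<tau>)" and ?w = "\<lambda>z. z / \<tau> + of_nat k * (- 1 / \<tau>)"
      have w0: "?w z0 = ?pt" using t0 by (simp add: ab field_simps)
      have "filterlim ?w (at ?pt) (at z0)"
      proof (rule filterlim_atI)
        have "(?w \<longlongrightarrow> ?w z0) (at z0)" using t0 by (intro tendsto_intros) auto
        then show "(?w \<longlongrightarrow> ?pt) (at z0)" unfolding w0 .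
        have "?w z \<noteq> ?pt" if "z \<noteq> z0" for z using that t0 unfolding w0[symmetric] by simp
        then show "eventually (\<lambda>z. ?w z \<noteq> ?pt) (at z0)" by (auto simp: eventually_at_filter)
      qed
      from filterlim_compose[OF appell_residue[OF \<tau>' acoef_summable[OF \<tau>'] refl, of b "a - int k" N "\<lambda>j. uu j / \<tau>"] this]
      have "((\<lambda>z. \<tau> * ((?w z - ?pt) * appell A' (- 1 / \<tau>) (?w z))) \<longlongrightarrow> ?L k) (at z0)"
        unfolding A'_def[symmetric] by (intro tendsto_mult tendsto_const)
      moreover have "\<tau> * ((?w z - ?pt) * appell A' (- 1 / \<tau>) (?w z)) = (z - z0) * appell A' (- 1 / \<tau>) (?w z)" for z
      proof -
        have "\<tau> * (?w z - ?pt) = z - z0" unfolding w0[symmetric] using t0 by (simp add: field_simps)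
        then show ?thesis by (simp only: mult.assoc[symmetric])
      qed
      ultimately show ?thesis by (simp only:)
    qed
    let ?LA = "- A (- b) * exp (pi_i * (of_int a - of_int (- b) * \<tau>)) / (two_pi_i)"
    have z0': "z0 = of_int a - of_int (- b) * \<tau>" by (simp add: ab)
    have LA: "((\<lambda>z. (z - z0) * appell A \<tau> z) \<longlongrightarrow> ?LA) (at z0)"
      using appell_residue[OF \<tau> acoef_summable[OF \<tau>] z0', of N uu] unfolding A_def z0' by simp
    have "((\<lambda>z. Cfac N \<tau> (z + U) * (\<Sum>k<N. E k z * ((z - z0) * appell A' (- 1 / \<tau>) (z / \<tau> + of_nat k * (- 1 / \<tau>)) / T')) -
        (z - z0) * appell A \<tau> z / T + (z - z0) * (\<i> / 2 * Rd (z + U))) \<longlongrightarrow>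
      Cfac N \<tau> (z0 + U) * (\<Sum>k<N. E k z0 * (?L k / T')) - ?LA / T + (z0 - z0) * (\<i> / 2 * Rd (z0 + U))) (at z0)"
    proof (rule tendsto_add[OF tendsto_diff[OF tendsto_mult[OF _ tendsto_sum[OF tendsto_mult[OF _ tendsto_divide[OF L tendsto_const T0']]]]
            tendsto_divide[OF LA tendsto_const T0]] tendsto_mult[OF _ tendsto_mult[OF tendsto_const]]])
      show "((\<lambda>z. Cfac N \<tau> (z + U)) \<longlongrightarrow> Cfac N \<tau> (z0 + U)) (at z0)" using cont[OF holC] by (simp add: isCont_def)
      show "(E k \<longlongrightarrow> E k z0) (at z0)" for k using cont[OF holE] by (simp add: isCont_def)
      have "(\<lambda>z. Rd (z + U)) holomorphic_on UNIV" by (intro holomorphic_on_compose_entire[OF holR] holomorphic_intros)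
      from cont[OF this] show "((\<lambda>z. Rd (z + U)) \<longlongrightarrow> Rd (z0 + U)) (at z0)" by (simp add: isCont_def)
      show "((\<lambda>z. z - z0) \<longlongrightarrow> z0 - z0) (at z0)" by (intro tendsto_intros)
    qed
    moreover have "Cfac N \<tau> (z0 + U) * (\<Sum>k<N. E k z0 * (?L k / T')) = ?LA / T"
      using MtS_residue_match[OF N \<tau>, of uu a b] T0 T0' unfolding E_def ab A_def A'_def T_def T'_def U_def by blast
    moreover have "(z - z0) * F z = Cfac N \<tau> (z + U) * (\<Sum>k<N. E k z * ((z - z0) * appell A' (- 1 / \<tau>) (z / \<tau> + of_nat k * (- 1 / \<tau>)) / T')) -
        (z - z0) * appell A \<tau> z / T + (z - z0) * (\<i> / 2 * Rd (z + U))" for z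
    proof -
      have "(z - z0) * (Cfac N \<tau> (z + U) * (\<Sum>k<N. E k z * (appell A' (- 1 / \<tau>) (z / \<tau> + of_nat k * (- 1 / \<tau>)) / T'))) =
        Cfac N \<tau> (z + U) * (\<Sum>k<N. E k z * ((z - z0) * appell A' (- 1 / \<tau>) (z / \<tau> + of_nat k * (- 1 / \<tau>)) / T'))"
        unfolding sum_distrib_left by (intro sum.cong refl) (simp only: times_divide_eq_right mult_ac)
      then show ?thesis unfolding F_def by (simp add: distrib_left right_diff_distrib)
    qed
    ultimately show "((\<lambda>z. (z - z0) * F z) \<longlongrightarrow> 0) (at z0)" by simp
  qed blast
  have cg: "continuous_on UNIV g" using g(1) holomorphic_on_imp_continuous_on by blast
  have g1: "g (z + 1) = - g z" for z
  proof (rule continuous_eq_off_countable[OF countable_lattice[of \<tau>], of "\<lambda>z. g (z + 1)" "\<lambda>z. - g z"])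
    show "continuous_on UNIV (\<lambda>z. g (z + 1))" by (rule continuous_on_compose2[OF cg]) (auto intro!: continuous_intros)
    show "continuous_on UNIV (\<lambda>z. - g z)" by (intro continuous_intros cg)
    fix z assume z: "z \<notin> lattice \<tau>"
    then have z1: "z + 1 \<notin> lattice \<tau>" using lattice_add_iff[of z 1 0 \<tau>] by simp
    have "MtN N (uu(0 := z + 1)) \<tau> 0 = - MtN N (uu(0 := z)) \<tau> 0" using MtN_plus_1[OF N \<tau> z, of uu 0] by simp
    then show "g (z + 1) = - g z"
      using MtS_0_plus_1[where uu = uu, OF N \<tau> uu z] unfolding g(2)[OF z] g(2)[OF z1] Feq[OF z, symmetric] Feq[OF z1, symmetric] by simp
  qed
  let ?x = "\<lambda>z. (-1) ^ N * exp (two_pi_i * (z + U) + pi_i * of_nat N * \<tau>)"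
  have gN: "g (z + of_nat N * \<tau>) = ?x z * g z" for z
  proof (rule continuous_eq_off_countable[OF countable_lattice[of \<tau>], of "\<lambda>z. g (z + of_nat N * \<tau>)" "\<lambda>z. ?x z * g z"])
    show "continuous_on UNIV (\<lambda>z. g (z + of_nat N * \<tau>))" by (rule continuous_on_compose2[OF cg]) (auto intro!: continuous_intros)
    show "continuous_on UNIV (\<lambda>z. ?x z * g z)" by (intro continuous_intros cg)
    fix z assume z: "z \<notin> lattice \<tau>"
    then have z1: "z + of_nat N * \<tau> \<notin> lattice \<tau>" using lattice_add_iff[of z 0 "int N" \<tau>] by simp
    let ?y = "exp (neg_two_pi_i * (z + U) - pi_i * of_nat N * \<tau>)"
    have "MtN N (uu(0 := z)) \<tau> 0 = (-1) ^ N * ?y * MtN N (uu(0 := z + of_nat N * \<tau>)) \<tau> 0"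
      using MtN_N_eq_0[where uu = uu, OF N \<tau> uu z] MtN_N_shift[OF N \<tau>, of uu z] unfolding U_def by simp
    then have "?x z * MtN N (uu(0 := z)) \<tau> 0 = (?x z * ((-1) ^ N * ?y)) * MtN N (uu(0 := z + of_nat N * \<tau>)) \<tau> 0"
      by (simp only: mult.assoc)
    also have "?x z * ((-1) ^ N * ?y) = 1"
    proof -
      have "((-1) ^ N * (-1) ^ N) * (exp (two_pi_i * (z + U) + pi_i * of_nat N * \<tau>) * ?y) = 1"
        unfolding exp_add[symmetric] power_mult_distrib[symmetric] by simp
      then show ?thesis by (simp only: mult_ac)
    qed
    finally have M: "MtN N (uu(0 := z + of_nat N * \<tau>)) \<tau> 0 = ?x z * MtN N (uu(0 := z)) \<tau> 0"
      by (simp only: mult_1_left)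
    show "g (z + of_nat N * \<tau>) = ?x z * g z"
      unfolding g(2)[OF z] g(2)[OF z1] Feq[OF z, symmetric] Feq[OF z1, symmetric] M
        MtS_0_plus_period[OF N \<tau> z] U_def[symmetric] by (simp only: right_diff_distrib)
  qed
  \<comment> \<open>The factor exp (pi i z) turns the antiperiod 1 into a period. Its change under N
    \<tau> supplies half of the term 2 pi i N \<tau> in \<open>\<kappa>\<close>, and N pi i encodes
    the sign (-1)^N.\<close>
  have "exp (pi_i * z) * g z = 0" for z
  proof (rule entire_negative_degree_eq_0[where D = "\<lambda>z. exp (pi_i * z) * g z" and s = "of_nat N * \<tau>"
        and \<kappa> = "of_nat N * (pi_i) + two_pi_i * U + two_pi_i * of_nat N * \<tau>"])
    show "(\<lambda>z. exp (pi_i * z) * g z) holomorphic_on UNIV" by (intro holomorphic_intros g(1))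
    show "exp (pi_i * (z + 1)) * g (z + 1) = exp (pi_i * z) * g z" for z
      unfolding g1 by (simp add: ring_distribs exp_add)
    show "Im (of_nat N * \<tau>) > 0" using N \<tau> by simp
    show "exp (pi_i * (z + of_nat N * \<tau>)) * g (z + of_nat N * \<tau>) =
      exp (of_nat N * (pi_i) + two_pi_i * U + two_pi_i * of_nat N * \<tau> + two_pi_i * z) * (exp (pi_i * z) * g z)" for z
      unfolding gN minus_one_power mult.assoc[symmetric] exp_add[symmetric]
      by (rule arg_cong[of _ _ "\<lambda>w. exp w * g z"]) (simp add: algebra_simps)
  qed
  then have "g z = 0" by simp
  then show ?thesis using g(2)[OF z] Feq[OF z] by simp
qed

text \<open>Both sides obey the same recursion, which raises the row while shifting z by \<tau>. Row
  0 therefore settles all rows, provided that z varies in the induction.\<close>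

lemma MtS_eq_MtN:
  assumes N: "N \<ge> 1" and \<tau>: "Im \<tau> > 0" and uu: "\<And>j. j \<in> {1..N} \<Longrightarrow> uu j \<notin> lattice \<tau>" and z: "z \<notin> lattice \<tau>"
  shows "MtS N uu \<tau> j z = MtN N (uu(0 := z)) \<tau> j"
  using z
proof (induction j arbitrary: z)
  case 0 show ?case by (rule MtS_0_eq_MtN[OF N \<tau> uu 0])
next
  case (Suc j)
  have "z + \<tau> \<notin> lattice \<tau>" using Suc.prems lattice_add_period by simp
  note IH = Suc.IH[OF this]
  show ?case unfolding MtS_Suc[OF N \<tau> Suc.prems] MtN_Suc[OF N \<tau>] IH ..
qed

section \<open>Translation of \<tau> by 1\<close>

lemma muN_tau_plus_1:
  "muN N (w + of_nat k) uu (\<tau> + 1) = (-1) ^ k * exp (- (pi_i * of_nat N / 4)) * muN N w uu \<tau>"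
proof -
  have q1: "qpow (\<tau> + 1) (of_int n) = qpow \<tau> (of_int n)" for n
  proof -
    have "qpow (\<tau> + 1) (of_int n) = qpow \<tau> (of_int n) * exp (two_pi_i * of_int n)"
      unfolding qpow_def exp_add[symmetric] by (rule arg_cong[of _ _ exp]) (simp add: algebra_simps)
    then show ?thesis by simp
  qed
  have q2: "qpow (\<tau> + 1) (of_int (n * (n + 1)) / 2) = qpow \<tau> (of_int (n * (n + 1)) / 2)" for n
  proof -
    have "even (n * (n + 1))" by simp
    then obtain m where m: "n * (n + 1) = 2 * m" by blast
    have "of_int (n * (n + 1)) / 2 = (of_int m :: complex)" unfolding m by simp
    then show ?thesis by (simp only: q1)
  qed
  have e1: "exp (pi_i * (w + of_nat k)) = (-1) ^ k * exp (pi_i * w)"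
    unfolding minus_one_power exp_add[symmetric] by (rule arg_cong[of _ _ exp]) (simp add: algebra_simps)
  have e2: "exp (two_pi_i * (w + of_nat k)) = exp (two_pi_i * w)"
  proof -
    have "exp (two_pi_i * (w + of_nat k)) = exp (two_pi_i * w) * exp (two_pi_i * of_int (int k))"
      unfolding exp_add[symmetric] by (rule arg_cong[of _ _ exp]) (simp add: algebra_simps)
    then show ?thesis unfolding exp_2pi_int by simp
  qed
  \<comment> \<open>The q-powers in the summand are unchanged, so besides the sign from the shift of
    the first argument only one factor exp (- pi i / 4) per theta denominator appears.\<close>
  have c: "(\<Prod>j\<in>{1..N}. f j / theta (uu j) (\<tau> + 1)) = exp (- (pi_i * of_nat N / 4)) * (\<Prod>j\<in>{1..N}. f j / theta (uu j) \<tau>)" for f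
  proof -
    have h: "f j / theta (uu j) (\<tau> + 1) = exp (- (pi_i / 4)) * (f j / theta (uu j) \<tau>)" for j
    proof -
      have "x / (y * v) = inverse y * (x / v)" for x y v :: complex by (simp add: divide_inverse)
      then show ?thesis unfolding theta_plus_1 exp_minus .
    qed
    have p: "exp (- (pi_i / 4)) ^ N = exp (- (pi_i * of_nat N / 4))"
      unfolding exp_of_nat_mult[symmetric] by (rule arg_cong[of _ _ exp]) simp
    have "(\<Prod>j\<in>{1..N}. f j / theta (uu j) (\<tau> + 1)) =
       (\<Prod>j\<in>{1..N}. exp (- (pi_i / 4))) * (\<Prod>j\<in>{1..N}. f j / theta (uu j) \<tau>)"
      unfolding h by (rule prod.distrib)
    then show ?thesis by (simp add: p)
  qed
  have "s * e / d * (x * p) = s * x * (e / d * p)" for s e d x p :: complex by (simp add: divide_inverse)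
  then show ?thesis unfolding muN_def infsum_cmult_right'[symmetric] q1 q2 c e1 e2
    by (intro infsum_cong)
qed

text \<open>As m (m + 1) is even, every squared half-integer is 1/4 modulo 2. All terms hence
  acquire one common factor, the same as for the Appell part, while the error functions see only
  imaginary parts.\<close>

lemma Rfun_tau_plus:
  "Rfun (w + of_nat k) (\<sigma> + of_nat N) = (-1) ^ k * exp (- (pi_i * of_nat N / 4)) * Rfun w \<sigma>"
  unfolding Rfun_def Let_def infsum_cmult_right'[symmetric]
proof (intro infsum_cong)
  fix m :: int
  let ?\<nu> = "real_of_int m + 1/2"
  have "even (m * (m + 1))" by simp
  then obtain n where n: "m * (m + 1) = 2 * n" by blast
  have "(of_real (?\<nu>\<^sup>2) :: complex) = of_int (m * (m + 1)) + 1 / 4"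
    by (simp add: power2_eq_square field_simps)
  then have n': "(of_real (?\<nu>\<^sup>2) :: complex) = 2 * of_int n + 1 / 4" unfolding n by simp
  have "exp (neg_two_pi_i * of_real ?\<nu> * (w + of_nat k)) * exp (neg_pi_i * of_real (?\<nu>\<^sup>2) * (\<sigma> + of_nat N)) =
     (-1) ^ k * exp (- (pi_i * of_nat N / 4)) * (exp (neg_two_pi_i * of_real ?\<nu> * w) * exp (neg_pi_i * of_real (?\<nu>\<^sup>2) * \<sigma>)) *
     (exp (two_pi_i * of_int (- (m + 1) * int k)) * exp (two_pi_i * of_int (- n * int N)))"
    unfolding minus_one_power n' exp_add[symmetric] by (rule arg_cong[of _ _ exp]) (simp add: field_simps)
  then have e: "exp (neg_two_pi_i * of_real ?\<nu> * (w + of_nat k)) * exp (neg_pi_i * of_real (?\<nu>\<^sup>2) * (\<sigma> + of_nat N)) =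
     (-1) ^ k * exp (- (pi_i * of_nat N / 4)) * (exp (neg_two_pi_i * of_real ?\<nu> * w) * exp (neg_pi_i * of_real (?\<nu>\<^sup>2) * \<sigma>))"
    unfolding exp_2pi_int mult_1_right .
  have I: "Im (w + of_nat k) = Im w" "Im (\<sigma> + of_nat N) = Im \<sigma>" by simp_all
  show "of_real (sgn ?\<nu> - Efun ((?\<nu> + Im (w + of_nat k) / Im (\<sigma> + of_nat N)) * sqrt (2 * Im (\<sigma> + of_nat N)))) * (-1) powi m *
      exp (neg_two_pi_i * of_real ?\<nu> * (w + of_nat k)) * exp (neg_pi_i * of_real (?\<nu>\<^sup>2) * (\<sigma> + of_nat N)) =
    (-1) ^ k * exp (- (pi_i * of_nat N / 4)) * (of_real (sgn ?\<nu> - Efun ((?\<nu> + Im w / Im \<sigma>) * sqrt (2 * Im \<sigma>))) * (-1) powi m *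
      exp (neg_two_pi_i * of_real ?\<nu> * w) * exp (neg_pi_i * of_real (?\<nu>\<^sup>2) * \<sigma>))"
    unfolding I mult.assoc[of _ "exp (neg_two_pi_i * of_real ?\<nu> * (w + of_nat k))"] e by (simp only: mult_ac)
qed

lemma zeta_power: "N \<ge> 1 \<Longrightarrow> zeta N ^ k = exp (two_pi_i * of_nat k / of_nat N)"
  unfolding zeta_def exp_of_nat_mult[symmetric] by (simp add: mult_ac)

lemma MtN_tau_plus_1:
  assumes N: "N \<ge> 1"
  shows "exp (pi_i * of_nat N / 4) * ((-1) ^ k * zeta (2 * N) ^ (k\<^sup>2) * MtN N uu (\<tau> + 1) k) = MtN N uu \<tau> k"
proof -
  have N': "of_nat N \<noteq> (0::complex)" using N by simp
  let ?u = "\<Sum>j\<le>N. uu j"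
  let ?z = "exp (- (pi_i * of_nat (k\<^sup>2) / of_nat N))"
  let ?e = "exp (- (pi_i * of_nat N / 4))"
  have z: "zeta (2 * N) ^ (k\<^sup>2) = exp (pi_i * of_nat (k\<^sup>2) / of_nat N)"
  proof -
    have "1 \<le> 2 * N" using N by simp
    then show ?thesis unfolding zeta_power[OF \<open>1 \<le> 2 * N\<close>]
      by (intro arg_cong[of _ _ exp]) (use N' in \<open>simp add: field_simps\<close>)
  qed
  have e1: "exp (neg_two_pi_i * of_nat k * ?u / of_nat N - pi_i * of_nat (k\<^sup>2) * (\<tau> + 1) / of_nat N) =
     ?z * exp (neg_two_pi_i * of_nat k * ?u / of_nat N - pi_i * of_nat (k\<^sup>2) * \<tau> / of_nat N)"
    unfolding exp_add[symmetric] by (rule arg_cong[of _ _ exp]) (use N' in \<open>simp add: field_simps\<close>)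
  have e2: "qpow (\<tau> + 1) (- of_nat (k\<^sup>2) / (2 * of_nat N)) = ?z * qpow \<tau> (- of_nat (k\<^sup>2) / (2 * of_nat N))"
    unfolding qpow_def exp_add[symmetric] by (rule arg_cong[of _ _ exp]) (use N' in \<open>simp add: field_simps\<close>)
  have w: "uu 0 + of_nat k * (\<tau> + 1) = uu 0 + of_nat k * \<tau> + of_nat k"
    "?u + of_nat k * (\<tau> + 1) + (of_nat N + 1) / 2 = (?u + of_nat k * \<tau> + (of_nat N + 1) / 2) + of_nat k"
    "of_nat N * (\<tau> + 1) = of_nat N * \<tau> + of_nat N" by (simp_all add: algebra_simps)
  have M: "MN N uu (\<tau> + 1) k = (-1) ^ k * ?z * ?e * MN N uu \<tau> k"
    unfolding MN_def Let_def e1 w muN_tau_plus_1 by (simp only: mult_ac)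
  have R: "RN N ?u (\<tau> + 1) k = (-1) ^ k * ?z * ?e * RN N ?u \<tau> k"
    unfolding RN_def e2 w Rfun_tau_plus by (simp only: mult_ac)
  have "MtN N uu (\<tau> + 1) k = (-1) ^ k * ?z * ?e * MtN N uu \<tau> k"
    unfolding MtN_def M R by (simp only: distrib_left mult_ac)
  moreover have "exp (pi_i * of_nat N / 4) * ((-1) ^ k * exp (pi_i * of_nat (k\<^sup>2) / of_nat N) * ((-1) ^ k * ?z * ?e * X)) = X" for X
  proof -
    have "((-1) ^ k * (-1) ^ k) * (exp (pi_i * of_nat N / 4) * ?e) * (exp (pi_i * of_nat (k\<^sup>2) / of_nat N) * ?z) * X = X"
      unfolding power_mult_distrib[symmetric] exp_add[symmetric] by simp
    then show ?thesis by (simp only: mult_ac)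
  qed
  ultimately show ?thesis unfolding z by simp
qed

lemma matvec_diag: "j < N \<Longrightarrow> matvec N (\<lambda>j k. if j = k then c k else 0) V j = c j * V j"
  unfolding matvec_def by (simp add: if_distrib[of "\<lambda>x. x * _"] cong: if_cong)

lemma matvec_Pmat:
  assumes "j < N" shows "matvec N (Pmat N) V j = V (if j = 0 then N - 1 else j - 1)"
proof -
  let ?i = "if j = 0 then N - 1 else j - 1"
  have "?i < N" using assms by auto
  then show ?thesis unfolding matvec_def Pmat_def by (simp add: if_distrib[of "\<lambda>x. x * _"] cong: if_cong)
qed

theorem theorem1p5:
  fixes N :: nat and uu :: "nat \<Rightarrow> complex" and \<tau> :: complex
  assumes "N \<ge> 1" and "Im \<tau> > 0"
    and "\<forall>j\<le>N. uu j \<notin> lattice \<tau>"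
  defines "u \<equiv> (\<Sum>j\<le>N. uu j)"
  shows
    "(\<forall>j<N. - matvec N (\<lambda>j k. if j = k then zeta N ^ k else 0)
                (MtN N (uu(0 := uu 0 + 1)) \<tau>) j = MtN N uu \<tau> j)
   \<and> (\<forall>j<N. - exp (- 2 * of_real pi * \<i> * u / of_nat N) * qpow \<tau> (- 1 / (2 * of_nat N))
                * matvec N (Pmat N) (MtN N (uu(0 := uu 0 + \<tau>)) \<tau>) j = MtN N uu \<tau> j)
   \<and> (\<forall>j<N. exp (of_real pi * \<i> * of_nat N / 4)
                * matvec N (\<lambda>j k. if j = k then (-1) ^ k * zeta (2 * N) ^ (k\<^sup>2) else 0)
                    (MtN N uu (\<tau> + 1)) j = MtN N uu \<tau> j)
   \<and> (\<forall>j<N. (- \<i>) ^ (N + 1) * exp (of_real pi * \<i> * u\<^sup>2 / (of_nat N * \<tau>))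
                / (of_real (sqrt (real N)) * csqrt (- \<i> * \<tau>))
                * matvec N (\<lambda>j k. inverse (zeta N) ^ (j * k))
                    (MtN N (\<lambda>i. uu i / \<tau>) (- 1 / \<tau>)) j = MtN N uu \<tau> j)"
proof (intro conjI allI impI)
  note N = assms(1) and \<tau> = assms(2)
  have N': "of_nat N \<noteq> (0::complex)" using N by simp
  have u0: "uu 0 \<notin> lattice \<tau>" and uj: "\<And>j. j \<in> {1..N} \<Longrightarrow> uu j \<notin> lattice \<tau>" using assms(3) by auto
  have u: "u = uu 0 + (\<Sum>j\<in>{1..N}. uu j)" using sum_upd_0[of uu "uu 0" N] unfolding u_def by simp
  fix j assume j: "j < N"
  show "- matvec N (\<lambda>j k. if j = k then zeta N ^ k else 0) (MtN N (uu(0 := uu 0 + 1)) \<tau>) j = MtN N uu \<tau> j"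
  proof -
    have "zeta N ^ j * exp (- 2 * of_real pi * \<i> * of_nat j / of_nat N) = exp 0"
      unfolding zeta_power[OF N] exp_add[symmetric] by (rule arg_cong[of _ _ exp]) simp
    then show ?thesis
      unfolding matvec_diag[OF j] MtN_plus_1[OF N \<tau> u0] fun_upd_triv by (simp add: mult.assoc[symmetric])
  qed
  show "- exp (- 2 * of_real pi * \<i> * u / of_nat N) * qpow \<tau> (- 1 / (2 * of_nat N))
                * matvec N (Pmat N) (MtN N (uu(0 := uu 0 + \<tau>)) \<tau>) j = MtN N uu \<tau> j"
  proof (cases "j = 0")
    case True
    \<comment> \<open>The last component at \<open>uu 0 + \<tau>\<close> yields index N, which the
      wrap-around identifies with index 0.\<close>
    have "MtN N uu \<tau> 0 = MtN N (uu(0 := uu 0)) \<tau> (Suc (N - 1))"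
      using MtN_N_eq_0[where uu = uu, OF N \<tau> uj u0] N by simp
    then show ?thesis unfolding matvec_Pmat[OF j] MtN_Suc[OF N \<tau>] u using True by simp
  next
    case False
    have "MtN N uu \<tau> j = MtN N (uu(0 := uu 0)) \<tau> (Suc (j - 1))" using False by simp
    then show ?thesis unfolding matvec_Pmat[OF j] MtN_Suc[OF N \<tau>] u using False by simp
  qed
  show "exp (of_real pi * \<i> * of_nat N / 4)
                * matvec N (\<lambda>j k. if j = k then (-1) ^ k * zeta (2 * N) ^ (k\<^sup>2) else 0)
                    (MtN N uu (\<tau> + 1)) j = MtN N uu \<tau> j"
    unfolding matvec_diag[OF j] by (rule MtN_tau_plus_1[OF N])
  show "(- \<i>) ^ (N + 1) * exp (of_real pi * \<i> * u\<^sup>2 / (of_nat N * \<tau>))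
                / (of_real (sqrt (real N)) * csqrt (- \<i> * \<tau>))
                * matvec N (\<lambda>j k. inverse (zeta N) ^ (j * k))
                    (MtN N (\<lambda>i. uu i / \<tau>) (- 1 / \<tau>)) j = MtN N uu \<tau> j"
  proof -
    have z: "inverse (zeta N) ^ (j * k) = exp (- 2 * of_real pi * \<i> * of_nat j * of_nat k / of_nat N)" for k
      unfolding power_inverse zeta_power[OF N] exp_minus[symmetric] by (rule arg_cong[of _ _ exp]) simp
    have "(\<lambda>i. uu i / \<tau>)(0 := uu 0 / \<tau>) = (\<lambda>i. uu i / \<tau>)" by auto
    then have "MtS N uu \<tau> j (uu 0) = (- \<i>) ^ (N + 1) * exp (of_real pi * \<i> * u\<^sup>2 / (of_nat N * \<tau>))
                / (of_real (sqrt (real N)) * csqrt (- \<i> * \<tau>))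
                * matvec N (\<lambda>j k. inverse (zeta N) ^ (j * k)) (MtN N (\<lambda>i. uu i / \<tau>) (- 1 / \<tau>)) j"
      unfolding MtS_def Cfac_def matvec_def z u csqrt_of_nat_mult[OF \<tau>] by simp
    then show ?thesis using MtS_eq_MtN[where uu = uu and j = j, OF N \<tau> uj u0] by simp
  qed
qed

end
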